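(* Let $(M,g)$ be a closed orientable Riemannian manifold and let $f$ be any smooth function on $M$. A smooth vector field $X$ on $M$ is Killing if and only if it satisfies $$0=\Delta X^i+\nabla^i\operatorname{div}(X)+R^i{}_jX^j+\nabla_jf\,(\mathcal{L}_Xg)^{ij}.$$ (When $f\equiv 0$ this condition reduces to the classical criterion of Yano, $\Delta X^i+\nabla^i\operatorname{div}(X)+R^i{}_jX^j=0$.)
   Context: Closed means compact without boundary. $\nabla$ is the Levi-Civita connection of $g$, $\Delta=g^{k\ell}\nabla_k\nabla_\ell$ is the (rough) Laplacian on vector fields, $\operatorname{div}(X)=\nabla_iX^i$, $R_{ij}$ is the Ricci curvature, and $\mathcal{L}_Xg$ is the Lie derivative of $g$, $(\mathcal{L}_Xg)_{ij}=\nabla_iX_j+\nabla_jX_i$. Indices are raised and lowered with $g$, and repeated indices are summed. $X$ is Killing if $\mathcal{L}_Xg=0$. *)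

theory Defs
  imports "HOL-Analysis.Analysis"
begin

section \<open>Smooth maps on open subsets of normed spaces\<close>

text \<open>The set \<open>S\<close> is always open below. \<open>Ck_on k f S\<close> says that all iterated directional
  derivatives of order at most \<open>k\<close> exist and are continuous on \<open>S\<close>.\<close>

fun Ck_on :: "nat \<Rightarrow> ('a::real_normed_vector \<Rightarrow> 'b::real_normed_vector) \<Rightarrow> 'a set \<Rightarrow> bool" where
  "Ck_on 0 f S \<longleftrightarrow> continuous_on S f"
| "Ck_on (Suc k) f S \<longleftrightarrow>
     (\<forall>x\<in>S. f differentiable (at x)) \<and> (\<forall>v. Ck_on k (\<lambda>x. frechet_derivative f (at x) v) S)"

definition smooth_on :: "'a set \<Rightarrow> ('a::real_normed_vector \<Rightarrow> 'b::real_normed_vector) \<Rightarrow> bool" where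
  "smooth_on S f \<longleftrightarrow> (\<forall>k. Ck_on k f S)"

section \<open>Smooth manifolds\<close>

text \<open>The manifold is the type \<open>'m\<close>, its dimension is \<open>CARD('n)\<close>. A chart is a pair \<open>(U, \<phi>)\<close>;
  the values of \<open>\<phi>\<close> outside \<open>U\<close> are irrelevant.\<close>

type_synonym ('m, 'n) chart = "'m set \<times> ('m \<Rightarrow> real ^ 'n)"

definition inv_chart :: "('m, 'n) chart \<Rightarrow> real ^ 'n \<Rightarrow> 'm" where
  "inv_chart c = inv_into (fst c) (snd c)"

definition is_chart :: "('m::topological_space, 'n::finite) chart \<Rightarrow> bool" where
  "is_chart c \<longleftrightarrow> open (fst c) \<and> open (snd c ` fst c) \<and>
     homeomorphism (fst c) (snd c ` fst c) (snd c) (inv_chart c)"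

definition transition :: "('m, 'n) chart \<Rightarrow> ('m, 'n) chart \<Rightarrow> real ^ 'n \<Rightarrow> real ^ 'n" where
  "transition c d = snd d \<circ> inv_chart c"

definition smooth_atlas :: "('m::topological_space, 'n::finite) chart set \<Rightarrow> bool" where
  "smooth_atlas A \<longleftrightarrow> (\<forall>c\<in>A. is_chart c) \<and> (\<Union>c\<in>A. fst c) = UNIV \<and>
     (\<forall>c\<in>A. \<forall>d\<in>A. smooth_on (snd c ` (fst c \<inter> fst d)) (transition c d))"

text \<open>Entry \<open>k, i\<close> of the following matrix is \<open>\<partial>y\<^sup>k / \<partial>x\<^sup>i\<close> at the point \<open>p\<close>, where \<open>x\<close> and \<open>y\<close>
  are the coordinates of \<open>c\<close> and \<open>d\<close>.\<close>

definition transition_jac ::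
    "('m, 'n::finite) chart \<Rightarrow> ('m, 'n) chart \<Rightarrow> 'm \<Rightarrow> real ^ 'n ^ 'n" where
  "transition_jac c d p = jacobian (transition c d) (at (snd c p))"

text \<open>Two atlases define the same smooth structure iff their union is an atlas.\<close>

definition orientable_atlas :: "('m::topological_space, 'n::finite) chart set \<Rightarrow> bool" where
  "orientable_atlas A \<longleftrightarrow> (\<exists>B. smooth_atlas B \<and> smooth_atlas (A \<union> B) \<and>
     (\<forall>c\<in>B. \<forall>d\<in>B. \<forall>p\<in>fst c \<inter> fst d. det (transition_jac c d p) > 0))"

definition smooth_function ::
    "('m, 'n::finite) chart set \<Rightarrow> ('m \<Rightarrow> real) \<Rightarrow> bool" where
  "smooth_function A f \<longleftrightarrow> (\<forall>c\<in>A. smooth_on (snd c ` fst c) (f \<circ> inv_chart c))"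

text \<open>A tensor field is given by its components in every chart of the atlas, related by the
  transformation law. \<open>X c p $ i\<close> is the component \<open>X\<^sup>i\<close> at \<open>p\<close> in the chart \<open>c\<close>, and
  \<open>g c p $ i $ j\<close> is \<open>g\<^sub>i\<^sub>j\<close>; only the values for \<open>p \<in> fst c\<close> matter.\<close>

type_synonym ('m, 'n) vector_field = "('m, 'n) chart \<Rightarrow> 'm \<Rightarrow> real ^ 'n"
type_synonym ('m, 'n) metric_field = "('m, 'n) chart \<Rightarrow> 'm \<Rightarrow> real ^ 'n ^ 'n"

definition smooth_vector_field ::
    "('m, 'n::finite) chart set \<Rightarrow> ('m, 'n) vector_field \<Rightarrow> bool" where
  "smooth_vector_field A X \<longleftrightarrow>
     (\<forall>c\<in>A. smooth_on (snd c ` fst c) (X c \<circ> inv_chart c)) \<and>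
     (\<forall>c\<in>A. \<forall>d\<in>A. \<forall>p\<in>fst c \<inter> fst d. X d p = transition_jac c d p *v X c p)"

definition riemannian_metric ::
    "('m, 'n::finite) chart set \<Rightarrow> ('m, 'n) metric_field \<Rightarrow> bool" where
  "riemannian_metric A g \<longleftrightarrow>
     (\<forall>c\<in>A. smooth_on (snd c ` fst c) (g c \<circ> inv_chart c)) \<and>
     (\<forall>c\<in>A. \<forall>d\<in>A. \<forall>p\<in>fst c \<inter> fst d.
        g c p = transpose (transition_jac c d p) ** g d p ** transition_jac c d p) \<and>
     (\<forall>c\<in>A. \<forall>p\<in>fst c. transpose (g c p) = g c p \<and> (\<forall>v. v \<noteq> 0 \<longrightarrow> v \<bullet> (g c p *v v) > 0))"

section \<open>Tensor calculus in a chart\<close>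

text \<open>Coordinate derivative \<open>\<partial>\<^sub>i u\<close> in the chart \<open>c\<close>, for \<open>u\<close> defined on the domain of \<open>c\<close>.\<close>

definition partial ::
    "('m, 'n::finite) chart \<Rightarrow> 'n \<Rightarrow> ('m \<Rightarrow> real) \<Rightarrow> 'm \<Rightarrow> real" where
  "partial c i u p = frechet_derivative (u \<circ> inv_chart c) (at (snd c p)) (axis i 1)"

definition ginv :: "('m, 'n::finite) metric_field \<Rightarrow> ('m, 'n) metric_field" where
  "ginv g c p = matrix_inv (g c p)"

text \<open>\<open>christoffel g c k i j\<close> is \<open>\<Gamma>\<^sup>k\<^sub>i\<^sub>j\<close> of the Levi-Civita connection.\<close>

definition christoffel ::
    "('m, 'n::finite) metric_field \<Rightarrow> ('m, 'n) chart \<Rightarrow> 'n \<Rightarrow> 'n \<Rightarrow> 'n \<Rightarrow> 'm \<Rightarrow> real" where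
  "christoffel g c k i j p = (1/2) * (\<Sum>l\<in>UNIV. ginv g c p $ k $ l *
     (partial c i (\<lambda>q. g c q $ j $ l) p + partial c j (\<lambda>q. g c q $ i $ l) p
      - partial c l (\<lambda>q. g c q $ i $ j) p))"

text \<open>\<open>nabla_vec g c X j i\<close> is \<open>\<nabla>\<^sub>j X\<^sup>i\<close>.\<close>

definition nabla_vec ::
    "('m, 'n::finite) metric_field \<Rightarrow> ('m, 'n) chart \<Rightarrow> ('m, 'n) vector_field
     \<Rightarrow> 'n \<Rightarrow> 'n \<Rightarrow> 'm \<Rightarrow> real" where
  "nabla_vec g c X j i p =
     partial c j (\<lambda>q. X c q $ i) p + (\<Sum>m\<in>UNIV. christoffel g c i j m p * X c p $ m)"

text \<open>\<open>nabla_covec g c w i j\<close> is \<open>\<nabla>\<^sub>i w\<^sub>j\<close> for a covector field with components \<open>w\<close> in the chart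
  \<open>c\<close>.\<close>

definition nabla_covec ::
    "('m, 'n::finite) metric_field \<Rightarrow> ('m, 'n) chart \<Rightarrow> ('n \<Rightarrow> 'm \<Rightarrow> real)
     \<Rightarrow> 'n \<Rightarrow> 'n \<Rightarrow> 'm \<Rightarrow> real" where
  "nabla_covec g c w i j p =
     partial c i (w j) p - (\<Sum>m\<in>UNIV. christoffel g c m i j p * w m p)"

text \<open>\<open>nabla2_vec g c X k l i\<close> is \<open>\<nabla>\<^sub>k \<nabla>\<^sub>l X\<^sup>i\<close>, the covariant derivative of the
  (1,1)-tensor field \<open>\<nabla>\<^sub>l X\<^sup>i\<close>.\<close>

definition nabla2_vec ::
    "('m, 'n::finite) metric_field \<Rightarrow> ('m, 'n) chart \<Rightarrow> ('m, 'n) vector_field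
     \<Rightarrow> 'n \<Rightarrow> 'n \<Rightarrow> 'n \<Rightarrow> 'm \<Rightarrow> real" where
  "nabla2_vec g c X k l i p =
     partial c k (nabla_vec g c X l i) p
     + (\<Sum>m\<in>UNIV. christoffel g c i k m p * nabla_vec g c X l m p)
     - (\<Sum>m\<in>UNIV. christoffel g c m k l p * nabla_vec g c X m i p)"

definition rough_laplacian ::
    "('m, 'n::finite) metric_field \<Rightarrow> ('m, 'n) chart \<Rightarrow> ('m, 'n) vector_field
     \<Rightarrow> 'n \<Rightarrow> 'm \<Rightarrow> real" where
  "rough_laplacian g c X i p =
     (\<Sum>k\<in>UNIV. \<Sum>l\<in>UNIV. ginv g c p $ k $ l * nabla2_vec g c X k l i p)"

definition divergence ::
    "('m, 'n::finite) metric_field \<Rightarrow> ('m, 'n) chart \<Rightarrow> ('m, 'n) vector_field \<Rightarrow> 'm \<Rightarrow> real" where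
  "divergence g c X p = (\<Sum>i\<in>UNIV. nabla_vec g c X i i p)"

text \<open>\<open>grad g c u i\<close> is \<open>\<nabla>\<^sup>i u = g\<^sup>i\<^sup>j \<partial>\<^sub>j u\<close>.\<close>

definition grad ::
    "('m, 'n::finite) metric_field \<Rightarrow> ('m, 'n) chart \<Rightarrow> ('m \<Rightarrow> real) \<Rightarrow> 'n \<Rightarrow> 'm \<Rightarrow> real" where
  "grad g c u i p = (\<Sum>j\<in>UNIV. ginv g c p $ i $ j * partial c j u p)"

text \<open>\<open>riemann g c l k i j\<close> is the \<open>l\<close>-component of \<open>R(\<partial>\<^sub>i, \<partial>\<^sub>j) \<partial>\<^sub>k\<close>, where
  \<open>R(Y, Z) = \<nabla>\<^sub>Y \<nabla>\<^sub>Z - \<nabla>\<^sub>Z \<nabla>\<^sub>Y - \<nabla>\<^sub>[\<^sub>Y\<^sub>,\<^sub>Z\<^sub>]\<close>. With the contraction below the Ricci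
  curvature of the round sphere is positive.\<close>

definition riemann ::
    "('m, 'n::finite) metric_field \<Rightarrow> ('m, 'n) chart \<Rightarrow> 'n \<Rightarrow> 'n \<Rightarrow> 'n \<Rightarrow> 'n \<Rightarrow> 'm \<Rightarrow> real" where
  "riemann g c l k i j p =
     partial c i (christoffel g c l j k) p - partial c j (christoffel g c l i k) p
     + (\<Sum>m\<in>UNIV. christoffel g c l i m p * christoffel g c m j k p)
     - (\<Sum>m\<in>UNIV. christoffel g c l j m p * christoffel g c m i k p)"

definition ricci ::
    "('m, 'n::finite) metric_field \<Rightarrow> ('m, 'n) chart \<Rightarrow> 'n \<Rightarrow> 'n \<Rightarrow> 'm \<Rightarrow> real" where
  "ricci g c k j p = (\<Sum>i\<in>UNIV. riemann g c i k i j p)"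

text \<open>\<open>ricci_up g c i j\<close> is \<open>R\<^sup>i\<^sub>j\<close>.\<close>

definition ricci_up ::
    "('m, 'n::finite) metric_field \<Rightarrow> ('m, 'n) chart \<Rightarrow> 'n \<Rightarrow> 'n \<Rightarrow> 'm \<Rightarrow> real" where
  "ricci_up g c i j p = (\<Sum>k\<in>UNIV. ginv g c p $ i $ k * ricci g c k j p)"

definition flat ::
    "('m, 'n::finite) metric_field \<Rightarrow> ('m, 'n) chart \<Rightarrow> ('m, 'n) vector_field
     \<Rightarrow> 'n \<Rightarrow> 'm \<Rightarrow> real" where
  "flat g c X j p = (\<Sum>k\<in>UNIV. g c p $ j $ k * X c p $ k)"

text \<open>The Lie derivative \<open>(L\<^sub>X g)\<^sub>i\<^sub>j = \<nabla>\<^sub>i X\<^sub>j + \<nabla>\<^sub>j X\<^sub>i\<close>.\<close>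

definition lie_metric ::
    "('m, 'n::finite) metric_field \<Rightarrow> ('m, 'n) chart \<Rightarrow> ('m, 'n) vector_field
     \<Rightarrow> 'n \<Rightarrow> 'n \<Rightarrow> 'm \<Rightarrow> real" where
  "lie_metric g c X i j p =
     nabla_covec g c (flat g c X) i j p + nabla_covec g c (flat g c X) j i p"

text \<open>\<open>lie_metric_up g c X i j\<close> is \<open>(L\<^sub>X g)\<^sup>i\<^sup>j\<close>, both indices being raised with \<open>g\<close>.\<close>

definition lie_metric_up ::
    "('m, 'n::finite) metric_field \<Rightarrow> ('m, 'n) chart \<Rightarrow> ('m, 'n) vector_field
     \<Rightarrow> 'n \<Rightarrow> 'n \<Rightarrow> 'm \<Rightarrow> real" where
  "lie_metric_up g c X i j p = (\<Sum>k\<in>UNIV. \<Sum>l\<in>UNIV.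
     ginv g c p $ i $ k * ginv g c p $ j $ l * lie_metric g c X k l p)"

definition killing ::
    "('m, 'n::finite) chart set \<Rightarrow> ('m, 'n) metric_field \<Rightarrow> ('m, 'n) vector_field \<Rightarrow> bool" where
  "killing A g X \<longleftrightarrow> (\<forall>c\<in>A. \<forall>p\<in>fst c. \<forall>i j. lie_metric g c X i j p = 0)"

end

(* Write L for the Lie derivative of g, P for the inverse metric, E for the right hand side of the
   equation, and let Y = P L X, that is Y^i = g^ij L_jk X^k.  The weighted divergence of Y is
     e^(-f) div(e^f Y) = g(E, X) + tr(P L P L) / 2,
   by metric compatibility and the contracted Ricci identity.  If E = 0, then div(e^f Y) >= 0, hence
   div(e^f Y) = 0 by the divergence theorem, and tr(P L P L), the squared norm of L, vanishes.
   Conversely, differentiating L = 0 gives E = 0; here the symmetry of the Ricci tensor is needed.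
   The divergence theorem only uses the density sqrt(det g) in charts: with a partition of unity
   eta_i one has int h = sum_i int eta_i h = - sum_i int d(eta_i)(V) = 0 for h = div V, where the
   integrals over different charts are compared by the change of variables formula. *)

theory Submission
  imports Defs
begin

section \<open>Calculus of \<open>C\<^sup>k\<close> functions\<close>

text \<open>In index notation E^i = e^(-f) nabla_j (e^f L^ij): one summand of L contributes the
  Laplacian, the other the second derivative nabla_j nabla^i X^j, which commutes into the gradient
  of the divergence and the Ricci term, and the weight contributes the term with f. So the natural
  test of E = 0 is to contract with X and integrate against e^f. As L is symmetric, L^ij nabla_j X_i
  is half of its squared norm, which is the origin of the factor 1/2. The factor e^f is carried by
  the vector field, while the measure stays the Riemannian one. The obstacle is that tensors exist
  only as components in charts. Covariant derivatives are treated in one chart, as matrix identities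
  in which the Christoffel terms cancel. The only differential expression whose change of chart has
  to be proved is L, and its Christoffel-free coordinate formula reduces this to the chain rule.
  Functions on M such as h and the derivatives of the eta_i along V are defined by a choice of chart
  at each point and shown not to depend on it.\<close>

lemma frechet_derivative_cong_open:
  assumes "open S" "x \<in> S" "\<And>y. y \<in> S \<Longrightarrow> f y = g y"
  shows "frechet_derivative f (at x) = frechet_derivative g (at x)"
proof -
  have "(f has_derivative D) (at x) \<longleftrightarrow> (g has_derivative D) (at x)" for D
    using has_derivative_transform_within_open[OF _ assms(1,2)] assms(3) by metis
  then show ?thesis
    unfolding frechet_derivative_def by simp
qed

lemma differentiable_cong_open:
  assumes "open S" "x \<in> S" "\<And>y. y \<in> S \<Longrightarrow> f y = g y" "f differentiable (at x)"
  shows "g differentiable (at x)"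
  using assms has_derivative_transform_within_open unfolding differentiable_def by metis

lemma Ck_on_imp_continuous_on: "Ck_on k f S \<Longrightarrow> continuous_on S f"
  by (cases k) (auto intro!: continuous_at_imp_continuous_on differentiable_imp_continuous_within)

lemma Ck_on_Suc_imp: "Ck_on (Suc k) f S \<Longrightarrow> Ck_on k f S"
proof (induction k arbitrary: f)
  case 0
  then show ?case using Ck_on_imp_continuous_on by (metis Ck_on.simps(1))
next
  case (Suc k)
  then show ?case by (metis Ck_on.simps(2))
qed

lemma Ck_on_le: "Ck_on k f S \<Longrightarrow> j \<le> k \<Longrightarrow> Ck_on j f S"
proof (induction k)
  case (Suc k)
  then show ?case using Ck_on_Suc_imp le_SucE by metis
qed simp

lemma Ck_on_subset: "Ck_on k f S \<Longrightarrow> T \<subseteq> S \<Longrightarrow> Ck_on k f T"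
  by (induction k arbitrary: f) (auto intro: continuous_on_subset)

lemma Ck_on_cong:
  assumes "open S" "\<And>x. x \<in> S \<Longrightarrow> f x = g x" "Ck_on k f S"
  shows "Ck_on k g S"
  using assms(2,3)
proof (induction k arbitrary: f g)
  case 0
  then show ?case using continuous_on_cong by (metis Ck_on.simps(1))
next
  case (Suc k)
  have "Ck_on k (\<lambda>x. frechet_derivative g (at x) v) S" for v
  proof (rule Suc.IH)
    show "frechet_derivative f (at x) v = frechet_derivative g (at x) v" if "x \<in> S" for x
      using frechet_derivative_cong_open[OF assms(1) that Suc.prems(1)] by simp
    show "Ck_on k (\<lambda>x. frechet_derivative f (at x) v) S"
      using Suc.prems(2) by simp
  qed
  moreover have "g differentiable (at x)" if "x \<in> S" for x
    using differentiable_cong_open[OF assms(1) that Suc.prems(1)] Suc.prems(2) that by simp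
  ultimately show ?case by simp
qed

lemma Ck_on_has_derivative:
  "Ck_on (Suc k) f S \<Longrightarrow> x \<in> S \<Longrightarrow> (f has_derivative frechet_derivative f (at x)) (at x)"
  by (simp add: frechet_derivative_works)

lemma Ck_on_frechet: "Ck_on (Suc k) f S \<Longrightarrow> Ck_on k (\<lambda>x. frechet_derivative f (at x) v) S"
  by simp

text \<open>Openness matters only for continuity, the case of order 0; differentiability is
  pointwise already. Used to glue extensions by zero.\<close>

lemma Ck_on_Un:
  assumes "open S" "open T"
  shows "Ck_on k f S \<Longrightarrow> Ck_on k f T \<Longrightarrow> Ck_on k f (S \<union> T)"
proof (induction k arbitrary: f)
  case 0
  then show ?case using continuous_on_open_Un[OF assms] by simp
next
  case (Suc k)
  show ?case
    unfolding Ck_on.simps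
    using Suc.prems Suc.IH[OF Ck_on_frechet[OF Suc.prems(1)] Ck_on_frechet[OF Suc.prems(2)]]
    by (simp add: ball_Un)
qed

text \<open>Any explicit formula may stand in for the derivative chosen by
  \<open>frechet_derivative\<close>. Closure properties thereby become inductions whose step is the
  usual differentiation rule.\<close>

lemma Ck_on_SucI:
  assumes "open S" "\<And>x. x \<in> S \<Longrightarrow> (f has_derivative f' x) (at x)"
    "\<And>v. Ck_on k (\<lambda>x. f' x v) S"
  shows "Ck_on (Suc k) f S"
proof -
  have "Ck_on k (\<lambda>x. frechet_derivative f (at x) v) S" for v
    by (rule Ck_on_cong[OF assms(1) _ assms(3)]) (simp add: frechet_derivative_at[OF assms(2)])
  then show ?thesis
    using assms(2) by (auto simp: differentiable_def)
qed

lemma Ck_on_const: "Ck_on k (\<lambda>x. c) S"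
  by (induction k arbitrary: c) auto

context
  fixes S :: "'a::real_normed_vector set"
  assumes S: "open S"
begin

lemma Ck_on_linear:
  assumes "bounded_linear L" "Ck_on k f S"
  shows "Ck_on k (\<lambda>x. L (f x)) S"
  using assms(2)
proof (induction k arbitrary: f)
  case 0
  then show ?case
    by (auto intro: continuous_on_compose2[OF linear_continuous_on[OF assms(1), of UNIV]])
next
  case (Suc k)
  show ?case
  proof (rule Ck_on_SucI[OF S])
    show "((\<lambda>x. L (f x)) has_derivative (\<lambda>v. L (frechet_derivative f (at x) v))) (at x)"
      if "x \<in> S" for x
      using bounded_linear.has_derivative[OF assms(1) Ck_on_has_derivative[OF Suc.prems that]] .
    show "Ck_on k (\<lambda>x. L (frechet_derivative f (at x) v)) S" for v
      using Suc.IH[OF Ck_on_frechet[OF Suc.prems]] .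
  qed
qed

lemma Ck_on_add:
  "Ck_on k f S \<Longrightarrow> Ck_on k h S \<Longrightarrow> Ck_on k (\<lambda>x. f x + h x) S"
proof (induction k arbitrary: f h)
  case 0
  then show ?case by (auto intro: continuous_on_add)
next
  case (Suc k)
  show ?case
  proof (rule Ck_on_SucI[OF S])
    show "((\<lambda>x. f x + h x) has_derivative
        (\<lambda>v. frechet_derivative f (at x) v + frechet_derivative h (at x) v)) (at x)"
      if "x \<in> S" for x
      using has_derivative_add[OF Ck_on_has_derivative[OF Suc.prems(1) that]
          Ck_on_has_derivative[OF Suc.prems(2) that]] .
    show "Ck_on k (\<lambda>x. frechet_derivative f (at x) v + frechet_derivative h (at x) v) S" for v
      using Suc.IH[OF Ck_on_frechet[OF Suc.prems(1)] Ck_on_frechet[OF Suc.prems(2)]] .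
  qed
qed

lemma Ck_on_minus: "Ck_on k f S \<Longrightarrow> Ck_on k (\<lambda>x. - f x) S"
  by (rule Ck_on_linear[OF bounded_linear_minus[OF bounded_linear_ident]])

lemma Ck_on_diff: "Ck_on k f S \<Longrightarrow> Ck_on k h S \<Longrightarrow> Ck_on k (\<lambda>x. f x - h x) S"
  using Ck_on_add[OF _ Ck_on_minus] by (metis (no_types, lifting) ext diff_conv_add_uminus)

lemma Ck_on_sum:
  "(\<And>i. i \<in> I \<Longrightarrow> Ck_on k (f i) S) \<Longrightarrow> Ck_on k (\<lambda>x. \<Sum>i\<in>I. f i x) S"
proof (induction I rule: infinite_finite_induct)
  case (insert i I)
  then show ?case using Ck_on_add[of k "f i" "\<lambda>x. \<Sum>i\<in>I. f i x"] by simp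
qed (auto intro: Ck_on_const)

lemma Ck_on_mult:
  fixes f h :: "'a \<Rightarrow> real"
  shows "Ck_on k f S \<Longrightarrow> Ck_on k h S \<Longrightarrow> Ck_on k (\<lambda>x. f x * h x) S"
proof (induction k arbitrary: f h)
  case 0
  then show ?case by (auto intro: continuous_on_mult)
next
  case (Suc k)
  show ?case
  proof (rule Ck_on_SucI[OF S])
    show "((\<lambda>x. f x * h x) has_derivative
        (\<lambda>v. f x * frechet_derivative h (at x) v + frechet_derivative f (at x) v * h x)) (at x)"
      if "x \<in> S" for x
      using has_derivative_mult[OF Ck_on_has_derivative[OF Suc.prems(1) that]
          Ck_on_has_derivative[OF Suc.prems(2) that]] .
    show "Ck_on k (\<lambda>x. f x * frechet_derivative h (at x) v + frechet_derivative f (at x) v * h x) S" for v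
      using Ck_on_add[OF Suc.IH[OF Ck_on_Suc_imp[OF Suc.prems(1)] Ck_on_frechet[OF Suc.prems(2)]]
          Suc.IH[OF Ck_on_frechet[OF Suc.prems(1)] Ck_on_Suc_imp[OF Suc.prems(2)]]] .
  qed
qed

lemma Ck_on_prod:
  fixes f :: "'i \<Rightarrow> 'a \<Rightarrow> real"
  shows "(\<And>i. i \<in> I \<Longrightarrow> Ck_on k (f i) S) \<Longrightarrow> Ck_on k (\<lambda>x. \<Prod>i\<in>I. f i x) S"
proof (induction I rule: infinite_finite_induct)
  case (insert i I)
  then show ?case using Ck_on_mult[of k "f i" "\<lambda>x. \<Prod>i\<in>I. f i x"] by simp
qed (auto intro: Ck_on_const)

text \<open>The derivative contains \<open>exp (f x)\<close> again, needed to one order less, which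
  is the induction hypothesis. So \<open>f\<close> stays fixed in the induction, unlike in
  \<open>Ck_on_mult\<close>; \<open>Ck_on_inverse\<close> and \<open>Ck_on_sqrt\<close> follow the
  same pattern.\<close>

lemma Ck_on_exp:
  fixes f :: "'a \<Rightarrow> real"
  shows "Ck_on k f S \<Longrightarrow> Ck_on k (\<lambda>x. exp (f x)) S"
proof (induction k)
  case 0
  then show ?case by (auto intro: continuous_on_exp)
next
  case (Suc k)
  show ?case
  proof (rule Ck_on_SucI[OF S])
    show "((\<lambda>x. exp (f x)) has_derivative (\<lambda>v. frechet_derivative f (at x) v * exp (f x))) (at x)"
      if "x \<in> S" for x
      using has_derivative_exp[OF Ck_on_has_derivative[OF Suc.prems that]] by simp
    show "Ck_on k (\<lambda>x. frechet_derivative f (at x) v * exp (f x)) S" for v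
      using Ck_on_mult[OF Ck_on_frechet[OF Suc.prems] Suc.IH[OF Ck_on_Suc_imp[OF Suc.prems]]] .
  qed
qed

lemma Ck_on_inverse:
  fixes f :: "'a \<Rightarrow> real"
  assumes "\<And>x. x \<in> S \<Longrightarrow> f x \<noteq> 0"
  shows "Ck_on k f S \<Longrightarrow> Ck_on k (\<lambda>x. inverse (f x)) S"
proof (induction k)
  case 0
  then show ?case using assms by (auto intro: continuous_on_inverse)
next
  case (Suc k)
  note IH = Suc.IH[OF Ck_on_Suc_imp[OF Suc.prems]]
  show ?case
  proof (rule Ck_on_SucI[OF S])
    show "((\<lambda>x. inverse (f x)) has_derivative
        (\<lambda>v. - (inverse (f x) * frechet_derivative f (at x) v * inverse (f x)))) (at x)"
      if "x \<in> S" for x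
      by (rule Deriv.has_derivative_inverse[OF assms[OF that] Ck_on_has_derivative[OF Suc.prems that]])
    show "Ck_on k (\<lambda>x. - (inverse (f x) * frechet_derivative f (at x) v * inverse (f x))) S" for v
      using Ck_on_minus[OF Ck_on_mult[OF Ck_on_mult[OF IH Ck_on_frechet[OF Suc.prems]] IH]] .
  qed
qed

lemma Ck_on_divide:
  fixes f h :: "'a \<Rightarrow> real"
  shows "(\<And>x. x \<in> S \<Longrightarrow> h x \<noteq> 0) \<Longrightarrow> Ck_on k f S \<Longrightarrow> Ck_on k h S \<Longrightarrow> Ck_on k (\<lambda>x. f x / h x) S"
  unfolding divide_inverse by (intro Ck_on_mult Ck_on_inverse)

lemma Ck_on_sqrt:
  fixes f :: "'a \<Rightarrow> real"
  assumes pos: "\<And>x. x \<in> S \<Longrightarrow> 0 < f x"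
  shows "Ck_on k f S \<Longrightarrow> Ck_on k (\<lambda>x. sqrt (f x)) S"
proof (induction k)
  case 0
  then show ?case by (auto intro: continuous_on_real_sqrt)
next
  case (Suc k)
  show ?case
  proof (rule Ck_on_SucI[OF S])
    show "((\<lambda>x. sqrt (f x)) has_derivative
        (\<lambda>v. frechet_derivative f (at x) v * (1/2) * inverse (sqrt (f x)))) (at x)"
      if "x \<in> S" for x
      using has_derivative_real_sqrt[OF pos[OF that] Ck_on_has_derivative[OF Suc.prems that]]
      by (simp add: mult_ac)
    show "Ck_on k (\<lambda>x. frechet_derivative f (at x) v * (1/2) * inverse (sqrt (f x))) S" for v
      by (rule Ck_on_mult[OF Ck_on_mult[OF Ck_on_frechet[OF Suc.prems] Ck_on_const]
            Ck_on_inverse[OF _ Suc.IH[OF Ck_on_Suc_imp[OF Suc.prems]]]])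
        (use pos in force)
  qed
qed

end

lemma linear_eq_sum_axis:
  fixes L :: "real ^ 'n::finite \<Rightarrow> 'b::real_vector"
  assumes "linear L"
  shows "L v = (\<Sum>i\<in>UNIV. (v $ i) *\<^sub>R L (axis i 1))"
proof -
  have "v = (\<Sum>i\<in>UNIV. (v $ i) *\<^sub>R axis i 1)"
    by (simp add: vec_eq_iff axis_def if_distrib cong: if_cong)
  then have "L v = L (\<Sum>i\<in>UNIV. (v $ i) *\<^sub>R axis i 1)" by simp
  also have "\<dots> = (\<Sum>i\<in>UNIV. L ((v $ i) *\<^sub>R axis i 1))"
    by (rule linear_sum[OF assms])
  finally show ?thesis by (simp add: linear_cmul[OF assms])
qed

text \<open>The chain rule differentiates \<open>f\<close> in a direction that moves with
  \<open>x\<close>, whereas \<open>Ck_on\<close> speaks of fixed directions. Expanding the moving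
  direction in the axis vectors turns the derivative into a finite sum of products.\<close>

lemma Ck_on_compose:
  fixes f :: "real ^ 'n::finite \<Rightarrow> real" and h :: "'a::real_normed_vector \<Rightarrow> real ^ 'n"
  assumes S: "open S" and T: "h ` S \<subseteq> T"
  shows "Ck_on k h S \<Longrightarrow> Ck_on k f T \<Longrightarrow> Ck_on k (\<lambda>x. f (h x)) S"
proof (induction k arbitrary: f)
  case 0
  then show ?case using continuous_on_compose2[OF _ _ T] by simp
next
  case (Suc k)
  have hT: "h x \<in> T" if "x \<in> S" for x using T that by auto
  show ?case
  proof (rule Ck_on_SucI[OF S])
    show "((\<lambda>x. f (h x)) has_derivative (\<lambda>v. \<Sum>i\<in>UNIV. frechet_derivative h (at x) v $ i *
        frechet_derivative f (at (h x)) (axis i 1))) (at x)" if "x \<in> S" for x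
    proof -
      note df = Ck_on_has_derivative[OF Suc.prems(2) hT[OF that]]
      have "((\<lambda>x. f (h x)) has_derivative
          (\<lambda>v. frechet_derivative f (at (h x)) (frechet_derivative h (at x) v))) (at x)"
        using has_derivative_compose[OF Ck_on_has_derivative[OF Suc.prems(1) that] df] .
      then show ?thesis
        unfolding linear_eq_sum_axis[OF has_derivative_linear[OF df], of "frechet_derivative h (at x) _"]
        by simp
    qed
    show "Ck_on k (\<lambda>x. \<Sum>i\<in>UNIV. frechet_derivative h (at x) v $ i *
        frechet_derivative f (at (h x)) (axis i 1)) S" for v
      by (intro Ck_on_sum[OF S] Ck_on_mult[OF S])
        (rule Ck_on_linear[OF S bounded_linear_vec_nth Ck_on_frechet[OF Suc.prems(1)]],
          rule Suc.IH[OF Ck_on_Suc_imp[OF Suc.prems(1)] Ck_on_frechet[OF Suc.prems(2)]])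
  qed
qed

section \<open>Symmetry of second derivatives\<close>

text \<open>The left hand side is symmetric in \<open>u\<close> and \<open>v\<close>, which gives Schwarz' theorem as \<open>r \<rightarrow> 0\<close>.\<close>

lemma second_difference_mean_value:
  fixes f :: "'a::real_normed_vector \<Rightarrow> real"
  assumes f: "Ck_on 2 f S" and r: "0 < r"
    and S: "\<And>s t. 0 \<le> s \<Longrightarrow> s \<le> r \<Longrightarrow> 0 \<le> t \<Longrightarrow> t \<le> r \<Longrightarrow> x + s *\<^sub>R u + t *\<^sub>R v \<in> S"
  obtains s t where "0 \<le> s" "s \<le> r" "0 \<le> t" "t \<le> r"
    "f (x + r *\<^sub>R u + r *\<^sub>R v) - f (x + r *\<^sub>R u) - f (x + r *\<^sub>R v) + f x =
      r * r * frechet_derivative (\<lambda>y. frechet_derivative f (at y) u) (at (x + s *\<^sub>R u + t *\<^sub>R v)) v"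
proof -
  let ?D = "\<lambda>y. frechet_derivative f (at y)"
  let ?D2 = "\<lambda>y. frechet_derivative (\<lambda>y. ?D y u) (at y)"
  have f1: "Ck_on (Suc 1) f S" using f by (simp add: numeral_2_eq_2)
  have f2: "Ck_on (Suc 0) (\<lambda>y. ?D y u) S" using Ck_on_frechet[OF f1] by simp
  \<comment> \<open>The second difference is the increment of \<open>h\<close> over
    \<open>[0, r]\<close>; one mean value step in the direction \<open>u\<close> and one in the
    direction \<open>v\<close> turn it into a second derivative.\<close>
  define h where "h s = f (x + s *\<^sub>R u + r *\<^sub>R v) - f (x + s *\<^sub>R u)" for s
  have dh: "(h has_real_derivative ?D (x + s *\<^sub>R u + r *\<^sub>R v) u - ?D (x + s *\<^sub>R u) u) (at s)"
    if "0 \<le> s" "s \<le> r" for s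
  proof -
    have 1: "x + s *\<^sub>R u + r *\<^sub>R v \<in> S" "x + s *\<^sub>R u \<in> S"
      using S[OF that, of r] S[OF that, of 0] r by auto
    note D1 = Ck_on_has_derivative[OF f1 1(1)] and D2 = Ck_on_has_derivative[OF f1 1(2)]
    have "((\<lambda>s. f (x + s *\<^sub>R u + r *\<^sub>R v)) has_derivative
        (\<lambda>a. ?D (x + s *\<^sub>R u + r *\<^sub>R v) (a *\<^sub>R u))) (at s)"
      by (rule has_derivative_compose[where f = "\<lambda>s. x + s *\<^sub>R u + r *\<^sub>R v", OF _ D1]) (auto intro!: derivative_eq_intros)
    moreover have "((\<lambda>s. f (x + s *\<^sub>R u)) has_derivative (\<lambda>a. ?D (x + s *\<^sub>R u) (a *\<^sub>R u))) (at s)"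
      by (rule has_derivative_compose[where f = "\<lambda>s. x + s *\<^sub>R u", OF _ D2]) (auto intro!: derivative_eq_intros)
    ultimately have "(h has_derivative
       (\<lambda>a. ?D (x + s *\<^sub>R u + r *\<^sub>R v) (a *\<^sub>R u) - ?D (x + s *\<^sub>R u) (a *\<^sub>R u))) (at s)"
      unfolding h_def by (rule has_derivative_diff)
    then show ?thesis
      unfolding has_field_derivative_def
      by (rule has_derivative_eq_rhs)
        (simp add: fun_eq_iff linear_cmul[OF has_derivative_linear[OF D1]]
          linear_cmul[OF has_derivative_linear[OF D2]] right_diff_distrib mult.commute)
  qed
  obtain s where s: "0 < s" "s < r"
    "h r - h 0 = (r - 0) * (?D (x + s *\<^sub>R u + r *\<^sub>R v) u - ?D (x + s *\<^sub>R u) u)"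
    using MVT2[of 0 r h "\<lambda>s. ?D (x + s *\<^sub>R u + r *\<^sub>R v) u - ?D (x + s *\<^sub>R u) u"] dh r by auto
  have dk: "((\<lambda>t. ?D (x + s *\<^sub>R u + t *\<^sub>R v) u) has_real_derivative ?D2 (x + s *\<^sub>R u + t *\<^sub>R v) v) (at t)"
    if "0 \<le> t" "t \<le> r" for t
  proof -
    have "x + s *\<^sub>R u + t *\<^sub>R v \<in> S" using S[of s t] s that by auto
    note D1 = Ck_on_has_derivative[OF f2 this]
    have "((\<lambda>t. ?D (x + s *\<^sub>R u + t *\<^sub>R v) u) has_derivative
        (\<lambda>a. ?D2 (x + s *\<^sub>R u + t *\<^sub>R v) (a *\<^sub>R v))) (at t)"
      by (rule has_derivative_compose[where f = "\<lambda>t. x + s *\<^sub>R u + t *\<^sub>R v", OF _ D1]) (auto intro!: derivative_eq_intros)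
    then show ?thesis
      unfolding has_field_derivative_def
      by (rule has_derivative_eq_rhs)
        (simp add: fun_eq_iff linear_cmul[OF has_derivative_linear[OF D1]] mult.commute)
  qed
  obtain t where t: "0 < t" "t < r"
    "?D (x + s *\<^sub>R u + r *\<^sub>R v) u - ?D (x + s *\<^sub>R u + 0 *\<^sub>R v) u = (r - 0) * ?D2 (x + s *\<^sub>R u + t *\<^sub>R v) v"
    using MVT2[of 0 r "\<lambda>t. ?D (x + s *\<^sub>R u + t *\<^sub>R v) u" "\<lambda>t. ?D2 (x + s *\<^sub>R u + t *\<^sub>R v) v"] dk r by auto
  show thesis
    by (rule that[of s t]) (use s t in \<open>auto simp: h_def algebra_simps\<close>)
qed

theorem second_derivative_symmetric:
  fixes f :: "'a::real_normed_vector \<Rightarrow> real"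
  assumes "open S" "x \<in> S" and f: "Ck_on 2 f S"
  shows "frechet_derivative (\<lambda>y. frechet_derivative f (at y) u) (at x) v =
    frechet_derivative (\<lambda>y. frechet_derivative f (at y) v) (at x) u"
proof -
  define D where "D u v y = frechet_derivative (\<lambda>y. frechet_derivative f (at y) u) (at y) v" for u v y
  have f1: "Ck_on (Suc (Suc 0)) f S" using f by (simp add: numeral_2_eq_2)
  have "continuous_on S (D u v)" for u v
    using f1 by (simp add: D_def[abs_def])
  then have cont: "isCont (D u v) x" for u v
    using assms(1,2) continuous_on_eq_continuous_at by blast
  obtain e where e: "0 < e" "ball x e \<subseteq> S"
    using assms(1,2) openE by blast
  have "D u v x = D v u x"
  proof (rule ccontr)
    assume ne: "D u v x \<noteq> D v u x"
    \<comment> \<open>Half of the gap: one common value cannot be closer than this to both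
      \<open>D u v x\<close> and \<open>D v u x\<close>.\<close>
    define \<epsilon> where "\<epsilon> = \<bar>D u v x - D v u x\<bar> / 2"
    have "\<epsilon> > 0" using ne by (simp add: \<epsilon>_def)
    then obtain d1 d2 where d: "d1 > 0" "\<And>y. dist y x < d1 \<Longrightarrow> dist (D u v y) (D u v x) < \<epsilon>"
      "d2 > 0" "\<And>y. dist y x < d2 \<Longrightarrow> dist (D v u y) (D v u x) < \<epsilon>"
      using cont unfolding continuous_at_eps_delta by metis
    define m where "m = min e (min d1 d2)"
    \<comment> \<open>Keeps the whole parallelogram spanned by \<open>r *\<^sub>R u\<close> and
      \<open>r *\<^sub>R v\<close> within distance \<open>m\<close> of \<open>x\<close>; the summand
      1 covers the case that both vectors vanish.\<close>
    define r where "r = m / (2 * (norm u + norm v + 1))"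
    have m: "m > 0" using d e by (simp add: m_def)
    have nuv: "norm u + norm v + 1 > 0" by (smt (verit) norm_ge_zero)
    have r: "r > 0" using m nuv by (simp add: r_def)
    have near: "dist (x + s *\<^sub>R u + t *\<^sub>R v) x < m" if "0 \<le> s" "s \<le> r" "0 \<le> t" "t \<le> r" for s t
    proof -
      have "dist (x + s *\<^sub>R u + t *\<^sub>R v) x = norm (s *\<^sub>R u + t *\<^sub>R v)"
        by (simp add: dist_norm algebra_simps)
      also have "\<dots> \<le> s * norm u + t * norm v"
        using that norm_triangle_ineq[of "s *\<^sub>R u" "t *\<^sub>R v"] by simp
      also have "\<dots> \<le> r * norm u + r * norm v"
        using that by (intro add_mono mult_right_mono) auto
      also have "\<dots> \<le> r * (norm u + norm v + 1)" using r by (simp add: algebra_simps)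
      also have "\<dots> = m / 2" using nuv by (simp add: r_def field_simps)
      finally show ?thesis using m by simp
    qed
    have inS: "x + s *\<^sub>R u + t *\<^sub>R v \<in> S" "x + t *\<^sub>R v + s *\<^sub>R u \<in> S"
      if "0 \<le> s" "s \<le> r" "0 \<le> t" "t \<le> r" for s t
    proof -
      show 1: "x + s *\<^sub>R u + t *\<^sub>R v \<in> S"
        using near[OF that] e by (auto simp: m_def dist_commute)
      show "x + t *\<^sub>R v + s *\<^sub>R u \<in> S" using 1 by (simp add: algebra_simps)
    qed
    obtain s t where st: "0 \<le> s" "s \<le> r" "0 \<le> t" "t \<le> r"
      and 1: "f (x + r *\<^sub>R u + r *\<^sub>R v) - f (x + r *\<^sub>R u) - f (x + r *\<^sub>R v) + f x = r * r * D u v (x + s *\<^sub>R u + t *\<^sub>R v)"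
      using second_difference_mean_value[OF f r, of x u v] inS(1) unfolding D_def by metis
    obtain s' t' where st': "0 \<le> s'" "s' \<le> r" "0 \<le> t'" "t' \<le> r"
      and 2: "f (x + r *\<^sub>R v + r *\<^sub>R u) - f (x + r *\<^sub>R v) - f (x + r *\<^sub>R u) + f x = r * r * D v u (x + s' *\<^sub>R v + t' *\<^sub>R u)"
      using second_difference_mean_value[OF f r, of x v u] inS(2) unfolding D_def by metis
    have eq: "D u v (x + s *\<^sub>R u + t *\<^sub>R v) = D v u (x + s' *\<^sub>R v + t' *\<^sub>R u)"
    proof -
      have sw: "x + r *\<^sub>R v + r *\<^sub>R u = x + r *\<^sub>R u + r *\<^sub>R v" by (simp add: algebra_simps)
      have "r * r * D u v (x + s *\<^sub>R u + t *\<^sub>R v) = r * r * D v u (x + s' *\<^sub>R v + t' *\<^sub>R u)"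
        using 1 2 unfolding sw by linarith
      then show ?thesis using r by simp
    qed
    have "dist (D u v (x + s *\<^sub>R u + t *\<^sub>R v)) (D u v x) < \<epsilon>"
      using d(2) near[OF st] by (simp add: m_def)
    moreover have sw: "x + s' *\<^sub>R v + t' *\<^sub>R u = x + t' *\<^sub>R u + s' *\<^sub>R v" by (simp add: algebra_simps)
    have "dist (D v u (x + s' *\<^sub>R v + t' *\<^sub>R u)) (D v u x) < \<epsilon>"
      unfolding sw by (rule d(4)) (use near[of t' s'] st' in \<open>simp add: m_def\<close>)
    ultimately show False
      using abs_triangle_ineq4[of "D v u (x + s' *\<^sub>R v + t' *\<^sub>R u) - D v u x"
          "D v u (x + s' *\<^sub>R v + t' *\<^sub>R u) - D u v x"]
      unfolding eq \<epsilon>_def dist_real_def by simp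
  qed
  then show ?thesis by (simp add: D_def)
qed

section \<open>Integration on \<open>real ^ 'n\<close>\<close>

text \<open>The change of variables theorem of the library asks for a well-ordered index type. The type
  below is a well-ordered copy of an arbitrary finite type.\<close>

typedef ('n::finite) idx = "{..<CARD('n)}"
  using zero_less_card_finite by blast

instance idx :: (finite) finite
proof
  have "(UNIV :: 'a idx set) = Abs_idx ` {..<CARD('a)}"
    by (metis type_definition.Abs_image type_definition_idx)
  then show "finite (UNIV :: 'a idx set)" by (metis finite_imageI finite_lessThan)
qed

instantiation idx :: (finite) wellorder
begin

definition less_eq_idx :: "'a idx \<Rightarrow> 'a idx \<Rightarrow> bool" where
  "less_eq_idx i j \<longleftrightarrow> Rep_idx i \<le> Rep_idx j"

definition less_idx :: "'a idx \<Rightarrow> 'a idx \<Rightarrow> bool" where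
  "less_idx i j \<longleftrightarrow> Rep_idx i < Rep_idx j"

instance
proof
  fix P :: "'a idx \<Rightarrow> bool" and a :: "'a idx"
  assume step: "\<And>x. (\<And>y. y < x \<Longrightarrow> P y) \<Longrightarrow> P x"
  show "P a"
  proof (induction a rule: measure_induct_rule[of Rep_idx])
    case (less x)
    show ?case by (rule step) (rule less.IH, simp add: less_idx_def)
  qed
qed (auto simp: less_eq_idx_def less_idx_def Rep_idx_inject)

end

lemma CARD_idx: "CARD('n::finite idx) = CARD('n)"
  using type_definition.card[OF type_definition_idx] by simp

section \<open>Relabelling coordinates along a bijection of index types\<close>

definition reindex_vec :: "('k \<Rightarrow> 'n) \<Rightarrow> 'a ^ 'n \<Rightarrow> 'a ^ 'k" where
  "reindex_vec e x = (\<chi> k. x $ e k)"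

context
  fixes e :: "'k::finite \<Rightarrow> 'n::finite"
  assumes e: "bij e"
begin

lemma reindex_vec_inverse [simp]:
  "reindex_vec (inv e) (reindex_vec e x) = x" "reindex_vec e (reindex_vec (inv e) y) = y"
  using e by (simp_all add: reindex_vec_def vec_eq_iff bij_is_surj surj_f_inv_f bij_is_inj inv_f_f)

text \<open>\<open>map_permutation UNIV e\<close> is conjugation by \<open>e\<close>. It is a
  bijection between the permutations of the two index types and preserves signs, so the Leibniz
  expansions agree term by term.\<close>

lemma det_reindex:
  fixes A :: "'a::comm_ring_1 ^ 'n ^ 'n"
  shows "det (\<chi> i j. A $ e i $ e j) = det A"
proof -
  have inj: "inj e" and surj: "surj e" using e by (auto simp: bij_is_inj bij_is_surj)
  let ?m = "map_permutation UNIV e"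
  have m: "?m p = (\<lambda>x. e (p (inv e x)))" for p
    by (auto simp: map_permutation_def restrict_id_def fun_eq_iff surj)
  have bij: "bij_betw ?m {p. p permutes UNIV} {p. p permutes UNIV}"
    using bij_betw_permutations[OF e] by (simp add: m[abs_def])
  have "det A = (\<Sum>p\<in>{p. p permutes UNIV}. of_int (sign (?m p)) * (\<Prod>i\<in>UNIV. A $ i $ ?m p i))"
    unfolding det_def by (rule sum.reindex_bij_betw[OF bij, symmetric])
  also have "\<dots> = (\<Sum>p\<in>{p. p permutes UNIV}. of_int (sign p) * (\<Prod>i\<in>UNIV. A $ e i $ e (p i)))"
  proof (intro sum.cong refl)
    fix p :: "'k \<Rightarrow> 'k" assume "p \<in> {p. p permutes UNIV}"
    then have "sign (?m p) = sign p" using sign_map_permutation[of e UNIV p] inj by simp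
    moreover have "(\<Prod>i\<in>UNIV. A $ i $ ?m p i) = (\<Prod>i\<in>UNIV. A $ e i $ ?m p (e i))"
      by (rule prod.reindex_bij_betw[OF e, symmetric])
    ultimately show "of_int (sign (?m p)) * (\<Prod>i\<in>UNIV. A $ i $ ?m p i) =
        of_int (sign p) * (\<Prod>i\<in>UNIV. A $ e i $ e (p i))"
      by (simp add: m inj)
  qed
  finally show ?thesis by (simp add: det_def)
qed

lemma linear_reindex_vec: "linear (reindex_vec e :: real ^ 'n \<Rightarrow> real ^ 'k)"
  by (intro linearI) (simp_all add: reindex_vec_def vec_eq_iff)

lemma borel_measurable_reindex_vec [measurable]:
  "(reindex_vec e :: real ^ 'n \<Rightarrow> real ^ 'k) \<in> borel_measurable borel"
  by (intro borel_measurable_continuous_onI linear_continuous_on)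
    (simp add: linear_conv_bounded_linear[symmetric] linear_reindex_vec)

text \<open>The preimage of a box is a box with the same side lengths in another order, and Lebesgue
  measure is determined by its values on boxes.\<close>

lemma lborel_distr_reindex_vec:
  "distr (lborel :: (real ^ 'n) measure) borel (reindex_vec e) = lborel"
proof (rule lborel_eqI[symmetric])
  fix l u :: "real ^ 'k"
  assume le: "\<And>b. b \<in> Basis \<Longrightarrow> l \<bullet> b \<le> u \<bullet> b"
  have inj: "inj e" and surj: "surj e" using e by (auto simp: bij_is_inj bij_is_surj)
  let ?l = "reindex_vec (inv e) l" and ?u = "reindex_vec (inv e) u"
  have pB: "(\<Prod>b\<in>Basis. x \<bullet> b) = (\<Prod>i\<in>UNIV. x $ i)" for x :: "real ^ 'm::finite"
  proof -
    have "(Basis :: (real ^ 'm) set) = (\<lambda>i. axis i 1) ` UNIV" by (auto simp: Basis_vec_def)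
    then show ?thesis
      using prod.reindex[of "\<lambda>i::'m. axis i (1::real)" UNIV "\<lambda>b. x \<bullet> b"]
      by (simp add: inner_axis inj_on_def axis_eq_axis o_def)
  qed
  have le': "l $ k \<le> u $ k" for k
    using le[of "axis k 1"] by (simp add: inner_axis)
  have vimage: "reindex_vec e -` box l u = box ?l ?u"
  proof -
    have "reindex_vec e x \<in> box l u \<longleftrightarrow> x \<in> box ?l ?u" for x
      unfolding mem_box_cart
    proof safe
      fix i assume "\<forall>k. l $ k < reindex_vec e x $ k \<and> reindex_vec e x $ k < u $ k"
      then have "l $ inv e i < reindex_vec e x $ inv e i" "reindex_vec e x $ inv e i < u $ inv e i" by auto
      then show "?l $ i < x $ i" "x $ i < ?u $ i"
        by (simp_all add: reindex_vec_def surj surj_f_inv_f)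
    next
      fix k assume "\<forall>i. ?l $ i < x $ i \<and> x $ i < ?u $ i"
      then have "?l $ e k < x $ e k" "x $ e k < ?u $ e k" by auto
      then show "l $ k < reindex_vec e x $ k" "reindex_vec e x $ k < u $ k"
        by (simp_all add: reindex_vec_def inj)
    qed
    then show ?thesis by auto
  qed
  have "emeasure (distr lborel borel (reindex_vec e)) (box l u) = emeasure lborel (box ?l ?u)"
    by (simp add: emeasure_distr vimage)
  also have "\<dots> = (\<Prod>b\<in>Basis. (?u - ?l) \<bullet> b)"
    by (rule emeasure_lborel_box)
      (use le' in \<open>auto simp: Basis_vec_def inner_axis reindex_vec_def\<close>)
  also have "\<dots> = (\<Prod>i\<in>UNIV. (u - l) $ inv e i)"
    unfolding pB by (simp add: reindex_vec_def)
  also have "\<dots> = (\<Prod>b\<in>Basis. (u - l) \<bullet> b)"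
    unfolding pB using prod.reindex_bij_betw[OF bij_imp_bij_inv[OF e], of "\<lambda>k. (u - l) $ k"] by simp
  finally show "emeasure (distr lborel borel (reindex_vec e)) (box l u) = (\<Prod>b\<in>Basis. (u - l) \<bullet> b)" .
qed simp

end

text \<open>Translates a statement on absolute integrability with values in \<open>real ^ 1\<close>
  into one on integrals over \<open>lborel\<close>. The measurability supplied by \<open>int\<close>
  and \<open>meas\<close> identifies integrals over \<open>lborel\<close> with those over its
  completion.\<close>

lemma lborel_change_of_variables_wellorder:
  fixes f :: "real ^ 'n::{finite,wellorder} \<Rightarrow> real" and \<tau> :: "real ^ 'n::{finite,wellorder} \<Rightarrow> real ^ 'n::_"
  assumes S: "open S" "open (\<tau> ` S)"
    and der: "\<And>x. x \<in> S \<Longrightarrow> (\<tau> has_derivative \<tau>' x) (at x)"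
    and inj: "inj_on \<tau> S"
    and int: "integrable lborel (\<lambda>y. indicator (\<tau> ` S) y * f y)"
    and meas: "(\<lambda>x. indicator S x * (\<bar>det (matrix (\<tau>' x))\<bar> * f (\<tau> x))) \<in> borel_measurable borel"
  shows "(\<integral>y. indicator (\<tau> ` S) y * f y \<partial>lborel) =
    (\<integral>x. indicator S x * (\<bar>det (matrix (\<tau>' x))\<bar> * f (\<tau> x)) \<partial>lborel)"
proof -
  let ?h = "\<lambda>x. \<bar>det (matrix (\<tau>' x))\<bar> * f (\<tau> x)"
  have f: "f absolutely_integrable_on \<tau> ` S"
    unfolding set_integrable_def using int integrable_completion[OF borel_measurable_integrable[OF int]]
    by simp
  have "(\<lambda>x. \<bar>det (matrix (\<tau>' x))\<bar> *\<^sub>R vec (f (\<tau> x)) :: real ^ 1) absolutely_integrable_on S \<and>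
      integral S (\<lambda>x. \<bar>det (matrix (\<tau>' x))\<bar> *\<^sub>R vec (f (\<tau> x))) = (vec (integral (\<tau> ` S) f) :: real ^ 1)
    \<longleftrightarrow> (\<lambda>x. vec (f x) :: real ^ 1) absolutely_integrable_on (\<tau> ` S) \<and>
      integral (\<tau> ` S) (\<lambda>x. vec (f x)) = (vec (integral (\<tau> ` S) f) :: real ^ 1)"
    by (rule has_absolute_integral_change_of_variables[OF _ _ inj])
      (use S der in \<open>auto intro: has_derivative_at_withinI\<close>)
  then have h: "?h absolutely_integrable_on S" "integral S ?h = integral (\<tau> ` S) f"
    using f by (simp_all add: absolutely_integrable_on_1_iff integral_on_1_eq)
  have "(LINT x:S|lebesgue. ?h x) = (LINT y:\<tau> ` S|lebesgue. f y)"
    using h(2) set_lebesgue_integral_eq_integral(2)[OF f] set_lebesgue_integral_eq_integral(2)[OF h(1)]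
    by simp
  then show ?thesis
    using integral_completion[OF meas[folded measurable_lborel2]]
      integral_completion[OF borel_measurable_integrable[OF int]]
    by (simp add: set_lebesgue_integral_def)
qed

text \<open>Conjugation with the relabelling \<open>T\<close>: \<open>\<sigma>\<close> is
  \<open>\<tau>\<close> read on the well-ordered copy. Relabelling preserves \<open>lborel\<close>,
  and since rows and columns of the Jacobian matrix are relabelled alike, its determinant is
  unchanged.\<close>

theorem lborel_change_of_variables:
  fixes f :: "real ^ 'n::finite \<Rightarrow> real" and \<tau> :: "real ^ 'n::finite \<Rightarrow> real ^ 'n"
  assumes S: "open S" "open (\<tau> ` S)"
    and der: "\<And>x. x \<in> S \<Longrightarrow> (\<tau> has_derivative \<tau>' x) (at x)"
    and inj: "inj_on \<tau> S"
    and int: "integrable lborel (\<lambda>y. indicator (\<tau> ` S) y * f y)"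
    and meas: "(\<lambda>x. indicator S x * (\<bar>det (matrix (\<tau>' x))\<bar> * f (\<tau> x))) \<in> borel_measurable borel"
  shows "(\<integral>y. indicator (\<tau> ` S) y * f y \<partial>lborel) =
    (\<integral>x. indicator S x * (\<bar>det (matrix (\<tau>' x))\<bar> * f (\<tau> x)) \<partial>lborel)"
proof -
  obtain e :: "'n idx \<Rightarrow> 'n" where e: "bij e"
    using finite_same_card_bij[of "UNIV :: 'n idx set" "UNIV :: 'n set"] CARD_idx by auto
  have e': "bij (inv e)" using bij_imp_bij_inv[OF e] .
  have inve: "inv (inv e) = e" using inv_inv_eq[OF e] .
  define T where "T = (reindex_vec e :: real ^ 'n \<Rightarrow> real ^ 'n idx)"
  define T' where "T' = (reindex_vec (inv e) :: real ^ 'n idx \<Rightarrow> real ^ 'n)"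
  have TT [simp]: "T' (T x) = x" "T (T' y) = y" for x y
    by (simp_all add: T_def T'_def e)
  have blT: "bounded_linear T" "bounded_linear T'"
    using linear_reindex_vec[OF e] linear_reindex_vec[OF e']
    by (simp_all add: T_def T'_def linear_conv_bounded_linear)
  have [measurable]: "T \<in> borel_measurable borel" "T' \<in> borel_measurable borel"
    using borel_measurable_reindex_vec[OF e] borel_measurable_reindex_vec[OF e']
    by (simp_all add: T_def T'_def)
  have dT: "distr lborel borel T = lborel" and dT': "distr lborel borel T' = lborel"
    using lborel_distr_reindex_vec[OF e] lborel_distr_reindex_vec[OF e'] by (simp_all add: T_def T'_def)
  have int_T': "(\<integral>x. h (T' x) \<partial>lborel) = (\<integral>x. h x \<partial>lborel)" if "h \<in> borel_measurable borel" for h :: "real ^ 'n \<Rightarrow> real"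
    using integral_distr[of T' lborel borel h] that by (simp add: dT')
  define \<sigma> where "\<sigma> = (\<lambda>y. T (\<tau> (T' y)))"
  define \<sigma>' where "\<sigma>' = (\<lambda>y v. T (\<tau>' (T' y) (T' v)))"
  have imT: "T ` U = T' -` U" for U
    by (auto simp: image_iff) (metis TT(2))
  have openT: "open (T ` U)" if "open U" for U
    unfolding imT using that by (intro open_vimage linear_continuous_on blT)
  have im: "\<sigma> ` (T ` S) = T ` (\<tau> ` S)" by (auto simp: \<sigma>_def image_image)
  have ind: "indicator (T ` U) y = (indicator U (T' y) :: real)" for U y
    by (simp add: imT indicator_def)
  have detT: "det (matrix (\<sigma>' y)) = det (matrix (\<tau>' (T' y)))" if "T' y \<in> S" for y
  proof -
    note L = has_derivative_linear[OF der[OF that]]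
    have T'ax: "T' (axis j 1) = axis (e j) 1" for j
      using bij_is_inj[OF e] bij_is_surj[OF e]
      by (auto simp: T'_def reindex_vec_def axis_def vec_eq_iff surj_f_inv_f)
    have "matrix (\<sigma>' y) = (\<chi> i j. matrix (\<tau>' (T' y)) $ e i $ e j)"
      by (simp add: matrix_def \<sigma>'_def T'ax vec_eq_iff) (simp add: T_def reindex_vec_def)
    then show ?thesis by (simp add: det_reindex[OF e])
  qed
  have A: "(\<integral>y. indicator (\<sigma> ` T ` S) y * f (T' y) \<partial>lborel) =
    (\<integral>x. indicator (T ` S) x * (\<bar>det (matrix (\<sigma>' x))\<bar> * f (T' (\<sigma> x))) \<partial>lborel)"
  proof (rule lborel_change_of_variables_wellorder)
    show "open (T ` S)" "open (\<sigma> ` T ` S)" using S openT by (simp_all add: im)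
    show "(\<sigma> has_derivative \<sigma>' x) (at x)" if "x \<in> T ` S" for x
      unfolding \<sigma>_def \<sigma>'_def
      by (rule bounded_linear.has_derivative[OF blT(1)]
          has_derivative_compose[OF bounded_linear_imp_has_derivative[OF blT(2)]] der)+
        (use that in \<open>simp add: imT\<close>)
    show "inj_on \<sigma> (T ` S)"
    proof (rule inj_onI)
      fix x y assume "x \<in> T ` S" "y \<in> T ` S" "\<sigma> x = \<sigma> y"
      then have "T' x \<in> S" "T' y \<in> S" "\<tau> (T' x) = \<tau> (T' y)"
        unfolding \<sigma>_def by (auto simp: imT) (metis TT(1))
      then have "T' x = T' y" using inj by (auto dest: inj_onD)
      then show "x = y" by (metis TT(2))
    qed
    have "integrable (distr lborel borel T') (\<lambda>y. indicator (\<tau> ` S) y * f y)"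
      using int by (simp add: dT')
    then have "integrable lborel (\<lambda>y. indicator (\<tau> ` S) (T' y) * f (T' y))"
      by (rule integrable_distr[rotated]) simp
    then show "integrable lborel (\<lambda>y. indicator (\<sigma> ` T ` S) y * f (T' y))"
      by (simp add: im ind)
    have "(\<lambda>x. indicator S (T' x) * (\<bar>det (matrix (\<tau>' (T' x)))\<bar> * f (\<tau> (T' x)))) \<in> borel_measurable borel"
      using measurable_compose[OF _ meas, of T' borel] by simp
    moreover have "indicator S (T' x) * (\<bar>det (matrix (\<tau>' (T' x)))\<bar> * f (\<tau> (T' x))) =
       indicator (T ` S) x * (\<bar>det (matrix (\<sigma>' x))\<bar> * f (T' (\<sigma> x)))" for x
      by (cases "T' x \<in> S") (auto simp: ind detT \<sigma>_def)
    ultimately show "(\<lambda>x. indicator (T ` S) x * (\<bar>det (matrix (\<sigma>' x))\<bar> * f (T' (\<sigma> x)))) \<in> borel_measurable borel"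
      by simp
  qed
  have "(\<integral>y. indicator (\<tau> ` S) y * f y \<partial>lborel) = (\<integral>y. indicator (\<sigma> ` T ` S) y * f (T' y) \<partial>lborel)"
    unfolding im ind
    using int_T'[of "\<lambda>y. indicator (\<tau> ` S) y * f y"] borel_measurable_integrable[OF int] by simp
  also note A
  also have "(\<integral>x. indicator (T ` S) x * (\<bar>det (matrix (\<sigma>' x))\<bar> * f (T' (\<sigma> x))) \<partial>lborel) =
      (\<integral>x. indicator S (T' x) * (\<bar>det (matrix (\<tau>' (T' x)))\<bar> * f (\<tau> (T' x))) \<partial>lborel)"
  proof (rule Bochner_Integration.integral_cong)
    show "indicator (T ` S) x * (\<bar>det (matrix (\<sigma>' x))\<bar> * f (T' (\<sigma> x))) =
        indicator S (T' x) * (\<bar>det (matrix (\<tau>' (T' x)))\<bar> * f (\<tau> (T' x)))" for x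
      by (cases "T' x \<in> S") (auto simp: ind detT \<sigma>_def)
  qed simp
  also have "\<dots> = (\<integral>x. indicator S x * (\<bar>det (matrix (\<tau>' x))\<bar> * f (\<tau> x)) \<partial>lborel)"
    by (rule int_T'[OF meas])
  finally show ?thesis .
qed

section \<open>Integrals of derivatives of compactly supported functions\<close>

lemma Lipschitz_of_bounded_derivative:
  fixes F :: "'a::real_normed_vector \<Rightarrow> real"
  assumes F: "Ck_on 1 F UNIV" and M: "\<And>x. \<bar>frechet_derivative F (at x) v\<bar> \<le> M" and "0 < t"
  shows "\<bar>F (x + t *\<^sub>R v) - F x\<bar> \<le> t * M"
proof -
  have F1: "Ck_on (Suc 0) F UNIV" using F by simp
  have d: "((\<lambda>s. F (x + s *\<^sub>R v)) has_real_derivative frechet_derivative F (at (x + s *\<^sub>R v)) v) (at s)" for s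
  proof -
    note D = Ck_on_has_derivative[OF F1, of "x + s *\<^sub>R v"]
    have "((\<lambda>s. F (x + s *\<^sub>R v)) has_derivative (\<lambda>a. frechet_derivative F (at (x + s *\<^sub>R v)) (a *\<^sub>R v))) (at s)"
      by (rule has_derivative_compose[where f = "\<lambda>s. x + s *\<^sub>R v", OF _ D])
        (auto intro!: derivative_eq_intros)
    then show ?thesis
      unfolding has_field_derivative_def
      by (rule has_derivative_eq_rhs)
        (simp add: fun_eq_iff linear_cmul[OF has_derivative_linear[OF D]] mult.commute)
  qed
  obtain s where "F (x + t *\<^sub>R v) - F (x + 0 *\<^sub>R v) = (t - 0) * frechet_derivative F (at (x + s *\<^sub>R v)) v"
    using MVT2[OF \<open>0 < t\<close>, of "\<lambda>s. F (x + s *\<^sub>R v)" "\<lambda>s. frechet_derivative F (at (x + s *\<^sub>R v)) v"] d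
    by blast
  then show ?thesis using M[of "x + s *\<^sub>R v"] \<open>0 < t\<close> by (simp add: abs_mult)
qed

lemma integrable_compact_support:
  fixes F :: "'a::euclidean_space \<Rightarrow> real"
  assumes "continuous_on UNIV F" "compact K" "\<And>x. x \<notin> K \<Longrightarrow> F x = 0"
  shows "integrable lborel F"
proof -
  have "integrable lborel (\<lambda>x. indicator K x *\<^sub>R F x)"
    by (rule borel_integrable_compact[OF assms(2) continuous_on_subset[OF assms(1)]]) simp
  moreover have "(\<lambda>x. indicator K x *\<^sub>R F x) = F"
    using assms(3) by (auto simp: indicator_def fun_eq_iff)
  ultimately show ?thesis by simp
qed

text \<open>Each difference quotient of \<open>F\<close> has integral zero because Lebesgue measure
  is translation invariant. The quotients are bounded by the maximum of the derivative, so dominated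
  convergence passes to the limit.\<close>

theorem integral_frechet_derivative_eq_0:
  fixes F :: "'a::euclidean_space \<Rightarrow> real"
  assumes F: "Ck_on 1 F UNIV" and K: "compact K" "\<And>x. x \<notin> K \<Longrightarrow> F x = 0"
  shows "(\<integral>x. frechet_derivative F (at x) v \<partial>lborel) = 0"
proof -
  let ?D = "\<lambda>x. frechet_derivative F (at x) v"
  have F1: "Ck_on (Suc 0) F UNIV" using F by simp
  have cF: "continuous_on UNIV F" using Ck_on_imp_continuous_on[OF F] .
  have cD: "continuous_on UNIV ?D" using F1 by simp
  have D0: "?D x = 0" if "x \<notin> K" for x
  proof -
    have "frechet_derivative F (at x) = frechet_derivative (\<lambda>_. 0) (at x)"
      using frechet_derivative_cong_open[of "- K" x F "\<lambda>_. 0"] K compact_imp_closed that by auto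
    then show ?thesis by simp
  qed
  have "bounded (?D ` K)"
    using compact_imp_bounded[OF compact_continuous_image[OF continuous_on_subset[OF cD] K(1)]] by simp
  then obtain M0 where M0: "\<And>x. x \<in> K \<Longrightarrow> \<bar>?D x\<bar> \<le> M0" by (auto simp: bounded_iff)
  \<comment> \<open>Off \<open>K\<close> the derivative is 0, while \<open>M0\<close> may be
    negative if \<open>K\<close> is empty.\<close>
  define M where "M = max 0 M0"
  have M: "\<bar>?D x\<bar> \<le> M" for x
    using M0[of x] D0[of x] by (cases "x \<in> K") (auto simp: M_def)
  obtain R where R: "\<And>x. x \<in> K \<Longrightarrow> norm x \<le> R"
    using compact_imp_bounded[OF K(1)] by (auto simp: bounded_iff)
  \<comment> \<open>As \<open>t n\<close> is at most 1, a translation moves the support by at most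
    \<open>norm v\<close>; outside this ball every difference quotient vanishes.\<close>
  let ?B = "cball (0::'a) (R + norm v)"
  define t where "t n = inverse (real (Suc n))" for n
  have t: "0 < t n" "t n \<le> 1" for n by (auto simp: t_def inverse_le_1_iff)
  define q where "q n x = (F (x + t n *\<^sub>R v) - F x) / t n" for n x
  have iF: "integrable lborel F" by (rule integrable_compact_support[OF cF K])
  have meas [measurable]: "F \<in> borel_measurable borel" "?D \<in> borel_measurable borel"
    using cF cD by (auto intro: borel_measurable_continuous_onI)
  have shift: "integrable lborel (\<lambda>x. F (x + c))" "(\<integral>x. F (x + c) \<partial>lborel) = (\<integral>x. F x \<partial>lborel)" for c
  proof -
    have "integrable (distr lborel borel ((+) c)) F" using iF by (simp add: lborel_distr_plus)
    then have "integrable lborel (\<lambda>x. F (c + x))" by (rule integrable_distr[rotated]) simp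
    then show "integrable lborel (\<lambda>x. F (x + c))" by (simp add: add.commute)
    show "(\<integral>x. F (x + c) \<partial>lborel) = (\<integral>x. F x \<partial>lborel)"
      using integral_distr[of "(+) c" lborel borel F] by (simp add: lborel_distr_plus add.commute)
  qed
  have q0: "(\<integral>x. q n x \<partial>lborel) = 0" for n
    using shift[of "t n *\<^sub>R v"] iF by (simp add: q_def)
  have "(\<lambda>n. \<integral>x. q n x \<partial>lborel) \<longlonglongrightarrow> (\<integral>x. ?D x \<partial>lborel)"
  proof (rule integral_dominated_convergence[where w = "\<lambda>x. indicator ?B x * M"])
    show "integrable lborel (\<lambda>x. indicator ?B x * M)"
      by (intro integrable_mult_left integrable_real_indicator)
        (use emeasure_lborel_cball_finite in \<open>auto simp: top_unique less_top\<close>)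
    show "q n \<in> borel_measurable lborel" for n unfolding q_def by measurable
    show "AE x in lborel. (\<lambda>n. q n x) \<longlonglongrightarrow> ?D x"
    proof (rule AE_I2)
      fix x
      note D = Ck_on_has_derivative[OF F1, of x]
      have "((\<lambda>s. F (x + s *\<^sub>R v)) has_derivative (\<lambda>a. frechet_derivative F (at x) (a *\<^sub>R v))) (at 0)"
        by (rule has_derivative_compose[where f = "\<lambda>s. x + s *\<^sub>R v"])
          (use D in \<open>auto intro!: derivative_eq_intros\<close>)
      then have "((\<lambda>s. F (x + s *\<^sub>R v)) has_real_derivative ?D x) (at 0)"
        unfolding has_field_derivative_def
        by (rule has_derivative_eq_rhs)
          (simp add: fun_eq_iff linear_cmul[OF has_derivative_linear[OF D]] mult.commute)
      then have "(\<lambda>s. (F (x + s *\<^sub>R v) - F x) / s) \<midarrow>0\<rightarrow> ?D x"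
        by (simp add: DERIV_def)
      moreover have "filterlim t (at 0) sequentially"
        unfolding filterlim_at t_def using LIMSEQ_inverse_real_of_nat by auto
      ultimately show "(\<lambda>n. q n x) \<longlonglongrightarrow> ?D x"
        unfolding q_def by (rule filterlim_compose)
    qed
    show "AE x in lborel. norm (q n x) \<le> indicator ?B x * M" for n
    proof (rule AE_I2)
      fix x
      show "norm (q n x) \<le> indicator ?B x * M"
      proof (cases "x \<in> ?B")
        case True
        have "\<bar>F (x + t n *\<^sub>R v) - F x\<bar> \<le> t n * M"
          by (rule Lipschitz_of_bounded_derivative[OF F M t(1)])
        then show ?thesis using True t(1)[of n] by (simp add: q_def field_simps)
      next
        case False
        then have x: "norm x > R + norm v" by (simp add: not_le)
        have "norm x \<le> norm (x + t n *\<^sub>R v) + norm (t n *\<^sub>R v)"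
          using norm_triangle_ineq4[of "x + t n *\<^sub>R v" "t n *\<^sub>R v"] by simp
        also have "norm (t n *\<^sub>R v) \<le> norm v"
          using t[of n] by (simp add: mult_left_le_one_le)
        finally have "norm (x + t n *\<^sub>R v) > R" using x by simp
        then have "F (x + t n *\<^sub>R v) = 0" using K(2) R by force
        moreover have "norm x > R" using x by (smt (verit) norm_ge_zero)
        then have "F x = 0" using K(2) R by force
        ultimately show ?thesis using False by (simp add: q_def)
      qed
    qed
  qed simp_all
  then show ?thesis unfolding q0 by (simp add: LIMSEQ_const_iff)
qed

section \<open>Functions on a chart domain\<close>

text \<open>The set \<open>W\<close> is a parameter because the notion is used on the domain of a
  chart, on the overlap of two domains, and on a domain with a compact support removed.\<close>

definition chart_Ck ::
    "('m, 'n::finite) chart \<Rightarrow> 'm set \<Rightarrow> nat \<Rightarrow> ('m \<Rightarrow> real) \<Rightarrow> bool" where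
  "chart_Ck c W k u \<longleftrightarrow> Ck_on k (\<lambda>x. u (inv_chart c x)) (snd c ` W)"

definition chart_smooth ::
    "('m, 'n::finite) chart \<Rightarrow> 'm set \<Rightarrow> ('m \<Rightarrow> real) \<Rightarrow> bool" where
  "chart_smooth c W u \<longleftrightarrow> (\<forall>k. chart_Ck c W k u)"

lemma chart_smooth_imp_Ck: "chart_smooth c W u \<Longrightarrow> chart_Ck c W k u"
  by (simp add: chart_smooth_def)

lemma chart_Ck_subset: "chart_Ck c W k u \<Longrightarrow> V \<subseteq> W \<Longrightarrow> chart_Ck c V k u"
  unfolding chart_Ck_def by (rule Ck_on_subset) auto

lemma chart_smooth_subset: "chart_smooth c W u \<Longrightarrow> V \<subseteq> W \<Longrightarrow> chart_smooth c V u"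
  unfolding chart_smooth_def using chart_Ck_subset by blast

locale chart_domain =
  fixes c :: "('m::t2_space, 'n::finite) chart" and W :: "'m set"
  assumes chart: "is_chart c" and open_W: "open W" and W_subset: "W \<subseteq> fst c"
begin

lemma inv_chart [simp]: "p \<in> fst c \<Longrightarrow> inv_chart c (snd c p) = p"
  using chart unfolding is_chart_def by (meson homeomorphism_apply1)

lemma inv_chart_W [simp]: "p \<in> W \<Longrightarrow> inv_chart c (snd c p) = p"
  using W_subset by auto

lemma chart_inv [simp]: "x \<in> snd c ` fst c \<Longrightarrow> snd c (inv_chart c x) = x"
  using chart unfolding is_chart_def by (meson homeomorphism_apply2)

lemma continuous_inv_chart: "continuous_on (snd c ` fst c) (inv_chart c)"
  and continuous_chart: "continuous_on (fst c) (snd c)"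
  using chart unfolding is_chart_def homeomorphism_def by auto

lemma open_chart_image: "open V \<Longrightarrow> V \<subseteq> fst c \<Longrightarrow> open (snd c ` V)"
proof -
  assume V: "open V" "V \<subseteq> fst c"
  have "snd c ` V = snd c ` fst c \<inter> inv_chart c -` V"
    using V(2) by (auto simp: image_iff)
  then show ?thesis
    using continuous_open_preimage[OF continuous_inv_chart _ V(1)] chart by (simp add: is_chart_def)
qed

lemma open_image [simp]: "open (snd c ` W)"
  by (rule open_chart_image[OF open_W W_subset])

abbreviation "Ck k u \<equiv> chart_Ck c W k u"
abbreviation "smooth u \<equiv> chart_smooth c W u"

lemma Ck_cong: "(\<And>q. q \<in> W \<Longrightarrow> u q = v q) \<Longrightarrow> Ck k u \<Longrightarrow> Ck k v"
  unfolding chart_Ck_def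
  by (rule Ck_on_cong[OF open_image, where f = "\<lambda>x. u (inv_chart c x)"]) auto

lemma Ck_const: "Ck k (\<lambda>q. a)"
  unfolding chart_Ck_def by (rule Ck_on_const)

lemma Ck_add: "Ck k u \<Longrightarrow> Ck k v \<Longrightarrow> Ck k (\<lambda>q. u q + v q)"
  unfolding chart_Ck_def by (rule Ck_on_add[OF open_image])

lemma Ck_diff: "Ck k u \<Longrightarrow> Ck k v \<Longrightarrow> Ck k (\<lambda>q. u q - v q)"
  unfolding chart_Ck_def by (rule Ck_on_diff[OF open_image])

lemma Ck_mult: "Ck k u \<Longrightarrow> Ck k v \<Longrightarrow> Ck k (\<lambda>q. u q * v q)"
  unfolding chart_Ck_def by (rule Ck_on_mult[OF open_image])

lemma Ck_sum: "(\<And>i. i \<in> I \<Longrightarrow> Ck k (u i)) \<Longrightarrow> Ck k (\<lambda>q. \<Sum>i\<in>I. u i q)"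
  unfolding chart_Ck_def by (rule Ck_on_sum[OF open_image])

lemma Ck_prod: "(\<And>i. i \<in> I \<Longrightarrow> Ck k (u i)) \<Longrightarrow> Ck k (\<lambda>q. \<Prod>i\<in>I. u i q)"
  unfolding chart_Ck_def by (rule Ck_on_prod[OF open_image])

lemma Ck_exp: "Ck k u \<Longrightarrow> Ck k (\<lambda>q. exp (u q))"
  unfolding chart_Ck_def by (rule Ck_on_exp[OF open_image])

lemma Ck_divide: "(\<And>q. q \<in> W \<Longrightarrow> v q \<noteq> 0) \<Longrightarrow> Ck k u \<Longrightarrow> Ck k v \<Longrightarrow> Ck k (\<lambda>q. u q / v q)"
  unfolding chart_Ck_def by (rule Ck_on_divide[OF open_image]) auto

lemma Ck_sqrt: "(\<And>q. q \<in> W \<Longrightarrow> 0 < u q) \<Longrightarrow> Ck k u \<Longrightarrow> Ck k (\<lambda>q. sqrt (u q))"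
  unfolding chart_Ck_def by (rule Ck_on_sqrt[OF open_image]) auto

lemma Ck_has_derivative:
  "Ck (Suc k) u \<Longrightarrow> p \<in> W \<Longrightarrow> ((\<lambda>x. u (inv_chart c x)) has_derivative
     frechet_derivative (\<lambda>x. u (inv_chart c x)) (at (snd c p))) (at (snd c p))"
  unfolding chart_Ck_def by (rule Ck_on_has_derivative) (assumption, rule imageI)

lemma partial_eq: "partial c i u p = frechet_derivative (\<lambda>x. u (inv_chart c x)) (at (snd c p)) (axis i 1)"
  unfolding partial_def comp_def ..

lemma partialI:
  "((\<lambda>x. u (inv_chart c x)) has_derivative D) (at (snd c p)) \<Longrightarrow> partial c i u p = D (axis i 1)"
  unfolding partial_eq by (drule frechet_derivative_at) simp

lemma partial_cong:
  assumes "p \<in> W" "\<And>q. q \<in> W \<Longrightarrow> u q = v q"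
  shows "partial c i u p = partial c i v p"
proof -
  have "frechet_derivative (\<lambda>x. u (inv_chart c x)) (at (snd c p)) =
      frechet_derivative (\<lambda>x. v (inv_chart c x)) (at (snd c p))"
    by (rule frechet_derivative_cong_open[OF open_image]) (use assms in auto)
  then show ?thesis by (simp add: partial_eq)
qed

lemma Ck_partial:
  assumes "Ck (Suc k) u"
  shows "Ck k (partial c i u)"
  unfolding chart_Ck_def
proof (rule Ck_on_cong[OF open_image])
  show "Ck_on k (\<lambda>x. frechet_derivative (\<lambda>x. u (inv_chart c x)) (at x) (axis i 1)) (snd c ` W)"
    using assms unfolding chart_Ck_def by (rule Ck_on_frechet)
qed (auto simp: partial_eq)

lemma partial_const: "partial c i (\<lambda>q. a) p = 0"
  by (rule partialI) (rule has_derivative_const)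

context
  fixes p :: 'm
  assumes p: "p \<in> W"
begin

lemma partial_add:
  assumes "Ck (Suc 0) u" "Ck (Suc 0) v"
  shows "partial c i (\<lambda>q. u q + v q) p = partial c i u p + partial c i v p"
  unfolding partial_eq[of _ u] partial_eq[of _ v]
  by (rule partialI) (rule has_derivative_add[OF assms[THEN Ck_has_derivative[OF _ p]]])

lemma partial_mult:
  assumes "Ck (Suc 0) u" "Ck (Suc 0) v"
  shows "partial c i (\<lambda>q. u q * v q) p = u p * partial c i v p + partial c i u p * v p"
  using partialI[OF has_derivative_mult[OF assms[THEN Ck_has_derivative[OF _ p]]], of i] p
  by (simp add: partial_eq)

lemma partial_sum:
  assumes "\<And>j. j \<in> I \<Longrightarrow> Ck (Suc 0) (u j)"
  shows "partial c i (\<lambda>q. \<Sum>j\<in>I. u j q) p = (\<Sum>j\<in>I. partial c i (u j) p)"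
  unfolding partial_eq[of _ "u _"]
  by (rule partialI) (rule has_derivative_sum[OF assms[THEN Ck_has_derivative[OF _ p]]])

lemma partial_exp:
  assumes "Ck (Suc 0) u"
  shows "partial c i (\<lambda>q. exp (u q)) p = exp (u p) * partial c i u p"
  using partialI[OF has_derivative_exp[OF assms[THEN Ck_has_derivative[OF _ p]]], of i] p
  by (simp add: partial_eq)

lemma partial_sqrt:
  assumes "Ck (Suc 0) u" "0 < u p"
  shows "partial c i (\<lambda>q. sqrt (u q)) p = partial c i u p / (2 * sqrt (u p))"
proof -
  have "0 < u (inv_chart c (snd c p))" using assms(2) p by simp
  from partialI[OF has_derivative_real_sqrt[OF this Ck_has_derivative[OF assms(1) p]], of i]
  show ?thesis using p by (simp add: partial_eq field_simps)
qed

lemma partial_prod: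
  assumes "finite I" "\<And>j. j \<in> I \<Longrightarrow> Ck (Suc 0) (u j)"
  shows "partial c i (\<lambda>q. \<Prod>j\<in>I. u j q) p = (\<Sum>j\<in>I. partial c i (u j) p * (\<Prod>k\<in>I - {j}. u k p))"
  using assms
proof (induction I rule: finite_induct)
  case empty
  then show ?case by (simp add: partial_const)
next
  case (insert a I)
  have "(\<Prod>k\<in>insert a I - {j}. u k p) = u a p * (\<Prod>k\<in>I - {j}. u k p)" if "j \<in> I" for j
  proof -
    have "insert a I - {j} = insert a (I - {j})" using insert.hyps that by auto
    then show ?thesis using insert.hyps by simp
  qed
  moreover have "insert a I - {a} = I" using insert.hyps by auto
  ultimately have "(\<Sum>j\<in>insert a I. partial c i (u j) p * (\<Prod>k\<in>insert a I - {j}. u k p)) =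
     partial c i (u a) p * (\<Prod>k\<in>I. u k p) + u a p * (\<Sum>j\<in>I. partial c i (u j) p * (\<Prod>k\<in>I - {j}. u k p))"
    using insert.hyps by (simp add: sum_distrib_left mult_ac cong: sum.cong)
  moreover have "partial c i (\<lambda>q. u a q * (\<Prod>j\<in>I. u j q)) p =
     u a p * partial c i (\<lambda>q. \<Prod>j\<in>I. u j q) p + partial c i (u a) p * (\<Prod>j\<in>I. u j p)"
    by (rule partial_mult) (use insert.prems in \<open>auto intro: Ck_prod\<close>)
  ultimately show ?case
    using insert by simp
qed

lemma partial_commute:
  assumes "Ck 2 u"
  shows "partial c i (partial c j u) p = partial c j (partial c i u) p"
proof -
  let ?u = "\<lambda>x. u (inv_chart c x)"
  have *: "partial c i (partial c j u) p =
     frechet_derivative (\<lambda>x. frechet_derivative ?u (at x) (axis j 1)) (at (snd c p)) (axis i 1)" for i j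
  proof -
    have "frechet_derivative (\<lambda>x. partial c j u (inv_chart c x)) (at (snd c p)) =
       frechet_derivative (\<lambda>x. frechet_derivative ?u (at x) (axis j 1)) (at (snd c p))"
      by (rule frechet_derivative_cong_open[OF open_image]) (use p in \<open>auto simp: partial_eq\<close>)
    then show ?thesis by (simp add: partial_eq[of i])
  qed
  show ?thesis
    unfolding * using assms p unfolding chart_Ck_def
    by (intro second_derivative_symmetric[OF open_image]) auto
qed

end

lemma smooth_const: "smooth (\<lambda>q. a)"
  by (simp add: chart_smooth_def Ck_const)

lemma smooth_add: "smooth u \<Longrightarrow> smooth v \<Longrightarrow> smooth (\<lambda>q. u q + v q)"
  by (simp add: chart_smooth_def Ck_add)

lemma smooth_diff: "smooth u \<Longrightarrow> smooth v \<Longrightarrow> smooth (\<lambda>q. u q - v q)"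
  by (simp add: chart_smooth_def Ck_diff)

lemma smooth_mult: "smooth u \<Longrightarrow> smooth v \<Longrightarrow> smooth (\<lambda>q. u q * v q)"
  by (simp add: chart_smooth_def Ck_mult)

lemma smooth_sum: "(\<And>i. i \<in> I \<Longrightarrow> smooth (u i)) \<Longrightarrow> smooth (\<lambda>q. \<Sum>i\<in>I. u i q)"
  by (simp add: chart_smooth_def Ck_sum)

lemma smooth_prod: "(\<And>i. i \<in> I \<Longrightarrow> smooth (u i)) \<Longrightarrow> smooth (\<lambda>q. \<Prod>i\<in>I. u i q)"
  by (simp add: chart_smooth_def Ck_prod)

lemma smooth_exp: "smooth u \<Longrightarrow> smooth (\<lambda>q. exp (u q))"
  by (simp add: chart_smooth_def Ck_exp)

lemma smooth_divide:
  "(\<And>q. q \<in> W \<Longrightarrow> v q \<noteq> 0) \<Longrightarrow> smooth u \<Longrightarrow> smooth v \<Longrightarrow> smooth (\<lambda>q. u q / v q)"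
  by (simp add: chart_smooth_def Ck_divide)

lemma smooth_sqrt: "(\<And>q. q \<in> W \<Longrightarrow> 0 < u q) \<Longrightarrow> smooth u \<Longrightarrow> smooth (\<lambda>q. sqrt (u q))"
  by (simp add: chart_smooth_def Ck_sqrt)

lemma smooth_partial: "smooth u \<Longrightarrow> smooth (partial c i u)"
  by (simp add: chart_smooth_def Ck_partial)

lemma smooth_cong: "(\<And>q. q \<in> W \<Longrightarrow> u q = v q) \<Longrightarrow> smooth u \<Longrightarrow> smooth v"
  unfolding chart_smooth_def using Ck_cong by blast

lemmas smooth_intros =
  smooth_const smooth_add smooth_diff smooth_mult smooth_sum smooth_prod smooth_exp
  smooth_partial

end

lemma smooth_det:
  assumes "chart_domain c W" "\<And>i j. chart_smooth c W (\<lambda>q. A q $ i $ j)"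
  shows "chart_smooth c W (\<lambda>q. det (A q :: real ^ 'k::finite ^ 'k))"
proof -
  interpret chart_domain c W by fact
  show ?thesis unfolding det_def by (intro smooth_intros assms(2))
qed

lemma chart_smooth_components:
  assumes "is_chart c" "smooth_on (snd c ` fst c) (F \<circ> inv_chart c)" "bounded_linear L"
  shows "chart_smooth c (fst c) (\<lambda>q. L (F q))"
  using assms Ck_on_linear unfolding chart_smooth_def chart_Ck_def smooth_on_def is_chart_def comp_def
  by blast

section \<open>Transition between two charts\<close>

locale chart_overlap = chart_domain c W for c :: "('m::t2_space, 'n::finite) chart" and W +
  fixes d :: "('m, 'n) chart"
  assumes chart_d: "is_chart d" and W_subset_d: "W \<subseteq> fst d"
    and smooth_transition: "smooth_on (snd c ` W) (transition c d)"
begin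

sublocale d: chart_domain d W
  by unfold_locales (rule chart_d open_W W_subset_d)+

abbreviation "J \<equiv> transition_jac c d"

lemma Ck_transition: "Ck_on k (transition c d) (snd c ` W)"
  using smooth_transition by (simp add: smooth_on_def)

lemma transition_apply: "p \<in> W \<Longrightarrow> transition c d (snd c p) = snd d p"
  by (simp add: transition_def)

lemma transition_jac_apply: "J p $ b $ k = frechet_derivative (transition c d) (at (snd c p)) (axis k 1) $ b"
  by (simp add: transition_jac_def jacobian_def matrix_def)

lemma partial_change:
  assumes "p \<in> W" "d.Ck (Suc 0) u"
  shows "partial c k u p = (\<Sum>b\<in>UNIV. J p $ b $ k * partial d b u p)"
proof -
  have T: "(transition c d has_derivative frechet_derivative (transition c d) (at (snd c p))) (at (snd c p))"
    using Ck_on_has_derivative[OF Ck_transition[of "Suc 0"]] assms(1) by auto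
  have D: "((\<lambda>x. u (inv_chart d x)) has_derivative
      frechet_derivative (\<lambda>x. u (inv_chart d x)) (at (snd d p))) (at (transition c d (snd c p)))"
    using d.Ck_has_derivative[OF assms(2,1)] assms(1) by (simp add: transition_apply)
  have "((\<lambda>x. u (inv_chart c x)) has_derivative (\<lambda>v. frechet_derivative (\<lambda>x. u (inv_chart d x)) (at (snd d p))
      (frechet_derivative (transition c d) (at (snd c p)) v))) (at (snd c p))"
    by (rule has_derivative_transform_within_open[OF has_derivative_compose[OF T D] open_image])
      (use assms(1) in \<open>auto simp: transition_apply\<close>)
  then have "partial c k u p = frechet_derivative (\<lambda>x. u (inv_chart d x)) (at (snd d p))
      (frechet_derivative (transition c d) (at (snd c p)) (axis k 1))"
    by (rule partialI)
  also have "\<dots> = (\<Sum>b\<in>UNIV. J p $ b $ k * partial d b u p)"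
    by (subst linear_eq_sum_axis[OF has_derivative_linear[OF d.Ck_has_derivative[OF assms(2,1)]]])
      (simp add: transition_jac_apply d.partial_eq)
  finally show ?thesis .
qed

lemma Ck_change:
  assumes "d.Ck k u"
  shows "Ck k u"
proof -
  have "transition c d ` snd c ` W \<subseteq> snd d ` W" by (auto simp: transition_apply)
  note * = Ck_on_compose[OF open_image this Ck_transition assms[unfolded chart_Ck_def]]
  show ?thesis
    unfolding chart_Ck_def
    by (rule Ck_on_cong[OF open_image _ *]) (auto simp: transition_apply)
qed

lemma smooth_change: "d.smooth u \<Longrightarrow> smooth u"
  by (simp add: chart_smooth_def Ck_change)

lemma smooth_coordinate: "smooth (\<lambda>q. snd d q $ b)"
proof -
  have "Ck_on k (\<lambda>x. snd d (inv_chart c x) $ b) (snd c ` W)" for k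
    using Ck_on_linear[OF open_image bounded_linear_vec_nth Ck_transition] by (simp add: transition_def)
  then show ?thesis by (simp add: chart_smooth_def chart_Ck_def)
qed

lemma transition_jac_partial:
  assumes "p \<in> W"
  shows "J p $ b $ k = partial c k (\<lambda>q. snd d q $ b) p"
proof -
  have T: "(transition c d has_derivative frechet_derivative (transition c d) (at (snd c p))) (at (snd c p))"
    using Ck_on_has_derivative[OF Ck_transition[of "Suc 0"]] assms(1) by auto
  from bounded_linear.has_derivative[OF bounded_linear_vec_nth[of b] T]
  have "((\<lambda>x. snd d (inv_chart c x) $ b) has_derivative
      (\<lambda>v. frechet_derivative (transition c d) (at (snd c p)) v $ b)) (at (snd c p))"
    by (simp add: transition_def)
  from partialI[OF this] show ?thesis by (simp add: transition_jac_apply)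
qed

lemma smooth_transition_jac: "smooth (\<lambda>q. J q $ b $ k)"
  by (rule smooth_cong[OF _ smooth_partial[OF smooth_coordinate]]) (rule transition_jac_partial[symmetric])

text \<open>The entries of \<open>J\<close> are first derivatives of the coordinates of
  \<open>d\<close>, so this is Schwarz' theorem. It makes the second derivatives of the transition
  map match in \<open>lieX_change\<close>.\<close>

lemma partial_transition_jac_commute:
  assumes "p \<in> W"
  shows "partial c i (\<lambda>q. J q $ b $ k) p = partial c k (\<lambda>q. J q $ b $ i) p"
proof -
  have "partial c i (\<lambda>q. J q $ b $ k) p = partial c i (partial c k (\<lambda>q. snd d q $ b)) p" for i k
    by (rule partial_cong[OF assms]) (simp add: transition_jac_partial)
  then show ?thesis
    using partial_commute[OF assms chart_smooth_imp_Ck[OF smooth_coordinate]] by simp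
qed

end

section \<open>Integrals in charts\<close>

definition chart_extend :: "('m, 'n::finite) chart \<Rightarrow> ('m \<Rightarrow> real) \<Rightarrow> real ^ 'n \<Rightarrow> real" where
  "chart_extend c v x = indicator (snd c ` fst c) x * v (inv_chart c x)"

text \<open>The plain Lebesgue integral of the coordinate expression, hence dependent on the chart.
  A density factor in the integrand makes it independent, see
  \<open>chart_integral_change\<close>.\<close>

definition chart_integral :: "('m, 'n::finite) chart \<Rightarrow> ('m \<Rightarrow> real) \<Rightarrow> real" where
  "chart_integral c v = (\<integral>x. chart_extend c v x \<partial>lborel)"

definition supported_in :: "'m set \<Rightarrow> ('m \<Rightarrow> real) \<Rightarrow> bool" where
  "supported_in K v \<longleftrightarrow> (\<forall>p. p \<notin> K \<longrightarrow> v p = 0)"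

locale whole_chart = chart_domain c "fst c" for c :: "('m::t2_space, 'n::finite) chart"

lemma whole_chartI: "is_chart c \<Longrightarrow> whole_chart c"
  by unfold_locales (auto simp: is_chart_def)

context whole_chart
begin

lemma compact_image: "compact K \<Longrightarrow> K \<subseteq> fst c \<Longrightarrow> compact (snd c ` K)"
  by (rule compact_continuous_image[OF continuous_on_subset[OF continuous_chart]])

lemma chart_extend_outside:
  assumes "K \<subseteq> fst c" "supported_in K v" "x \<notin> snd c ` K"
  shows "chart_extend c v x = 0"
proof (cases "x \<in> snd c ` fst c")
  case True
  then obtain p where "p \<in> fst c" "x = snd c p" by auto
  then show ?thesis using assms by (auto simp: chart_extend_def supported_in_def)
qed (simp add: chart_extend_def)

text \<open>The image of the chart and the complement of the compact image of \<open>K\<close> are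
  open and cover the space; on the first the extension is the coordinate expression, on the second
  it is zero.\<close>

lemma Ck_on_chart_extend:
  assumes "compact K" "K \<subseteq> fst c" "supported_in K v" "Ck k v"
  shows "Ck_on k (chart_extend c v) UNIV"
proof -
  have cl: "open (- (snd c ` K))"
    using compact_imp_closed[OF compact_image[OF assms(1,2)]] by auto
  have "Ck_on k (chart_extend c v) (snd c ` fst c)"
    by (rule Ck_on_cong[OF open_image _ assms(4)[unfolded chart_Ck_def]]) (auto simp: chart_extend_def)
  moreover have "Ck_on k (chart_extend c v) (- (snd c ` K))"
    by (rule Ck_on_cong[OF cl _ Ck_on_const[of k 0]])
      (use chart_extend_outside[OF assms(2,3)] in auto)
  ultimately have "Ck_on k (chart_extend c v) (snd c ` fst c \<union> - (snd c ` K))"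
    by (rule Ck_on_Un[OF open_image cl])
  moreover have "snd c ` fst c \<union> - (snd c ` K) = UNIV" using assms(2) by auto
  ultimately show ?thesis by simp
qed

lemma integrable_chart_extend:
  assumes "compact K" "K \<subseteq> fst c" "supported_in K v" "Ck 0 v"
  shows "integrable lborel (chart_extend c v)"
  by (rule integrable_compact_support[OF _ compact_image[OF assms(1,2)]])
    (use Ck_on_chart_extend[OF assms] chart_extend_outside[OF assms(2,3)] in auto)

lemma chart_integral_sum:
  assumes "compact K" "K \<subseteq> fst c" "\<And>i. i \<in> I \<Longrightarrow> supported_in K (v i)" "\<And>i. i \<in> I \<Longrightarrow> Ck 0 (v i)"
  shows "chart_integral c (\<lambda>p. \<Sum>i\<in>I. v i p) = (\<Sum>i\<in>I. chart_integral c (v i))"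
proof -
  have "chart_extend c (\<lambda>p. \<Sum>i\<in>I. v i p) = (\<lambda>x. \<Sum>i\<in>I. chart_extend c (v i) x)"
    by (simp add: fun_eq_iff chart_extend_def sum_distrib_left)
  then show ?thesis
    unfolding chart_integral_def
    using Bochner_Integration.integral_sum[of I lborel "\<lambda>i. chart_extend c (v i)"]
      integrable_chart_extend[OF assms(1,2) assms(3,4)] by simp
qed

lemma chart_integral_add:
  assumes "compact K" "K \<subseteq> fst c" "supported_in K u" "supported_in K v" "Ck 0 u" "Ck 0 v"
  shows "chart_integral c (\<lambda>p. u p + v p) = chart_integral c u + chart_integral c v"
proof -
  have "chart_extend c (\<lambda>p. u p + v p) = (\<lambda>x. chart_extend c u x + chart_extend c v x)"
    by (simp add: fun_eq_iff chart_extend_def distrib_left)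
  then show ?thesis
    unfolding chart_integral_def
    using Bochner_Integration.integral_add[of lborel "chart_extend c u" "chart_extend c v"]
      integrable_chart_extend[OF assms(1,2)] assms(3-6) by simp
qed

lemma chart_integral_cong: "(\<And>p. p \<in> fst c \<Longrightarrow> u p = v p) \<Longrightarrow> chart_integral c u = chart_integral c v"
  unfolding chart_integral_def
  by (rule Bochner_Integration.integral_cong) (auto simp: chart_extend_def indicator_def)

lemma chart_integral_nonneg: "(\<And>p. p \<in> fst c \<Longrightarrow> 0 \<le> v p) \<Longrightarrow> 0 \<le> chart_integral c v"
  unfolding chart_integral_def
  by (rule integral_nonneg_AE) (auto simp: chart_extend_def indicator_def)

text \<open>By continuity the set where the integrand is nonzero is open, and a vanishing integral
  makes it a null set; an open null set is empty.\<close>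

lemma chart_integral_nonneg_eq_0:
  assumes "compact K" "K \<subseteq> fst c" "supported_in K v" "Ck 0 v" and nonneg: "\<And>p. p \<in> fst c \<Longrightarrow> 0 \<le> v p"
    and "chart_integral c v = 0" and p: "p \<in> fst c"
  shows "v p = 0"
proof -
  let ?F = "chart_extend c v"
  have cont: "continuous_on UNIV ?F" using Ck_on_chart_extend[OF assms(1-4)] by simp
  have "0 \<le> ?F x" for x using nonneg by (auto simp: chart_extend_def indicator_def)
  then have "AE x in lborel. ?F x = 0"
    using integral_nonneg_eq_0_iff_AE[OF integrable_chart_extend[OF assms(1-4)]] assms(6)
    by (simp add: chart_integral_def)
  moreover have op: "open {x. ?F x \<noteq> 0}"
    using open_Collect_neq[OF cont continuous_on_const] by simp
  ultimately have "{x. ?F x \<noteq> 0} \<in> null_sets lborel"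
    using AE_iff_null_sets[of "{x. ?F x \<noteq> 0}" lborel] by simp
  then have "negligible {x. ?F x \<noteq> 0}"
    by (simp add: negligible_iff_null_sets null_sets_completionI)
  then have "{x. ?F x \<noteq> 0} = {}"
    using open_not_negligible[OF op] by blast
  then have "?F (snd c p) = 0" by auto
  then show ?thesis using p by (simp add: chart_extend_def)
qed

text \<open>The integrand is the coordinate divergence of the field \<open>u\<close> times
  \<open>Y\<close>. It has compact support because \<open>u\<close> has, so each of its partial
  derivatives integrates to zero.\<close>

lemma chart_integral_divergence:
  assumes K: "compact K" "K \<subseteq> fst c" "supported_in K u"
    and u: "Ck (Suc 0) u" and Y: "\<And>j. Ck (Suc 0) (\<lambda>q. Y q $ j)"
  shows "chart_integral c (\<lambda>p. u p * (\<Sum>j\<in>UNIV. partial c j (\<lambda>q. Y q $ j) p) +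
    (\<Sum>j\<in>UNIV. partial c j u p * Y p $ j)) = 0"
proof -
  let ?v = "\<lambda>j q. u q * Y q $ j"
  let ?D = "\<lambda>j x. frechet_derivative (chart_extend c (?v j)) (at x) (axis j 1)"
  have sv: "supported_in K (?v j)" for j using K(3) by (simp add: supported_in_def)
  have v: "Ck (Suc 0) (?v j)" for j by (intro Ck_mult u Y)
  note C1 = Ck_on_chart_extend[OF K(1,2) sv v]
  have D_in: "?D j (snd c p) = partial c j (?v j) p" if "p \<in> fst c" for p j
  proof -
    have "frechet_derivative (chart_extend c (?v j)) (at (snd c p)) =
       frechet_derivative (\<lambda>x. ?v j (inv_chart c x)) (at (snd c p))"
      by (rule frechet_derivative_cong_open[OF open_image]) (use that in \<open>auto simp: chart_extend_def\<close>)
    then show ?thesis by (simp add: partial_eq)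
  qed
  have D_out: "?D j x = 0" if "x \<notin> snd c ` K" for x j
  proof -
    have "frechet_derivative (chart_extend c (?v j)) (at x) = frechet_derivative (\<lambda>_. 0) (at x)"
      by (rule frechet_derivative_cong_open[of "- (snd c ` K)"])
        (use that compact_imp_closed[OF compact_image[OF K(1,2)]] chart_extend_outside[OF K(2) sv] in auto)
    then show ?thesis by simp
  qed
  have "integrable lborel (?D j)" for j
    by (rule integrable_compact_support[OF _ compact_image[OF K(1,2)]]) (use C1 D_out in auto)
  then have "(\<integral>x. (\<Sum>j\<in>UNIV. ?D j x) \<partial>lborel) = (\<Sum>j\<in>UNIV. \<integral>x. ?D j x \<partial>lborel)"
    by (intro Bochner_Integration.integral_sum)
  also have "\<dots> = 0"
    using integral_frechet_derivative_eq_0[OF C1[unfolded One_nat_def[symmetric]] compact_image[OF K(1,2)]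
        chart_extend_outside[OF K(2) sv]] by simp
  finally have "(\<integral>x. (\<Sum>j\<in>UNIV. ?D j x) \<partial>lborel) = 0" .
  moreover have "(\<Sum>j\<in>UNIV. ?D j x) = chart_extend c (\<lambda>p. u p * (\<Sum>j\<in>UNIV. partial c j (\<lambda>q. Y q $ j) p) +
    (\<Sum>j\<in>UNIV. partial c j u p * Y p $ j)) x" for x
  proof (cases "x \<in> snd c ` fst c")
    case True
    then obtain p where p: "p \<in> fst c" and x: "x = snd c p" by auto
    have "(\<Sum>j\<in>UNIV. ?D j x) = (\<Sum>j\<in>UNIV. u p * partial c j (\<lambda>q. Y q $ j) p + partial c j u p * Y p $ j)"
      unfolding x using D_in[OF p] partial_mult[OF p u Y] by simp
    then show ?thesis
      using True p by (simp add: chart_extend_def x sum.distrib sum_distrib_left)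
  next
    case False
    then have "x \<notin> snd c ` K" using K(2) by auto
    then show ?thesis using False D_out by (simp add: chart_extend_def)
  qed
  ultimately show ?thesis by (simp add: chart_integral_def)
qed

end

section \<open>Partition of unity and the divergence theorem\<close>

lemma DERIV_max_0_square: "((\<lambda>s. (max 0 s)\<^sup>2) has_real_derivative 2 * max 0 s) (at s)" for s :: real
proof -
  consider "s > 0" | "s < 0" | "s = 0" by linarith
  then show ?thesis
  proof cases
    case 1
    have "((\<lambda>s. s\<^sup>2) has_real_derivative 2 * max 0 s) (at s)"
      using 1 by (auto intro!: derivative_eq_intros)
    then show ?thesis
      by (rule has_field_derivative_transform_within_open[where S = "{0<..}"]) (use 1 in auto)
  next
    case 2
    have "((\<lambda>s. 0) has_real_derivative 2 * max 0 s) (at s)" using 2 by auto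
    then show ?thesis
      by (rule has_field_derivative_transform_within_open[where S = "{..<0}"]) (use 2 in auto)
  next
    case 3
    have "((\<lambda>h. ((max 0 (0 + h))\<^sup>2 - (max 0 (0::real))\<^sup>2) / h) \<longlongrightarrow> 0) (at 0)"
    proof (rule Lim_null_comparison)
      show "\<forall>\<^sub>F h in at 0. norm (((max 0 (0 + h))\<^sup>2 - (max 0 (0::real))\<^sup>2) / h) \<le> \<bar>h\<bar>"
        by (rule always_eventually) (auto simp: power2_eq_square max_def)
    qed (auto intro!: tendsto_eq_intros)
    then show ?thesis using 3 by (simp add: DERIV_def)
  qed
qed

text \<open>Squaring the positive part makes the function C^1 across the sphere of radius
  \<open>r\<close>, and one derivative is all that integration by parts asks of a cut-off function.
  The squared norm is differentiable at the centre as well.\<close>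

definition bump :: "'a::real_inner \<Rightarrow> real \<Rightarrow> 'a \<Rightarrow> real" where
  "bump a r x = (max 0 (r\<^sup>2 - (norm (x - a))\<^sup>2))\<^sup>2"

lemma C1_bump: "Ck_on (Suc 0) (bump a r) S"
proof -
  let ?s = "\<lambda>x. r\<^sup>2 - (norm (x - a))\<^sup>2"
  have "Ck_on (Suc 0) (bump a r) UNIV"
  proof (rule Ck_on_SucI)
    show "(bump a r has_derivative (\<lambda>v. 2 * max 0 (?s x) * (- (2 * ((x - a) \<bullet> v))))) (at x)" for x
    proof -
      have "(?s has_derivative (\<lambda>v. - (2 * ((x - a) \<bullet> v)))) (at x)"
        unfolding power2_norm_eq_inner
        by (auto intro!: derivative_eq_intros simp: inner_commute)
      from has_derivative_compose[OF this DERIV_max_0_square[unfolded has_field_derivative_def]]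
      show ?thesis by (simp add: bump_def[abs_def])
    qed
    show "Ck_on 0 (\<lambda>x. 2 * max 0 (?s x) * (- (2 * ((x - a) \<bullet> v)))) UNIV" for v
      by (auto intro!: continuous_intros)
  qed simp
  then show ?thesis by (rule Ck_on_subset) simp
qed

locale closed_manifold =
  fixes A :: "('m::t2_space, 'n::finite) chart set"
  assumes compact_M: "compact (UNIV :: 'm set)" and atlas: "smooth_atlas A"
begin

lemma whole_chart: "c \<in> A \<Longrightarrow> whole_chart c"
  using atlas by (simp add: whole_chartI smooth_atlas_def)

lemma chart_at: obtains c where "c \<in> A" "p \<in> fst c"
  using atlas unfolding smooth_atlas_def by blast

lemma chart_overlap: "c \<in> A \<Longrightarrow> d \<in> A \<Longrightarrow> chart_overlap c (fst c \<inter> fst d) d"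
  using atlas unfolding smooth_atlas_def is_chart_def
  by unfold_locales (auto simp: is_chart_def)

definition M_Ck :: "nat \<Rightarrow> ('m \<Rightarrow> real) \<Rightarrow> bool" where
  "M_Ck k u \<longleftrightarrow> (\<forall>c\<in>A. chart_Ck c (fst c) k u)"

lemma M_Ck_mult:
  assumes "M_Ck k u" "M_Ck k v"
  shows "M_Ck k (\<lambda>p. u p * v p)"
  unfolding M_Ck_def
proof
  fix c assume c: "c \<in> A"
  then interpret whole_chart c by (rule whole_chart)
  show "chart_Ck c (fst c) k (\<lambda>p. u p * v p)"
    using assms c unfolding M_Ck_def by (intro Ck_mult) auto
qed

lemma M_Ck_sum:
  assumes "\<And>i. i \<in> I \<Longrightarrow> M_Ck k (u i)"
  shows "M_Ck k (\<lambda>p. \<Sum>i\<in>I. u i p)"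
  unfolding M_Ck_def
proof
  fix c assume c: "c \<in> A"
  then interpret whole_chart c by (rule whole_chart)
  show "chart_Ck c (fst c) k (\<lambda>p. \<Sum>i\<in>I. u i p)"
    using assms c unfolding M_Ck_def by (intro Ck_sum) auto
qed

lemma M_Ck_divide:
  assumes "M_Ck k u" "M_Ck k v" "\<And>p. v p \<noteq> 0"
  shows "M_Ck k (\<lambda>p. u p / v p)"
  unfolding M_Ck_def
proof
  fix c assume c: "c \<in> A"
  then interpret whole_chart c by (rule whole_chart)
  show "chart_Ck c (fst c) k (\<lambda>p. u p / v p)"
    using assms c unfolding M_Ck_def by (intro Ck_divide) auto
qed

lemma M_Ck_le: "M_Ck k u \<Longrightarrow> j \<le> k \<Longrightarrow> M_Ck j u"
  unfolding M_Ck_def chart_Ck_def using Ck_on_le by blast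

text \<open>The bump is built in one chart \<open>c\<close>, but must be C^1 in every chart
  \<open>d\<close>. There the domain is covered by two open pieces: the overlap with
  \<open>c\<close>, where regularity transfers along the transition map, and the complement of
  \<open>K\<close>, where the bump vanishes. The latter is open because compact sets in a Hausdorff
  space are closed.\<close>

lemma bump_exists:
  obtains c K \<rho> N where "c \<in> A" "compact K" "K \<subseteq> fst c" "supported_in K \<rho>" "M_Ck (Suc 0) \<rho>"
    "\<And>q. 0 \<le> \<rho> q" "open N" "p \<in> N" "\<And>q. q \<in> N \<Longrightarrow> 0 < \<rho> q"
proof -
  obtain c where c: "c \<in> A" "p \<in> fst c" by (rule chart_at)
  interpret c: whole_chart c by (rule whole_chart[OF c(1)])
  obtain r where r: "0 < r" "cball (snd c p) r \<subseteq> snd c ` fst c"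
    using c.open_image c(2) open_contains_cball by blast
  define K where "K = inv_chart c ` cball (snd c p) r"
  define \<rho> where "\<rho> q = (if q \<in> fst c then bump (snd c p) r (snd c q) else 0)" for q
  define N where "N = inv_chart c ` ball (snd c p) r"
  have K: "compact K"
    unfolding K_def by (rule compact_continuous_image[OF continuous_on_subset[OF c.continuous_inv_chart r(2)]]) simp
  have KU: "K \<subseteq> fst c"
  proof
    fix q assume "q \<in> K"
    then obtain x where "x \<in> snd c ` fst c" "q = inv_chart c x" using r(2) unfolding K_def by blast
    then show "q \<in> fst c" by auto
  qed
  have sq: "norm (x - a) < r \<longleftrightarrow> 0 < r\<^sup>2 - (norm (x - a))\<^sup>2" for x a :: "real ^ 'n"
    using r(1) abs_le_square_iff[of r "norm (x - a)"] by (simp add: not_le[symmetric])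
  have supp: "supported_in K \<rho>"
    unfolding supported_in_def
  proof (intro allI impI)
    fix q assume q: "q \<notin> K"
    show "\<rho> q = 0"
    proof (cases "q \<in> fst c")
      case True
      then have "snd c q \<notin> cball (snd c p) r"
        using q unfolding K_def by (metis c.inv_chart image_eqI)
      then have "\<not> norm (snd c q - snd c p) < r" by (simp add: dist_norm norm_minus_commute)
      then show ?thesis using True unfolding sq by (simp add: \<rho>_def bump_def)
    qed (simp add: \<rho>_def)
  qed
  have C1: "M_Ck (Suc 0) \<rho>"
    unfolding M_Ck_def
  proof
    fix d assume d: "d \<in> A"
    interpret d: whole_chart d by (rule whole_chart[OF d])
    interpret o: chart_overlap d "fst d \<inter> fst c" c by (rule chart_overlap[OF d c(1)])
    have "o.d.Ck (Suc 0) \<rho>"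
      unfolding chart_Ck_def
      by (rule Ck_on_cong[OF o.d.open_image _ C1_bump[of "snd c p" r]]) (auto simp: \<rho>_def)
    then have 1: "o.Ck (Suc 0) \<rho>" by (rule o.Ck_change)
    have op: "open (snd d ` (fst d - K))"
      by (rule d.open_chart_image) (use d.open_W compact_imp_closed[OF K] in \<open>auto intro: open_Diff\<close>)
    have 2: "chart_Ck d (fst d - K) (Suc 0) \<rho>"
      unfolding chart_Ck_def
      by (rule Ck_on_cong[OF op _ Ck_on_const[of _ 0]]) (use supp in \<open>auto simp: supported_in_def\<close>)
    have "snd d ` fst d = snd d ` (fst d \<inter> fst c) \<union> snd d ` (fst d - K)" using KU by auto
    then show "chart_Ck d (fst d) (Suc 0) \<rho>"
      using Ck_on_Un[OF o.open_image op 1[unfolded chart_Ck_def] 2[unfolded chart_Ck_def]]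
      unfolding chart_Ck_def by (simp del: Ck_on.simps)
  qed
  have N_eq: "N = fst c \<inter> snd c -` ball (snd c p) r"
  proof (intro set_eqI iffI)
    fix q assume "q \<in> N"
    then obtain x where x: "x \<in> ball (snd c p) r" "q = inv_chart c x" by (auto simp: N_def)
    then have "x \<in> snd c ` fst c" using r(2) by auto
    then show "q \<in> fst c \<inter> snd c -` ball (snd c p) r" using x by auto
  next
    fix q assume "q \<in> fst c \<inter> snd c -` ball (snd c p) r"
    then show "q \<in> N" unfolding N_def by (metis IntD1 IntD2 c.inv_chart image_eqI vimageD)
  qed
  show thesis
  proof (rule that[OF c(1) K KU supp C1])
    show "0 \<le> \<rho> q" for q by (simp add: \<rho>_def bump_def)
    show "open N" unfolding N_eq
      by (rule continuous_open_preimage[OF c.continuous_chart c.open_W open_ball])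
    show "p \<in> N" using c(2) r(1) by (simp add: N_eq)
    show "0 < \<rho> q" if "q \<in> N" for q
    proof -
      have "norm (snd c q - snd c p) < r" "q \<in> fst c"
        using that by (auto simp: N_eq dist_norm norm_minus_commute)
      then show ?thesis unfolding sq by (simp add: \<rho>_def bump_def)
    qed
  qed
qed

text \<open>By compactness finitely many of the neighbourhoods on which a bump is positive cover the
  manifold, and each bump is divided by the sum of these finitely many. The families are indexed by
  all points, so that only the sum refers to \<open>I\<close>.\<close>

lemma partition_of_unity:
  obtains I :: "'m set" and cc :: "'m \<Rightarrow> ('m, 'n) chart" and K :: "'m \<Rightarrow> 'm set" and \<eta> :: "'m \<Rightarrow> 'm \<Rightarrow> real"
  where "finite I" "\<And>i. cc i \<in> A" "\<And>i. compact (K i)" "\<And>i. K i \<subseteq> fst (cc i)"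
    "\<And>i. supported_in (K i) (\<eta> i)" "\<And>i. M_Ck (Suc 0) (\<eta> i)" "\<And>i p. 0 \<le> \<eta> i p"
    "\<And>p. (\<Sum>i\<in>I. \<eta> i p) = 1"
proof -
  have "\<exists>c K \<rho> N. c \<in> A \<and> compact K \<and> K \<subseteq> fst c \<and> supported_in K \<rho> \<and> M_Ck (Suc 0) \<rho> \<and>
    (\<forall>q. 0 \<le> \<rho> q) \<and> open N \<and> p \<in> N \<and> (\<forall>q\<in>N. 0 < \<rho> q)" for p
    by (rule bump_exists[of p]) blast
  then obtain cc K \<rho> N where *: "\<And>p. cc p \<in> A" "\<And>p. compact (K p)" "\<And>p. K p \<subseteq> fst (cc p)"
    "\<And>p. supported_in (K p) (\<rho> p)" "\<And>p. M_Ck (Suc 0) (\<rho> p)" "\<And>p q. 0 \<le> \<rho> p q"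
    "\<And>p. open (N p)" "\<And>p. p \<in> N p" "\<And>p q. q \<in> N p \<Longrightarrow> 0 < \<rho> p q"
    by metis
  obtain I where I: "finite I" "UNIV \<subseteq> (\<Union>i\<in>I. N i)"
    using compactE_image[OF compact_M, of UNIV N] * by (metis UNIV_I UN_I subsetI)
  define s where "s p = (\<Sum>i\<in>I. \<rho> i p)" for p
  have s: "0 < s p" for p
  proof -
    obtain i where "i \<in> I" "p \<in> N i" using I(2) by auto
    then show ?thesis unfolding s_def
      using I(1) *(6,9) by (intro sum_pos2[of I i]) auto
  qed
  have sC: "M_Ck (Suc 0) s" unfolding s_def by (intro M_Ck_sum *)
  show thesis
  proof (rule that[OF I(1) *(1-3)])
    show "M_Ck (Suc 0) (\<lambda>p. \<rho> i p / s p)" for i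
      by (rule M_Ck_divide[OF *(5) sC]) (use s in \<open>metis less_irrefl\<close>)
    show "(\<Sum>i\<in>I. \<rho> i p / s p) = 1" for p
      using s[of p] by (simp add: sum_divide_distrib[symmetric] s_def[symmetric])
    show "0 \<le> \<rho> i p / s p" for i p
      using *(6)[of i p] s[of p] by simp
    show "supported_in (K i) (\<lambda>p. \<rho> i p / s p)" for i
      using *(4)[of i] by (simp add: supported_in_def)
  qed
qed

end

text \<open>The absolute value of the Jacobian determinant in \<open>density_change\<close> is the
  factor of the change of variables formula; hence integrals against \<open>w\<close> agree in all
  charts. The density used later is the Riemannian one.\<close>

locale density_manifold = closed_manifold A
  for A :: "('m::t2_space, 'n::finite) chart set" +
  fixes w :: "('m, 'n) chart \<Rightarrow> 'm \<Rightarrow> real"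
  assumes C1_density: "c \<in> A \<Longrightarrow> chart_Ck c (fst c) (Suc 0) (w c)"
    and density_pos: "c \<in> A \<Longrightarrow> p \<in> fst c \<Longrightarrow> 0 < w c p"
    and density_change: "c \<in> A \<Longrightarrow> d \<in> A \<Longrightarrow> p \<in> fst c \<Longrightarrow> p \<in> fst d \<Longrightarrow>
      w c p = \<bar>det (transition_jac c d p)\<bar> * w d p"
begin

lemma C0_density: "c \<in> A \<Longrightarrow> chart_Ck c (fst c) 0 (w c)"
  using C1_density unfolding chart_Ck_def by (blast intro: Ck_on_Suc_imp)

lemma Ck0_times_density:
  assumes "c \<in> A" "M_Ck 0 v"
  shows "chart_Ck c (fst c) 0 (\<lambda>p. v p * w c p)"
proof -
  interpret whole_chart c by (rule whole_chart[OF assms(1)])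
  show ?thesis using assms C0_density unfolding M_Ck_def by (intro Ck_mult) auto
qed

text \<open>As \<open>K\<close> lies in both domains, extending by zero from either chart amounts to
  extending from the overlap. On the overlap the Jacobian factor turns \<open>w d\<close> into
  \<open>w c\<close>.\<close>

lemma chart_integral_change:
  assumes c: "c \<in> A" and d: "d \<in> A" and K: "compact K" "K \<subseteq> fst c \<inter> fst d" "supported_in K v" and v: "M_Ck 0 v"
  shows "chart_integral c (\<lambda>p. v p * w c p) = chart_integral d (\<lambda>p. v p * w d p)"
proof -
  let ?W = "fst c \<inter> fst d"
  interpret o: chart_overlap c ?W d by (rule chart_overlap[OF c d])
  interpret c: whole_chart c by (rule whole_chart[OF c])
  interpret d: whole_chart d by (rule whole_chart[OF d])
  let ?t = "transition c d"
  let ?t' = "\<lambda>x. frechet_derivative ?t (at x)"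
  let ?f = "\<lambda>y. v (inv_chart d y) * w d (inv_chart d y)"
  have im: "?t ` snd c ` ?W = snd d ` ?W"
    by (force simp: image_image o.transition_apply)
  have sc: "supported_in K (\<lambda>p. v p * w c p)" and sd: "supported_in K (\<lambda>p. v p * w d p)"
    using K(3) by (auto simp: supported_in_def)
  have Kc: "K \<subseteq> fst c" and Kd: "K \<subseteq> fst d" using K(2) by auto
  have d_ext: "indicator (?t ` snd c ` ?W) y * ?f y = chart_extend d (\<lambda>p. v p * w d p) y" for y
  proof (cases "y \<in> snd d ` ?W")
    case True
    then show ?thesis unfolding im by (auto simp: chart_extend_def)
  next
    case False
    then have "y \<notin> snd d ` K" using K(2) by auto
    then show ?thesis using False d.chart_extend_outside[OF Kd sd] unfolding im by simp
  qed
  have c_ext: "indicator (snd c ` ?W) x * (\<bar>det (matrix (?t' x))\<bar> * ?f (?t x)) =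
      chart_extend c (\<lambda>p. v p * w c p) x" for x
  proof (cases "x \<in> snd c ` ?W")
    case True
    then obtain p where p: "p \<in> ?W" and x: "x = snd c p" by auto
    have "\<bar>det (matrix (?t' x))\<bar> * w d p = w c p"
      using density_change[OF c d, of p] p by (simp add: transition_jac_def jacobian_def x)
    then show ?thesis
      using p by (auto simp: x o.transition_apply chart_extend_def mult_ac)
  next
    case False
    then have "x \<notin> snd c ` K" using K(2) by auto
    then show ?thesis using False c.chart_extend_outside[OF Kc sc] by simp
  qed
  have "(\<integral>y. indicator (?t ` snd c ` ?W) y * ?f y \<partial>lborel) =
    (\<integral>x. indicator (snd c ` ?W) x * (\<bar>det (matrix (?t' x))\<bar> * ?f (?t x)) \<partial>lborel)"
  proof (rule lborel_change_of_variables)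
    show "open (snd c ` ?W)" by (rule o.open_image)
    show "open (?t ` snd c ` ?W)" unfolding im by (rule o.d.open_image)
    show "(?t has_derivative ?t' x) (at x)" if "x \<in> snd c ` ?W" for x
      by (rule Ck_on_has_derivative[OF o.Ck_transition that])
    show "inj_on ?t (snd c ` ?W)"
    proof (rule inj_onI)
      fix x y assume "x \<in> snd c ` ?W" "y \<in> snd c ` ?W" "?t x = ?t y"
      then obtain p q where "p \<in> ?W" "q \<in> ?W" "x = snd c p" "y = snd c q" "snd d p = snd d q"
        by (auto simp: o.transition_apply)
      moreover from this have "p = q" by (metis o.d.inv_chart_W)
      ultimately show "x = y" by simp
    qed
    show "integrable lborel (\<lambda>y. indicator (?t ` snd c ` ?W) y * ?f y)"
      unfolding d_ext by (rule d.integrable_chart_extend[OF K(1) Kd sd Ck0_times_density[OF d v]])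
    show "(\<lambda>x. indicator (snd c ` ?W) x * (\<bar>det (matrix (?t' x))\<bar> * ?f (?t x))) \<in> borel_measurable borel"
      unfolding c_ext
      using borel_measurable_integrable[OF c.integrable_chart_extend[OF K(1) Kc sc Ck0_times_density[OF c v]]]
      by simp
  qed
  then show ?thesis unfolding c_ext d_ext chart_integral_def by simp
qed

text \<open>\<open>h\<close> is the divergence of \<open>V\<close> with respect to \<open>w\<close>.
  The integral of \<open>h\<close> over the manifold is represented by the sum of the integrals of
  \<open>\<eta> i\<close> times \<open>h\<close>, each taken in the chart
  \<open>cc i\<close>.\<close>

theorem nonneg_divergence_eq_0:
  fixes V :: "('m, 'n) vector_field" and h :: "'m \<Rightarrow> real"
  assumes V: "\<And>c i. c \<in> A \<Longrightarrow> chart_Ck c (fst c) (Suc 0) (\<lambda>q. V c q $ i)"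
    and V_change: "\<And>c d p. c \<in> A \<Longrightarrow> d \<in> A \<Longrightarrow> p \<in> fst c \<Longrightarrow> p \<in> fst d \<Longrightarrow> V d p = transition_jac c d p *v V c p"
    and h: "\<And>c p. c \<in> A \<Longrightarrow> p \<in> fst c \<Longrightarrow> (\<Sum>j\<in>UNIV. partial c j (\<lambda>q. w c q * V c q $ j) p) = h p * w c p"
    and h_nonneg: "\<And>p. 0 \<le> h p"
  shows "h p = 0"
proof -
  obtain I :: "'m set" and cc K \<eta> where I: "finite I" and cc: "\<And>i. cc i \<in> A"
    and K: "\<And>i. compact (K i)" "\<And>i. K i \<subseteq> fst (cc i)" and supp: "\<And>i. supported_in (K i) (\<eta> i)"
    and \<eta>: "\<And>i. M_Ck (Suc 0) (\<eta> i)" "\<And>i p. 0 \<le> \<eta> i p" "\<And>p. (\<Sum>i\<in>I. \<eta> i p) = 1"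
    by (rule partition_of_unity) blast
  have \<eta>0: "M_Ck 0 (\<eta> i)" for i using M_Ck_le[OF \<eta>(1)] by simp
  have wV: "chart_Ck c (fst c) (Suc 0) (\<lambda>q. w c q * V c q $ i)" if "c \<in> A" for c i
  proof -
    interpret whole_chart c by (rule whole_chart[OF that])
    show ?thesis by (intro Ck_mult C1_density V that)
  qed
  have h0: "M_Ck 0 h"
    unfolding M_Ck_def
  proof
    fix c assume c: "c \<in> A"
    then interpret whole_chart c by (rule whole_chart)
    \<comment> \<open>The function \<open>h\<close> is known only through its formula in charts;
      dividing by the positive density gives its continuity.\<close>
    have "Ck 0 (\<lambda>p. (\<Sum>j\<in>UNIV. partial c j (\<lambda>q. w c q * V c q $ j) p) / w c p)"
      using density_pos[OF c] by (intro Ck_divide Ck_sum Ck_partial wV C0_density c) force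
    then show "Ck 0 h"
      by (rule Ck_cong[rotated]) (use h[OF c] density_pos[OF c] in force)
  qed
  define ch where "ch p = (SOME c. c \<in> A \<and> p \<in> fst c)" for p
  have ch: "ch p \<in> A" "p \<in> fst (ch p)" for p
    using someI_ex[of "\<lambda>c. c \<in> A \<and> p \<in> fst c"] chart_at[of p] unfolding ch_def by blast+
  \<comment> \<open>The derivative of \<open>\<eta> i\<close> along \<open>V\<close>. To be a
    function on the manifold it is computed in a chosen chart \<open>ch p\<close>; the next fact
    shows that every chart gives the same value.\<close>
  define \<delta> where "\<delta> i p = (\<Sum>k\<in>UNIV. partial (ch p) k (\<eta> i) p * V (ch p) p $ k)" for i p
  have \<delta>: "\<delta> i p = (\<Sum>k\<in>UNIV. partial c k (\<eta> i) p * V c p $ k)" if c: "c \<in> A" "p \<in> fst c" for c i p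
  proof -
    let ?d = "ch p"
    interpret o: chart_overlap c "fst c \<inter> fst ?d" ?d by (rule chart_overlap[OF c(1) ch(1)])
    have \<eta>d: "o.d.Ck (Suc 0) (\<eta> i)"
      using \<eta>(1)[of i] ch(1)[of p] unfolding M_Ck_def by (auto intro: chart_Ck_subset)
    have "(\<Sum>k\<in>UNIV. partial c k (\<eta> i) p * V c p $ k) =
        (\<Sum>k\<in>UNIV. \<Sum>b\<in>UNIV. partial ?d b (\<eta> i) p * (o.J p $ b $ k * V c p $ k))"
      using o.partial_change[OF _ \<eta>d, of p] c ch by (simp add: sum_distrib_left sum_distrib_right mult_ac)
    also have "\<dots> = (\<Sum>b\<in>UNIV. partial ?d b (\<eta> i) p * V ?d p $ b)"
      using V_change[OF c(1) ch(1) c(2) ch(2)]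
      by (subst sum.swap) (simp add: matrix_vector_mult_def sum_distrib_left)
    finally show ?thesis by (simp add: \<delta>_def)
  qed
  have \<delta>0: "M_Ck 0 (\<delta> i)" for i
    unfolding M_Ck_def
  proof
    fix c assume c: "c \<in> A"
    then interpret whole_chart c by (rule whole_chart)
    have "Ck 0 (\<lambda>p. \<Sum>k\<in>UNIV. partial c k (\<eta> i) p * V c p $ k)"
      using \<eta>(1)[of i] V[OF c] c unfolding M_Ck_def
      by (intro Ck_sum Ck_mult Ck_partial) (auto simp: chart_Ck_def intro: Ck_on_Suc_imp simp del: Ck_on.simps)
    then show "Ck 0 (\<delta> i)"
      by (rule Ck_cong[rotated]) (simp add: \<delta>[OF c])
  qed
  have supp_\<delta>: "supported_in (K i) (\<delta> i)" for i
    unfolding supported_in_def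
  proof (intro allI impI)
    fix p assume p: "p \<notin> K i"
    interpret c: whole_chart "ch p" by (rule whole_chart[OF ch(1)])
    \<comment> \<open>As \<open>K i\<close> is closed, \<open>\<eta> i\<close> vanishes on a whole
      neighbourhood of \<open>p\<close>, and so does its derivative.\<close>
    interpret chart_domain "ch p" "fst (ch p) - K i"
      by unfold_locales (use c.chart c.open_W compact_imp_closed[OF K(1)] in \<open>auto intro: open_Diff\<close>)
    have "partial (ch p) k (\<eta> i) p = partial (ch p) k (\<lambda>_. 0) p" for k
      by (rule partial_cong) (use p ch supp[of i] in \<open>auto simp: supported_in_def\<close>)
    then show "\<delta> i p = 0" by (simp add: \<delta>_def c.partial_const)
  qed
  \<comment> \<open>The \<open>\<eta> i\<close> add up to the constant 1, whose derivative along
    \<open>V\<close> vanishes.\<close>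
  have sum_\<delta>: "(\<Sum>i\<in>I. \<delta> i p) = 0" for p
  proof -
    interpret c: whole_chart "ch p" by (rule whole_chart[OF ch(1)])
    have "(\<Sum>i\<in>I. \<delta> i p) = (\<Sum>k\<in>UNIV. (\<Sum>i\<in>I. partial (ch p) k (\<eta> i) p) * V (ch p) p $ k)"
      unfolding \<delta>_def by (subst sum.swap) (simp add: sum_distrib_right)
    also have "\<dots> = (\<Sum>k\<in>UNIV. partial (ch p) k (\<lambda>q. \<Sum>i\<in>I. \<eta> i q) p * V (ch p) p $ k)"
      using \<eta>(1) ch[of p] unfolding M_Ck_def by (subst c.partial_sum) auto
    also have "\<dots> = 0" by (simp add: \<eta>(3) c.partial_const)
    finally show ?thesis .
  qed
  \<comment> \<open>A function supported in one chart is cut into the pieces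
    \<open>\<eta> k p * v p\<close>. Each piece is supported in both \<open>c\<close> and
    \<open>cc k\<close>, so it may be integrated in its own chart \<open>cc k\<close>.\<close>
  have loc: "chart_integral c (\<lambda>p. v p * w c p) = (\<Sum>k\<in>I. chart_integral (cc k) (\<lambda>p. \<eta> k p * v p * w (cc k) p))"
    if c: "c \<in> A" and L: "compact L" "L \<subseteq> fst c" "supported_in L v" and v: "M_Ck 0 v" for c L v
  proof -
    interpret whole_chart c by (rule whole_chart[OF c])
    have "chart_integral c (\<lambda>p. v p * w c p) = chart_integral c (\<lambda>p. \<Sum>k\<in>I. \<eta> k p * v p * w c p)"
      by (simp add: sum_distrib_right[symmetric] \<eta>(3))
    also have "\<dots> = (\<Sum>k\<in>I. chart_integral c (\<lambda>p. \<eta> k p * v p * w c p))"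
      using L(3) by (intro chart_integral_sum[OF L(1,2)] Ck0_times_density[OF c] M_Ck_mult \<eta>0 v)
        (auto simp: supported_in_def)
    also have "\<dots> = (\<Sum>k\<in>I. chart_integral (cc k) (\<lambda>p. \<eta> k p * v p * w (cc k) p))"
    proof (intro sum.cong refl)
      fix k
      show "chart_integral c (\<lambda>p. \<eta> k p * v p * w c p) = chart_integral (cc k) (\<lambda>p. \<eta> k p * v p * w (cc k) p)"
        by (rule chart_integral_change[OF c cc, of "L \<inter> K k"])
          (use L K(1) subsetD[OF K(2)] supp[of k] v \<eta>0 in \<open>auto simp: supported_in_def
             intro: M_Ck_mult compact_Int_closed compact_imp_closed\<close>)
    qed
    finally show ?thesis .
  qed
  \<comment> \<open>Integration by parts in the chart \<open>cc i\<close>, without boundary term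
    since \<open>\<eta> i\<close> has compact support there.\<close>
  have parts: "chart_integral (cc i) (\<lambda>p. \<eta> i p * h p * w (cc i) p) =
      - chart_integral (cc i) (\<lambda>p. \<delta> i p * w (cc i) p)" for i
  proof -
    let ?c = "cc i"
    interpret whole_chart ?c by (rule whole_chart[OF cc])
    have "chart_integral ?c (\<lambda>p. \<eta> i p * (\<Sum>j\<in>UNIV. partial ?c j (\<lambda>q. (\<chi> j. w ?c q * V ?c q $ j) $ j) p) +
      (\<Sum>j\<in>UNIV. partial ?c j (\<eta> i) p * (\<chi> j. w ?c p * V ?c p $ j) $ j)) = 0"
      by (rule chart_integral_divergence[OF K supp])
        (use \<eta>(1)[of i] cc[of i] wV[OF cc] in \<open>auto simp: M_Ck_def\<close>)
    also have "chart_integral ?c (\<lambda>p. \<eta> i p * (\<Sum>j\<in>UNIV. partial ?c j (\<lambda>q. (\<chi> j. w ?c q * V ?c q $ j) $ j) p) +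
      (\<Sum>j\<in>UNIV. partial ?c j (\<eta> i) p * (\<chi> j. w ?c p * V ?c p $ j) $ j)) =
      chart_integral ?c (\<lambda>p. \<eta> i p * h p * w ?c p + \<delta> i p * w ?c p)"
      by (rule chart_integral_cong) (simp add: h[OF cc] \<delta>[OF cc] sum_distrib_left sum_distrib_right mult_ac)
    also have "\<dots> = chart_integral ?c (\<lambda>p. \<eta> i p * h p * w ?c p) + chart_integral ?c (\<lambda>p. \<delta> i p * w ?c p)"
      by (rule chart_integral_add[OF K])
        (use supp[of i] supp_\<delta>[of i] Ck0_times_density[OF cc] \<delta>0 M_Ck_mult[OF \<eta>0 h0] in \<open>auto simp: supported_in_def\<close>)
    finally show ?thesis by linarith
  qed
  \<comment> \<open>The functions \<open>\<delta> i\<close> live in different charts. Splitting each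
    by the partition and collecting by the chart \<open>cc k\<close> lets the sum over
    \<open>i\<close> be taken under one integral, where it vanishes.\<close>
  have "(\<Sum>i\<in>I. chart_integral (cc i) (\<lambda>p. \<eta> i p * h p * w (cc i) p)) =
      - (\<Sum>i\<in>I. \<Sum>k\<in>I. chart_integral (cc k) (\<lambda>p. \<eta> k p * \<delta> i p * w (cc k) p))"
    using loc[OF cc K supp_\<delta> \<delta>0] by (simp add: parts sum_negf)
  also have "(\<Sum>i\<in>I. \<Sum>k\<in>I. chart_integral (cc k) (\<lambda>p. \<eta> k p * \<delta> i p * w (cc k) p)) =
      (\<Sum>k\<in>I. \<Sum>i\<in>I. chart_integral (cc k) (\<lambda>p. \<eta> k p * \<delta> i p * w (cc k) p))"
    by (rule sum.swap)
  also have "\<dots> = (\<Sum>k\<in>I. chart_integral (cc k) (\<lambda>p. \<Sum>i\<in>I. \<eta> k p * \<delta> i p * w (cc k) p))"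
  proof (intro sum.cong refl)
    fix k
    interpret whole_chart "cc k" by (rule whole_chart[OF cc])
    show "(\<Sum>i\<in>I. chart_integral (cc k) (\<lambda>p. \<eta> k p * \<delta> i p * w (cc k) p)) =
      chart_integral (cc k) (\<lambda>p. \<Sum>i\<in>I. \<eta> k p * \<delta> i p * w (cc k) p)"
      by (rule chart_integral_sum[OF K, symmetric])
        (use supp[of k] Ck0_times_density[OF cc M_Ck_mult[OF \<eta>0 \<delta>0]] in \<open>auto simp: supported_in_def\<close>)
  qed
  also have "\<dots> = 0"
  proof -
    have "(\<Sum>i\<in>I. \<eta> k p * \<delta> i p * w (cc k) p) = \<eta> k p * (\<Sum>i\<in>I. \<delta> i p) * w (cc k) p" for k p
      by (simp add: sum_distrib_left sum_distrib_right)
    then show ?thesis by (simp add: sum_\<delta> chart_integral_def chart_extend_def)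
  qed
  finally have total: "(\<Sum>i\<in>I. chart_integral (cc i) (\<lambda>p. \<eta> i p * h p * w (cc i) p)) = 0" by simp
  have nonneg: "0 \<le> \<eta> i p * h p * w (cc i) p" if "p \<in> fst (cc i)" for i p
    using \<eta>(2) h_nonneg density_pos[OF cc that] by (simp add: less_imp_le)
  \<comment> \<open>All summands of the vanishing total are nonnegative, so each is zero; an index
    with \<open>\<eta> k p\<close> nonzero then detects \<open>h p\<close>.\<close>
  obtain k where k: "k \<in> I" "\<eta> k p \<noteq> 0"
    using \<eta>(3)[of p] by (metis sum.neutral zero_neq_one)
  interpret whole_chart "cc k" by (rule whole_chart[OF cc])
  have pk: "p \<in> fst (cc k)"
    using k(2) supp[of k] K(2)[of k] by (auto simp: supported_in_def)
  have "0 \<le> chart_integral (cc i) (\<lambda>p. \<eta> i p * h p * w (cc i) p)" for i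
    by (rule whole_chart.chart_integral_nonneg[OF whole_chart[OF cc]]) (rule nonneg)
  then have "\<forall>i\<in>I. chart_integral (cc i) (\<lambda>p. \<eta> i p * h p * w (cc i) p) = 0"
    using total sum_nonneg_eq_0_iff[OF I, of "\<lambda>i. chart_integral (cc i) (\<lambda>p. \<eta> i p * h p * w (cc i) p)"]
    by simp
  then have "\<eta> k p * h p * w (cc k) p = 0"
    by (intro chart_integral_nonneg_eq_0[OF K _ Ck0_times_density[OF cc M_Ck_mult[OF \<eta>0 h0]] nonneg _ pk])
      (use k supp[of k] in \<open>auto simp: supported_in_def\<close>)
  then show ?thesis using k(2) density_pos[OF cc pk] by simp
qed

end

section \<open>Linear algebra\<close>

lemma transpose_add: "transpose (A + B) = transpose A + transpose (B :: real ^ 'n ^ 'm)"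
  and transpose_diff: "transpose (A - B) = transpose A - transpose B"
  and transpose_minus: "transpose (- A) = - transpose A"
  by (simp_all add: transpose_def vec_eq_iff)

lemma matrix_minus_left: "(- A) ** B = - (A ** (B :: real ^ 'n ^ 'm))"
  and matrix_minus_right: "C ** (- B) = - (C ** B)"
  by (simp_all add: matrix_matrix_mult_def vec_eq_iff sum_negf)

lemma matrix_diff_ldistrib: "C ** (A - B) = C ** A - C ** (B :: real ^ 'n ^ 'm)"
  and matrix_diff_rdistrib: "(A - B) ** D = A ** D - B ** D"
  by (simp_all add: matrix_matrix_mult_def vec_eq_iff sum_subtractf algebra_simps)

lemma matrix_add_rdistrib': "(A + B) ** D = A ** D + B ** (D :: real ^ 'n ^ 'm)"
  by (simp add: matrix_matrix_mult_def vec_eq_iff sum.distrib algebra_simps)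

lemma matrix_vector_minus_left: "(- A) *v x = - (A *v (x :: real ^ 'n))"
  by (simp add: matrix_vector_mult_def vec_eq_iff sum_negf)

lemmas matrix_distribs = matrix_add_ldistrib matrix_add_rdistrib' matrix_diff_ldistrib matrix_diff_rdistrib
  matrix_minus_left matrix_minus_right transpose_add transpose_diff transpose_minus matrix_transpose_mul
  matrix_mul_assoc

lemma trace_transpose: "trace (transpose A) = trace A"
  by (simp add: trace_def transpose_def)

lemma trace_cyclic: "trace (A ** B) = trace (B ** (A :: real ^ 'n ^ 'n))"
  by (rule trace_mul_sym)

lemma matrix_inv_invertible:
  assumes "invertible (A :: real ^ 'n ^ 'n)"
  shows "A ** matrix_inv A = mat 1" "matrix_inv A ** A = mat 1"
  using someI_ex[OF assms[unfolded invertible_def]] by (auto simp: matrix_inv_def)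

lemma matrix_inv_unique:
  fixes A B :: "real ^ 'n ^ 'n"
  assumes "A ** B = mat 1"
  shows "matrix_inv A = B"
proof -
  have "invertible A" using assms invertible_right_inverse by blast
  then have "matrix_inv A ** (A ** B) = B"
    by (simp add: matrix_mul_assoc matrix_inv_invertible)
  then show ?thesis using assms by simp
qed

lemma transpose_matrix_inv:
  fixes A :: "real ^ 'n ^ 'n"
  assumes "invertible A" "transpose A = A"
  shows "transpose (matrix_inv A) = matrix_inv A"
proof -
  have "A ** transpose (matrix_inv A) = transpose (matrix_inv A ** A)"
    by (simp add: matrix_transpose_mul assms(2))
  also have "\<dots> = mat 1" by (simp add: matrix_inv_invertible assms(1))
  finally show ?thesis using matrix_inv_unique by metis
qed

text \<open>A polynomial of degree at most two in \<open>t\<close>. Evaluating it at well chosen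
  \<open>t\<close> replaces a discriminant argument in \<open>psd_rank_one_sum\<close>.\<close>

lemma quadratic_form_shift:
  fixes A :: "real ^ 'n ^ 'n"
  assumes "transpose A = A"
  shows "(x + t *\<^sub>R axis a 1) \<bullet> (A *v (x + t *\<^sub>R axis a 1)) =
    x \<bullet> (A *v x) + 2 * t * (A $ a \<bullet> x) + t\<^sup>2 * A $ a $ a"
proof -
  have "x \<bullet> (A *v axis a 1) = (transpose A *v x) \<bullet> axis a 1"
    by (simp add: dot_lmul_matrix)
  then have 1: "x \<bullet> (A *v axis a 1) = A $ a \<bullet> x"
    unfolding assms by (simp add: inner_axis matrix_vector_mul_component)
  have 2: "axis a 1 \<bullet> (A *v y) = A $ a \<bullet> y" for y
    by (simp add: inner_axis' matrix_vector_mul_component)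
  show ?thesis
    by (simp add: matrix_vector_right_distrib matrix_vector_mult_scaleR inner_add_left inner_add_right 1 2
        power2_eq_square inner_axis algebra_simps)
qed

text \<open>Symmetric Gaussian elimination: each step splits off the rank one matrix of one column.\<close>

lemma psd_rank_one_sum:
  fixes A :: "real ^ 'n::finite ^ 'n"
  assumes "finite S" "transpose A = A" "\<And>x. 0 \<le> x \<bullet> (A *v x)"
    "\<And>i j. i \<notin> S \<Longrightarrow> A $ i $ j = 0"
  shows "\<exists>b. \<forall>k l. A $ k $ l = (\<Sum>i\<in>S. b i k * b i l)"
  using assms
proof (induction S arbitrary: A rule: finite_induct)
  case empty
  then show ?case by simp
next
  case (insert a S)
  have sym: "A $ i $ j = A $ j $ i" for i j
    using arg_cong[OF insert.prems(1), of "\<lambda>M. M $ j $ i"] by (simp add: transpose_def)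
  let ?\<alpha> = "A $ a $ a"
  note shift = quadratic_form_shift[OF insert.prems(1), of _ _ a]
  have \<alpha>: "0 \<le> ?\<alpha>" using insert.prems(2)[of "0 + 1 *\<^sub>R axis a 1"] unfolding shift by simp
  show ?case
  proof (cases "?\<alpha> = 0")
    case True
    have row: "A $ a $ j = 0" for j
    proof (rule ccontr)
      assume ne: "A $ a $ j \<noteq> 0"
      let ?q = "axis j 1 \<bullet> (A *v axis j 1)"
      have "A $ a \<bullet> axis j 1 = A $ a $ j" by (simp add: inner_axis)
      \<comment> \<open>With a zero pivot the form is affine in \<open>t\<close>; this
        \<open>t\<close> would give it the value -1.\<close>
      then have "0 \<le> ?q + 2 * (- (?q + 1) / (2 * A $ a $ j)) * A $ a $ j"
        using insert.prems(2)[of "axis j 1 + (- (?q + 1) / (2 * A $ a $ j)) *\<^sub>R axis a 1"]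
        unfolding shift True by simp
      then show False using ne by (simp add: field_simps)
    qed
    have "\<exists>b. \<forall>k l. A $ k $ l = (\<Sum>i\<in>S. b i k * b i l)"
      by (rule insert.IH[OF insert.prems(1,2)]) (use row insert.prems(3) in \<open>metis insertE\<close>)
    then obtain b where b: "\<And>k l. A $ k $ l = (\<Sum>i\<in>S. b i k * b i l)" by blast
    have "A $ k $ l = (\<Sum>i\<in>insert a S. (b(a := \<lambda>_. 0)) i k * (b(a := \<lambda>_. 0)) i l)" for k l
      using insert.hyps b by (auto intro!: sum.cong)
    then show ?thesis by blast
  next
    case False
    \<comment> \<open>The Schur complement: subtracting the rank one matrix of row \<open>a\<close>,
      scaled by the pivot, clears row and column \<open>a\<close>.\<close>
    define A' where "A' = (\<chi> k l. A $ k $ l - A $ a $ k * A $ a $ l / ?\<alpha>)"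
    have form: "x \<bullet> (A' *v x) = x \<bullet> (A *v x) - (A $ a \<bullet> x)\<^sup>2 / ?\<alpha>" for x
    proof -
      have "A' *v x = A *v x - ((A $ a \<bullet> x) / ?\<alpha>) *\<^sub>R A $ a"
        by (simp add: A'_def vec_eq_iff matrix_vector_mult_def left_diff_distrib sum_subtractf
            inner_vec_def sum_distrib_left sum_divide_distrib right_diff_distrib mult_ac)
      then show ?thesis by (simp add: inner_diff_right power2_eq_square inner_commute)
    qed
    have "\<exists>b. \<forall>k l. A' $ k $ l = (\<Sum>i\<in>S. b i k * b i l)"
    proof (rule insert.IH)
      show "transpose A' = A'" by (simp add: A'_def transpose_def vec_eq_iff sym mult.commute)
      show "0 \<le> x \<bullet> (A' *v x)" for x
      proof -
        \<comment> \<open>The shift is by the minimiser of the quadratic polynomial in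
          \<open>t\<close>, and the minimum is the form of \<open>A'\<close>.\<close>
        have "x \<bullet> (A *v x) + 2 * (- (A $ a \<bullet> x) / ?\<alpha>) * (A $ a \<bullet> x) + (- (A $ a \<bullet> x) / ?\<alpha>)\<^sup>2 * ?\<alpha> =
            x \<bullet> (A *v x) - (A $ a \<bullet> x)\<^sup>2 / ?\<alpha>"
          using False by (simp add: field_simps power2_eq_square)
        then show ?thesis
          using insert.prems(2)[of "x + (- (A $ a \<bullet> x) / ?\<alpha>) *\<^sub>R axis a 1"] unfolding shift form by simp
      qed
      show "A' $ i $ j = 0" if "i \<notin> S" for i j
      proof (cases "i = a")
        case True
        then show ?thesis using False by (simp add: A'_def)
      next
        case False
        then have "A $ i $ l = 0" for l using insert.prems(3)[of i] that by simp
        then show ?thesis by (simp add: A'_def sym[of a i])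
      qed
    qed
    then obtain b where b: "\<And>k l. A' $ k $ l = (\<Sum>i\<in>S. b i k * b i l)" by blast
    define b' where "b' = b(a := \<lambda>k. A $ a $ k / sqrt ?\<alpha>)"
    have "A $ k $ l = (\<Sum>i\<in>insert a S. b' i k * b' i l)" for k l
    proof -
      have "(\<Sum>i\<in>S. b' i k * b' i l) = A' $ k $ l"
        unfolding b using insert.hyps by (intro sum.cong) (auto simp: b'_def)
      moreover have "b' a k * b' a l = A $ a $ k * A $ a $ l / ?\<alpha>"
        using \<alpha> by (simp add: b'_def)
      ultimately show ?thesis using insert.hyps by (simp add: A'_def)
    qed
    then show ?thesis by blast
  qed
qed

section \<open>Positive definite matrices\<close>

locale posdef_matrix =
  fixes G :: "real ^ 'n::finite ^ 'n"
  assumes symmetric: "transpose G = G" and posdef: "v \<noteq> 0 \<Longrightarrow> 0 < v \<bullet> (G *v v)"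
begin

lemma invertible_G: "invertible G"
proof -
  have "x = 0" if "G *v x = 0" for x using posdef[of x] that by force
  then show ?thesis
    using matrix_left_invertible_ker invertible_left_inverse by blast
qed

lemma square_root: obtains B :: "real ^ 'n ^ 'n" where "G = transpose B ** B" "invertible B"
proof -
  have "0 \<le> x \<bullet> (G *v x)" for x using posdef[of x] by (cases "x = 0") auto
  from psd_rank_one_sum[OF finite_class.finite_UNIV symmetric this]
  have "\<exists>b. \<forall>k l. G $ k $ l = (\<Sum>i\<in>(UNIV :: 'n set). b i k * b i l)" by simp
  then obtain b where b: "\<And>k l. G $ k $ l = (\<Sum>i\<in>(UNIV :: 'n set). b i k * b i l)" by blast
  define B :: "real ^ 'n ^ 'n" where "B = (\<chi> i k. b i k)"
  have G: "G = transpose B ** B"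
    by (simp add: vec_eq_iff matrix_matrix_mult_def transpose_def B_def b)
  then have "mat 1 = (matrix_inv G ** transpose B) ** B"
    using matrix_inv_invertible(2)[OF invertible_G] by (simp add: matrix_mul_assoc)
  then have "invertible B" by (metis invertible_left_inverse)
  then show thesis using G that by blast
qed

lemma det_pos: "0 < det G"
proof -
  obtain B :: "real ^ 'n ^ 'n" where B: "G = transpose B ** B" "invertible B" by (rule square_root)
  then show ?thesis
    by (auto simp: det_mul det_transpose invertible_det_nz zero_less_mult_iff linorder_neq_iff)
qed

text \<open>With G = B^T B and D the inverse of B one has P = D D^T. Cyclicity of the trace turns
  the expression into the sum of the squared entries of N = D^T L D, the matrix of L in an
  orthonormal frame; conversely L = B^T N B.\<close>

lemma trace_square:
  fixes L :: "real ^ 'n ^ 'n"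
  assumes L: "transpose L = L"
  defines "P \<equiv> matrix_inv G"
  shows "0 \<le> trace (P ** L ** P ** L)" "trace (P ** L ** P ** L) = 0 \<Longrightarrow> L = 0"
proof -
  obtain B :: "real ^ 'n ^ 'n" where B: "G = transpose B ** B" "invertible B" by (rule square_root)
  define D where "D = matrix_inv B"
  note BD = matrix_inv_invertible[OF B(2), folded D_def]
  have "transpose D ** transpose B = mat 1" "transpose B ** transpose D = mat 1"
    using BD by (simp_all add: matrix_transpose_mul[symmetric])
  note BDt = this
  have "G ** (D ** transpose D) = transpose B ** (B ** D) ** transpose D"
    by (simp add: B(1) matrix_mul_assoc)
  then have P: "P = D ** transpose D" unfolding P_def by (intro matrix_inv_unique) (simp add: BD BDt)
  define N where "N = transpose D ** L ** D"
  have N: "transpose N = N" by (simp add: N_def matrix_transpose_mul L matrix_mul_assoc)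
  have "P ** L ** P ** L = D ** (transpose D ** L ** D ** transpose D ** L)"
    by (simp add: P matrix_mul_assoc)
  then have "trace (P ** L ** P ** L) = trace (N ** N)"
    using trace_cyclic[of D "transpose D ** L ** D ** transpose D ** L"]
    by (simp add: N_def matrix_mul_assoc)
  also have "\<dots> = trace (transpose N ** N)" by (simp add: N)
  also have "\<dots> = (\<Sum>i\<in>UNIV. \<Sum>j\<in>UNIV. (N $ j $ i)\<^sup>2)"
    by (simp add: trace_def matrix_matrix_mult_def transpose_def power2_eq_square)
  finally have tr: "trace (P ** L ** P ** L) = (\<Sum>i\<in>UNIV. \<Sum>j\<in>UNIV. (N $ j $ i)\<^sup>2)" .
  show "0 \<le> trace (P ** L ** P ** L)" unfolding tr by (intro sum_nonneg) auto
  assume "trace (P ** L ** P ** L) = 0"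
  then have "N $ j $ i = 0" for i j
    unfolding tr by (simp add: sum_nonneg_eq_0_iff sum_nonneg)
  then have "N = 0" by (simp add: vec_eq_iff)
  moreover have "L = transpose B ** N ** B"
  proof -
    have "transpose B ** N ** B = (transpose B ** transpose D) ** L ** (D ** B)"
      by (simp add: N_def matrix_mul_assoc)
    then show ?thesis by (simp add: BD BDt)
  qed
  ultimately show "L = 0" by (simp add: matrix_matrix_mult_def vec_eq_iff)
qed

end

text \<open>Expand \<open>v\<close> in the rows of \<open>A\<close>, with coefficients
  \<open>v v* B\<close>; by multilinearity only the coefficient of row \<open>k\<close> survives.
  This evaluates the determinants in \<open>partial_det\<close>.\<close>

lemma det_replace_row:
  fixes A :: "real ^ 'n ^ 'n"
  assumes "A ** B = mat 1"
  shows "det (\<chi> i. if i = k then v else A $ i) = (\<Sum>m\<in>UNIV. v $ m * B $ m $ k) * det A"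
proof -
  have BA: "B ** A = mat 1" using assms matrix_left_right_inverse by blast
  have "(\<Sum>i\<in>UNIV. (v v* B) $ i *s row i A) = (v v* B) v* A"
    by (simp add: vec_eq_iff vector_matrix_mult_def row_def mult.commute)
  also have "\<dots> = v" by (simp add: vector_matrix_mul_assoc BA)
  finally have v: "(\<Sum>i\<in>UNIV. (v v* B) $ i *s row i A) = v" .
  have row: "row i A = A $ i" for i by (simp add: row_def vec_eq_iff)
  show ?thesis
    using cramer_lemma_transpose[of k "v v* B" A] unfolding v unfolding row
    by (simp add: vector_matrix_mult_def mult.commute)
qed

section \<open>Tensor calculus in matrix notation\<close>

definition partial_mat ::
    "('m, 'n::finite) chart \<Rightarrow> 'n \<Rightarrow> ('m \<Rightarrow> real ^ 'k ^ 'l) \<Rightarrow> 'm \<Rightarrow> real ^ 'k ^ 'l" where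
  "partial_mat c i F p = (\<chi> a b. partial c i (\<lambda>q. F q $ a $ b) p)"

definition partial_vec ::
    "('m, 'n::finite) chart \<Rightarrow> 'n \<Rightarrow> ('m \<Rightarrow> real ^ 'k) \<Rightarrow> 'm \<Rightarrow> real ^ 'k" where
  "partial_vec c i v p = (\<chi> a. partial c i (\<lambda>q. v q $ a) p)"

definition mat_smooth :: "('m, 'n::finite) chart \<Rightarrow> 'm set \<Rightarrow> ('m \<Rightarrow> real ^ 'k ^ 'l) \<Rightarrow> bool" where
  "mat_smooth c W F \<longleftrightarrow> (\<forall>a b. chart_smooth c W (\<lambda>q. F q $ a $ b))"

definition vec_smooth :: "('m, 'n::finite) chart \<Rightarrow> 'm set \<Rightarrow> ('m \<Rightarrow> real ^ 'k) \<Rightarrow> bool" where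
  "vec_smooth c W v \<longleftrightarrow> (\<forall>a. chart_smooth c W (\<lambda>q. v q $ a))"

lemma mat_smoothD: "mat_smooth c W F \<Longrightarrow> chart_smooth c W (\<lambda>q. F q $ a $ b)"
  and vec_smoothD: "vec_smooth c W v \<Longrightarrow> chart_smooth c W (\<lambda>q. v q $ a)"
  by (simp_all add: mat_smooth_def vec_smooth_def)

context chart_domain
begin

abbreviation "msmooth \<equiv> mat_smooth c W"
abbreviation "vsmooth \<equiv> vec_smooth c W"

lemma msmooth_mult:
  fixes F :: "'m \<Rightarrow> real ^ 'k::finite ^ 'l" and H :: "'m \<Rightarrow> real ^ 'o ^ 'k"
  shows "msmooth F \<Longrightarrow> msmooth H \<Longrightarrow> msmooth (\<lambda>q. F q ** H q)"
  by (simp add: mat_smooth_def matrix_matrix_mult_def smooth_sum smooth_mult)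

lemma msmooth_add: "msmooth F \<Longrightarrow> msmooth H \<Longrightarrow> msmooth (\<lambda>q. F q + H q)"
  by (simp add: mat_smooth_def smooth_add)

lemma msmooth_transpose: "msmooth F \<Longrightarrow> msmooth (\<lambda>q. transpose (F q))"
  by (simp add: mat_smooth_def transpose_def)

lemma vsmooth_mult:
  fixes F :: "'m \<Rightarrow> real ^ 'k::finite ^ 'l"
  shows "msmooth F \<Longrightarrow> vsmooth v \<Longrightarrow> vsmooth (\<lambda>q. F q *v v q)"
  by (simp add: mat_smooth_def vec_smooth_def matrix_vector_mult_def smooth_sum smooth_mult)

lemma vsmooth_partial: "vsmooth v \<Longrightarrow> vsmooth (partial_vec c i v)"
  by (simp add: vec_smooth_def partial_vec_def smooth_partial)

lemma partial_mat_const: "partial_mat c i (\<lambda>q. F) p = 0"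
  by (simp add: partial_mat_def partial_const vec_eq_iff)

lemma msmooth_cong: "(\<And>q. q \<in> W \<Longrightarrow> F q = H q) \<Longrightarrow> msmooth F \<Longrightarrow> msmooth H"
  unfolding mat_smooth_def using smooth_cong[of "\<lambda>q. F q $ _ $ _" "\<lambda>q. H q $ _ $ _"] by simp

context
  fixes p assumes p: "p \<in> W"
begin

lemma partial_mat_cong:
  assumes "\<And>q. q \<in> W \<Longrightarrow> F q = H q"
  shows "partial_mat c i F p = partial_mat c i H p"
  unfolding partial_mat_def vec_eq_iff vec_lambda_beta
  by (intro allI partial_cong[OF p]) (simp add: assms)

lemma partial_vec_cong:
  assumes "\<And>q. q \<in> W \<Longrightarrow> u q = v q"
  shows "partial_vec c i u p = partial_vec c i v p"
  unfolding partial_vec_def vec_eq_iff vec_lambda_beta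
  by (intro allI partial_cong[OF p]) (simp add: assms)

lemma partial_mat_mult:
  fixes F :: "'m \<Rightarrow> real ^ 'k::finite ^ 'l" and H :: "'m \<Rightarrow> real ^ 'o ^ 'k"
  assumes "msmooth F" "msmooth H"
  shows "partial_mat c i (\<lambda>q. F q ** H q) p = partial_mat c i F p ** H p + F p ** partial_mat c i H p"
proof -
  have "partial c i (\<lambda>q. \<Sum>k\<in>UNIV. F q $ a $ k * H q $ k $ b) p =
      (\<Sum>k\<in>UNIV. F p $ a $ k * partial c i (\<lambda>q. H q $ k $ b) p + partial c i (\<lambda>q. F q $ a $ k) p * H p $ k $ b)" for a b
    using assms
    by (subst partial_sum[OF p])
      (auto intro!: sum.cong partial_mult[OF p] chart_smooth_imp_Ck smooth_mult mat_smoothD)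
  then show ?thesis
    by (simp add: partial_mat_def matrix_matrix_mult_def vec_eq_iff sum.distrib)
qed

lemma partial_mat_add:
  "msmooth F \<Longrightarrow> msmooth H \<Longrightarrow> partial_mat c i (\<lambda>q. F q + H q) p = partial_mat c i F p + partial_mat c i H p"
  by (simp add: partial_mat_def vec_eq_iff partial_add[OF p] mat_smoothD chart_smooth_imp_Ck)

lemma partial_vec_add:
  "vsmooth u \<Longrightarrow> vsmooth v \<Longrightarrow> partial_vec c i (\<lambda>q. u q + v q) p = partial_vec c i u p + partial_vec c i v p"
  by (simp add: partial_vec_def vec_eq_iff partial_add[OF p] vec_smoothD chart_smooth_imp_Ck)

lemma partial_mat_transpose: "partial_mat c i (\<lambda>q. transpose (F q)) p = transpose (partial_mat c i F p)"
  by (simp add: partial_mat_def transpose_def vec_eq_iff)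

lemma partial_vec_mult:
  fixes F :: "'m \<Rightarrow> real ^ 'k::finite ^ 'l"
  assumes "msmooth F" "vsmooth v"
  shows "partial_vec c i (\<lambda>q. F q *v v q) p = partial_mat c i F p *v v p + F p *v partial_vec c i v p"
proof -
  note sF = mat_smoothD[OF assms(1)] and sv = vec_smoothD[OF assms(2)]
  have "partial c i (\<lambda>q. \<Sum>k\<in>UNIV. F q $ a $ k * v q $ k) p =
      (\<Sum>k\<in>UNIV. F p $ a $ k * partial c i (\<lambda>q. v q $ k) p + partial c i (\<lambda>q. F q $ a $ k) p * v p $ k)" for a
    by (subst partial_sum[OF p])
      (auto intro!: sum.cong partial_mult[OF p] chart_smooth_imp_Ck smooth_mult sF sv)
  then show ?thesis
    by (simp add: partial_mat_def partial_vec_def matrix_vector_mult_def vec_eq_iff sum.distrib)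
qed

lemma partial_vec_commute:
  "vsmooth v \<Longrightarrow> partial_vec c i (partial_vec c j v) p = partial_vec c j (partial_vec c i v) p"
  by (simp add: partial_vec_def vec_eq_iff partial_commute[OF p] vec_smoothD chart_smooth_imp_Ck)

text \<open>Jacobi's formula. The product rule in the Leibniz expansion replaces one row at a time
  by its derivative, and \<open>det_replace_row\<close> evaluates each resulting
  determinant.\<close>

lemma partial_det:
  fixes F :: "'m \<Rightarrow> real ^ 'k::finite ^ 'k"
  assumes F: "msmooth F" and inv: "F p ** B = mat 1"
  shows "partial c i (\<lambda>q. det (F q)) p = det (F p) * trace (partial_mat c i F p ** B)"
proof -
  let ?S = "{\<pi>. \<pi> permutes (UNIV :: 'k set)}"
  let ?D = "\<lambda>k. \<chi> j. if j = k then partial_mat c i F p $ k else F p $ j"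
  have C: "Ck (Suc 0) (\<lambda>q. F q $ a $ b)" for a b
    by (rule chart_smooth_imp_Ck[OF mat_smoothD[OF F]])
  have "partial c i (\<lambda>q. det (F q)) p =
      (\<Sum>\<pi>\<in>?S. partial c i (\<lambda>q. of_int (sign \<pi>) * (\<Prod>k\<in>UNIV. F q $ k $ \<pi> k)) p)"
    unfolding det_def by (rule partial_sum[OF p]) (intro Ck_mult Ck_const Ck_prod C)
  also have "\<dots> = (\<Sum>\<pi>\<in>?S. of_int (sign \<pi>) *
      (\<Sum>k\<in>UNIV. partial c i (\<lambda>q. F q $ k $ \<pi> k) p * (\<Prod>j\<in>UNIV - {k}. F p $ j $ \<pi> j)))"
    by (intro sum.cong refl)
      (simp add: partial_mult[OF p] Ck_const Ck_prod C partial_const partial_prod[OF p])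
  also have "\<dots> = (\<Sum>\<pi>\<in>?S. \<Sum>k\<in>UNIV. of_int (sign \<pi>) * (\<Prod>j\<in>UNIV. ?D k $ j $ \<pi> j))"
  proof (intro sum.cong refl)
    fix \<pi>
    have "(\<Prod>j\<in>UNIV. ?D k $ j $ \<pi> j) =
        partial c i (\<lambda>q. F q $ k $ \<pi> k) p * (\<Prod>j\<in>UNIV - {k}. F p $ j $ \<pi> j)" for k
      by (subst prod.remove[of _ k]) (auto simp: partial_mat_def intro!: prod.cong)
    then show "of_int (sign \<pi>) * (\<Sum>k\<in>UNIV. partial c i (\<lambda>q. F q $ k $ \<pi> k) p * (\<Prod>j\<in>UNIV - {k}. F p $ j $ \<pi> j)) =
        (\<Sum>k\<in>UNIV. of_int (sign \<pi>) * (\<Prod>j\<in>UNIV. ?D k $ j $ \<pi> j))"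
      by (simp add: sum_distrib_left)
  qed
  also have "\<dots> = (\<Sum>k\<in>UNIV. det (?D k))"
    unfolding det_def by (rule sum.swap)
  also have "\<dots> = (\<Sum>k\<in>UNIV. (\<Sum>m\<in>UNIV. partial_mat c i F p $ k $ m * B $ m $ k) * det (F p))"
    by (simp add: det_replace_row[OF inv])
  also have "\<dots> = det (F p) * trace (partial_mat c i F p ** B)"
    by (simp add: trace_def matrix_matrix_mult_def sum_distrib_left sum_distrib_right mult_ac)
  finally show ?thesis .
qed

end

end

text \<open>By Cramer's rule the entries of the inverse are quotients of determinants with smooth
  entries and nonzero denominator.\<close>

lemma mat_smooth_matrix_inv:
  fixes F :: "'m::t2_space \<Rightarrow> real ^ 'k::finite ^ 'k"
  assumes "chart_domain c W" "mat_smooth c W F" and inv: "\<And>q. q \<in> W \<Longrightarrow> invertible (F q)"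
  shows "mat_smooth c W (\<lambda>q. matrix_inv (F q))"
proof -
  interpret chart_domain c W by fact
  let ?N = "\<lambda>k l q. \<chi> i j. if j = k then axis l 1 $ i else F q $ i $ j"
  have det: "det (F q) \<noteq> 0" if "q \<in> W" for q
    using inv[OF that] by (simp add: invertible_det_nz)
  have eq: "det (?N k l q) / det (F q) = matrix_inv (F q) $ k $ l" if "q \<in> W" for q k l
  proof -
    have "F q *v (matrix_inv (F q) *v axis l 1) = axis l 1"
      by (simp add: matrix_vector_mul_assoc matrix_inv_invertible inv that)
    then have "matrix_inv (F q) *v axis l 1 = (\<chi> k. det (?N k l q) / det (F q))"
      using cramer[OF det[OF that], of "matrix_inv (F q) *v axis l 1" "axis l 1"] by simp
    then have "(matrix_inv (F q) *v axis l 1) $ k = det (?N k l q) / det (F q)" by simp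
    then show ?thesis
      by (simp add: matrix_vector_mult_def axis_def if_distrib cong: if_cong)
  qed
  have "smooth (\<lambda>q. ?N k l q $ i $ j)" for k l i j
    using assms(2) by (cases "j = k") (simp_all add: smooth_const mat_smoothD)
  then have "smooth (\<lambda>q. det (?N k l q) / det (F q))" for k l
    using assms(2) det by (intro smooth_divide smooth_det[OF assms(1)]) (auto simp: mat_smoothD)
  then show ?thesis
    unfolding mat_smooth_def
  proof (intro allI)
    show "smooth (\<lambda>q. matrix_inv (F q) $ k $ l)" for k l
      by (rule smooth_cong[OF eq[of _ k l] \<open>smooth (\<lambda>q. det (?N k l q) / det (F q))\<close>])
  qed
qed

section \<open>Levi-Civita calculus in one chart\<close>

locale metric_chart = whole_chart c for c :: "('m::t2_space, 'n::finite) chart" +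
  fixes g :: "('m, 'n) metric_field" and X :: "('m, 'n) vector_field"
  assumes smooth_g: "msmooth (g c)" and smooth_X: "vsmooth (X c)"
    and posdef_g: "\<And>q. q \<in> fst c \<Longrightarrow> posdef_matrix (g c q)"
begin

abbreviation "G \<equiv> g c"
abbreviation "P \<equiv> ginv g c"
abbreviation "dM \<equiv> partial_mat c"
abbreviation "dV \<equiv> partial_vec c"

text \<open>\<open>\<Gamma> k q $ m $ i\<close> is \<open>\<Gamma>\<^sup>m\<^sub>k\<^sub>i\<close>, \<open>nablaX q $ k $ i\<close> is \<open>\<nabla>\<^sub>k X\<^sup>i\<close> and \<open>nabla2X k q $ l $ i\<close> is \<open>\<nabla>\<^sub>k \<nabla>\<^sub>l X\<^sup>i\<close>.\<close>

definition \<Gamma> :: "'n \<Rightarrow> 'm \<Rightarrow> real ^ 'n ^ 'n" where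
  "\<Gamma> k q = (\<chi> m i. christoffel g c m k i q)"

definition nablaX :: "'m \<Rightarrow> real ^ 'n ^ 'n" where
  "nablaX q = (\<chi> k i. nabla_vec g c X k i q)"

definition nabla2X :: "'n \<Rightarrow> 'm \<Rightarrow> real ^ 'n ^ 'n" where
  "nabla2X k q = (\<chi> l i. nabla2_vec g c X k l i q)"

definition lieX :: "'m \<Rightarrow> real ^ 'n ^ 'n" where
  "lieX q = (\<chi> i j. lie_metric g c X i j q)"

lemma transpose_G: "q \<in> fst c \<Longrightarrow> transpose (G q) = G q"
  using posdef_g posdef_matrix.symmetric by blast

lemma G_sym: "q \<in> fst c \<Longrightarrow> G q $ i $ j = G q $ j $ i"
  using transpose_G[of q] by (simp add: transpose_def vec_eq_iff)

lemma GP: "q \<in> fst c \<Longrightarrow> G q ** P q = mat 1" and PG: "q \<in> fst c \<Longrightarrow> P q ** G q = mat 1"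
  using matrix_inv_invertible posdef_matrix.invertible_G[OF posdef_g] by (auto simp: ginv_def)

lemma transpose_P: "q \<in> fst c \<Longrightarrow> transpose (P q) = P q"
  using transpose_matrix_inv posdef_matrix.invertible_G[OF posdef_g] transpose_G by (auto simp: ginv_def)

lemma P_sym: "q \<in> fst c \<Longrightarrow> P q $ i $ j = P q $ j $ i"
  using transpose_P[of q] by (simp add: transpose_def vec_eq_iff)

lemma smooth_P: "msmooth P"
  unfolding ginv_def
  by (rule mat_smooth_matrix_inv[OF chart_domain_axioms smooth_g
        posdef_matrix.invertible_G[OF posdef_g]])

lemma smooth_\<Gamma>: "msmooth (\<Gamma> k)"
  unfolding mat_smooth_def \<Gamma>_def christoffel_def
  by (simp only: vec_lambda_beta)
    (intro allI smooth_intros mat_smoothD[OF smooth_g] mat_smoothD[OF smooth_P])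

lemma smooth_nablaX: "msmooth nablaX"
  using vec_smoothD[OF smooth_X] mat_smoothD[OF smooth_\<Gamma>]
  unfolding mat_smooth_def nablaX_def nabla_vec_def \<Gamma>_def vec_lambda_beta
  by (intro allI smooth_intros)

context
  fixes p assumes p: "p \<in> fst c"
begin

lemma dG_sym: "partial c k (\<lambda>q. G q $ i $ j) p = partial c k (\<lambda>q. G q $ j $ i) p"
  by (rule partial_cong[OF p]) (rule G_sym)

lemma \<Gamma>_sym: "\<Gamma> k p $ m $ i = \<Gamma> i p $ m $ k"
  using dG_sym by (simp add: \<Gamma>_def christoffel_def add.commute)

text \<open>\<open>Q\<close> collects the Christoffel symbols of the first kind; in the sum of
  \<open>Q\<close> and its transpose only the derivative in direction \<open>k\<close> survives. The
  identity is nabla g = 0 written with the connection terms on the right.\<close>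

lemma metric_compatible: "dM k G p = transpose (\<Gamma> k p) ** G p + G p ** \<Gamma> k p"
proof -
  define Q where "Q = (\<chi> l i. (1/2) * (partial c k (\<lambda>q. G q $ i $ l) p + partial c i (\<lambda>q. G q $ k $ l) p
      - partial c l (\<lambda>q. G q $ k $ i) p))"
  have "\<Gamma> k p = P p ** Q"
    by (simp add: \<Gamma>_def christoffel_def Q_def matrix_matrix_mult_def vec_eq_iff sum_distrib_left mult_ac)
  then have Q: "G p ** \<Gamma> k p = Q" by (simp add: matrix_mul_assoc GP p)
  have "transpose (\<Gamma> k p) ** G p = transpose Q"
    unfolding Q[symmetric] by (simp add: matrix_transpose_mul transpose_G p)
  moreover have "dM k G p = transpose Q + Q"
  proof -
    have "partial c k (\<lambda>q. G q $ i $ j) p = transpose Q $ i $ j + Q $ i $ j" for i j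
      using dG_sym[of k j i] by (simp add: Q_def transpose_def field_simps)
    then show ?thesis by (simp add: partial_mat_def vec_eq_iff)
  qed
  ultimately show ?thesis using Q by simp
qed

text \<open>Differentiate G P = 1 and multiply by P from the left; this expresses that the inverse
  metric is parallel.\<close>

lemma partial_P: "dM k P p = - (P p ** transpose (\<Gamma> k p)) - \<Gamma> k p ** P p"
proof -
  have "dM k G p ** P p + G p ** dM k P p = dM k (\<lambda>q. G q ** P q) p"
    by (rule partial_mat_mult[OF p smooth_g smooth_P, symmetric])
  also have "\<dots> = dM k (\<lambda>q. mat 1) p" by (rule partial_mat_cong[OF p]) (rule GP)
  finally have "G p ** dM k P p = - (dM k G p ** P p)"
    by (simp add: partial_mat_const add_eq_0_iff)
  then have "P p ** (G p ** dM k P p) = - (P p ** (dM k G p ** P p))"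
    by (simp add: matrix_minus_right)
  moreover have "P p ** (dM k G p ** P p) = P p ** transpose (\<Gamma> k p) ** (G p ** P p) + (P p ** G p) ** \<Gamma> k p ** P p"
    by (simp add: metric_compatible matrix_distribs)
  ultimately show ?thesis by (simp add: matrix_mul_assoc GP PG p)
qed

lemma nablaX_row: "nablaX p $ k = dV k (X c) p + \<Gamma> k p *v X c p"
  by (simp add: nablaX_def nabla_vec_def partial_vec_def \<Gamma>_def matrix_vector_mult_def vec_eq_iff)

lemma nabla2X_eq: "nabla2X k p = dM k nablaX p + nablaX p ** transpose (\<Gamma> k p) - transpose (\<Gamma> k p) ** nablaX p"
  by (simp add: nabla2X_def nabla2_vec_def nablaX_def partial_mat_def \<Gamma>_def matrix_matrix_mult_def
      transpose_def vec_eq_iff mult.commute)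

text \<open>Since the metric is parallel, lowering an index commutes with the covariant derivative,
  so nabla_i X_j is an entry of \<open>nablaX p ** G p\<close>.\<close>

lemma lieX_eq: "lieX p = nablaX p ** G p + transpose (nablaX p ** G p)"
proof -
  have "nabla_covec g c (flat g c X) i j p = (nablaX p ** G p) $ i $ j" for i j
  proof -
    have "partial c i (flat g c X j) p = dV i (\<lambda>q. G q *v X c q) p $ j"
      by (simp add: partial_vec_def flat_def[abs_def] matrix_vector_mult_def)
    moreover have "(\<Sum>m\<in>UNIV. christoffel g c m i j p * flat g c X m p) = (transpose (\<Gamma> i p) *v (G p *v X c p)) $ j"
      by (simp add: matrix_vector_mult_def transpose_def flat_def \<Gamma>_def del: transpose_matrix_vector)
    moreover have "dV i (\<lambda>q. G q *v X c q) p = transpose (\<Gamma> i p) *v (G p *v X c p) + G p *v (nablaX p $ i)"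
      by (simp add: partial_vec_mult[OF p smooth_g smooth_X] metric_compatible nablaX_row matrix_vector_right_distrib
          matrix_vector_mult_add_rdistrib matrix_vector_mul_assoc add_ac del: transpose_matrix_vector)
    moreover have "(G p *v (nablaX p $ i)) $ j = (nablaX p ** G p) $ i $ j"
      by (simp add: matrix_vector_mult_def matrix_matrix_mult_def G_sym[OF p, of j] mult.commute)
    ultimately show ?thesis unfolding nabla_covec_def by simp
  qed
  then show ?thesis
    by (simp add: lieX_def lie_metric_def vec_eq_iff transpose_def)
qed

lemma transpose_lieX: "transpose (lieX p) = lieX p"
  by (simp add: lieX_eq transpose_add add.commute)

lemma lie_metric_up_eq: "(\<chi> i j. lie_metric_up g c X i j p) = P p ** lieX p ** P p"
proof -
  have "P p ** lieX p ** P p = P p ** lieX p ** transpose (P p)" by (simp add: transpose_P p)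
  also have "\<dots> = (\<chi> i j. lie_metric_up g c X i j p)"
    by (simp add: vec_eq_iff lie_metric_up_def matrix_matrix_mult_def transpose_def lieX_def
        sum_distrib_left sum_distrib_right mult_ac) (subst sum.swap, simp)
  finally show ?thesis ..
qed

end

section \<open>Covariant derivatives of L and the weighted divergence identity\<close>

lemma smooth_lieX: "msmooth lieX"
  by (rule msmooth_cong[OF lieX_eq[symmetric]])
    (auto intro!: msmooth_add msmooth_transpose msmooth_mult smooth_nablaX smooth_g)

definition lie_up :: "'m \<Rightarrow> real ^ 'n" where
  "lie_up q = P q *v (lieX q *v X c q)"

lemma smooth_lie_up: "vsmooth lie_up"
  unfolding lie_up_def by (intro vsmooth_mult smooth_P smooth_lieX smooth_X)

context
  fixes p assumes p: "p \<in> fst c"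
begin

text \<open>The first two terms are nabla_k L, that is nabla_k nabla_i X_j + nabla_k nabla_j X_i;
  the last two are the connection terms of a tensor with two lower indices.\<close>

lemma partial_lieX:
  "dM k lieX p = nabla2X k p ** G p + G p ** transpose (nabla2X k p) + transpose (\<Gamma> k p) ** lieX p + lieX p ** \<Gamma> k p"
proof -
  let ?AG = "\<lambda>q. nablaX q ** G q"
  have sAG: "msmooth ?AG" by (intro msmooth_mult smooth_nablaX smooth_g)
  have dAG: "dM k ?AG p = nabla2X k p ** G p + transpose (\<Gamma> k p) ** (nablaX p ** G p) + (nablaX p ** G p) ** \<Gamma> k p"
    by (simp add: partial_mat_mult[OF p smooth_nablaX smooth_g] nabla2X_eq metric_compatible p matrix_distribs)
  have "dM k lieX p = dM k (\<lambda>q. ?AG q + transpose (?AG q)) p"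
    by (rule partial_mat_cong[OF p]) (rule lieX_eq)
  also have "\<dots> = dM k ?AG p + transpose (dM k ?AG p)"
    using p sAG by (simp add: partial_mat_add msmooth_transpose partial_mat_transpose)
  finally show ?thesis
    by (simp add: dAG lieX_eq p matrix_distribs transpose_G)
qed

text \<open>Product rule for P L X: the connection terms of adjacent factors cancel, and only that
  of the free upper index remains.\<close>

lemma partial_lie_up:
  "dV k lie_up p = - (\<Gamma> k p *v lie_up p)
     + (P p ** (nabla2X k p ** G p + G p ** transpose (nabla2X k p))) *v X c p + (P p ** lieX p) *v (nablaX p $ k)"
proof -
  have "lie_up = (\<lambda>q. (P q ** lieX q) *v X c q)"
    by (simp add: lie_up_def fun_eq_iff matrix_vector_mul_assoc)
  then have "dV k lie_up p = (dM k P p ** lieX p + P p ** dM k lieX p) *v X c p + (P p ** lieX p) *v dV k (X c) p"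
    by (simp add: partial_vec_mult[OF p _ smooth_X] msmooth_mult smooth_P smooth_lieX partial_mat_mult[OF p])
  then show ?thesis
    by (simp add: partial_P p partial_lieX nablaX_row lie_up_def matrix_distribs matrix_vector_mul_assoc
        matrix_vector_mult_add_rdistrib matrix_vector_mult_diff_rdistrib matrix_vector_right_distrib
        matrix_vector_minus_left)
qed

lemma nabla2X_row: "nabla2X j p $ l = dV j (\<lambda>q. nablaX q $ l) p + \<Gamma> j p *v (nablaX p $ l)
    - (\<Sum>m\<in>UNIV. \<Gamma> j p $ m $ l *\<^sub>R (nablaX p $ m))"
  by (simp add: nabla2X_eq p partial_mat_def partial_vec_def matrix_matrix_mult_def matrix_vector_mult_def
      transpose_def vec_eq_iff mult.commute)

text \<open>In the antisymmetrisation the second partial derivatives of \<open>X\<close> cancel by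
  Schwarz, and the term with nabla_m X cancels by symmetry of \<open>\<Gamma>\<close>. What remains
  is the curvature in matrix form applied to \<open>X\<close>.\<close>

lemma ricci_identity:
  "nabla2X j p $ l $ a - nabla2X l p $ j $ a = (\<Sum>m\<in>UNIV. riemann g c a m j l p * X c p $ m)"
proof -
  have row: "dV j (\<lambda>q. nablaX q $ l) p = dV j (dV l (X c)) p + dM j (\<Gamma> l) p *v X c p + \<Gamma> l p *v dV j (X c) p" for j l
  proof -
    have "dV j (\<lambda>q. nablaX q $ l) p = dV j (\<lambda>q. dV l (X c) q + \<Gamma> l q *v X c q) p"
      by (rule partial_vec_cong[OF p]) (rule nablaX_row)
    then show ?thesis
      by (simp add: partial_vec_add[OF p] partial_vec_mult[OF p] vsmooth_partial vsmooth_mult smooth_X smooth_\<Gamma>)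
  qed
  have "nabla2X j p $ l - nabla2X l p $ j =
     (dM j (\<Gamma> l) p - dM l (\<Gamma> j) p + \<Gamma> j p ** \<Gamma> l p - \<Gamma> l p ** \<Gamma> j p) *v X c p"
    unfolding nabla2X_row row
    by (simp add: nablaX_row p partial_vec_commute[OF p smooth_X, of j l] \<Gamma>_sym[OF p, of j _ l]
        matrix_vector_mul_assoc matrix_vector_mult_add_rdistrib matrix_vector_mult_diff_rdistrib
        matrix_vector_right_distrib)
  then have "(nabla2X j p $ l - nabla2X l p $ j) $ a =
     ((dM j (\<Gamma> l) p - dM l (\<Gamma> j) p + \<Gamma> j p ** \<Gamma> l p - \<Gamma> l p ** \<Gamma> j p) *v X c p) $ a"
    by simp
  then show ?thesis
    by (simp add: riemann_def partial_mat_def \<Gamma>_def matrix_matrix_mult_def matrix_vector_mult_def)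
qed

text \<open>Commuting the derivatives leaves the trace of \<open>nabla2X l p\<close>. Its two
  connection terms have equal traces, so it is the partial derivative of the divergence.\<close>

lemma contracted_ricci_identity:
  "(\<Sum>j\<in>UNIV. nabla2X j p $ l $ j) =
    partial c l (divergence g c X) p + (\<Sum>m\<in>UNIV. ricci g c m l p * X c p $ m)"
proof -
  have "(\<Sum>j\<in>UNIV. nabla2X j p $ l $ j) =
      (\<Sum>j\<in>UNIV. nabla2X l p $ j $ j + (\<Sum>m\<in>UNIV. riemann g c j m j l p * X c p $ m))"
    by (simp add: ricci_identity[symmetric])
  also have "\<dots> = (\<Sum>j\<in>UNIV. nabla2X l p $ j $ j) + (\<Sum>m\<in>UNIV. ricci g c m l p * X c p $ m)"
    unfolding sum.distrib ricci_def sum_distrib_right by (subst sum.swap) (rule refl)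
  also have "(\<Sum>j\<in>UNIV. nabla2X l p $ j $ j) = trace (nabla2X l p)"
    by (simp add: trace_def)
  also have "\<dots> = trace (dM l nablaX p)"
    by (simp add: nabla2X_eq p trace_add trace_sub trace_cyclic[of "nablaX p"])
  also have "\<dots> = partial c l (divergence g c X) p"
  proof -
    have "partial c l (\<lambda>q. \<Sum>i\<in>UNIV. nablaX q $ i $ i) p = (\<Sum>i\<in>UNIV. partial c l (\<lambda>q. nablaX q $ i $ i) p)"
      by (rule partial_sum[OF p]) (rule chart_smooth_imp_Ck[OF mat_smoothD[OF smooth_nablaX]])
    then show ?thesis
      by (simp add: trace_def partial_mat_def divergence_def[abs_def] nablaX_def)
  qed
  finally show ?thesis .
qed

end

definition volume :: "'m \<Rightarrow> real" where
  "volume q = sqrt (det (G q))"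

lemma smooth_volume: "smooth volume"
  unfolding volume_def
  by (rule smooth_sqrt[OF posdef_matrix.det_pos[OF posdef_g]
        smooth_det[OF chart_domain_axioms mat_smoothD[OF smooth_g]]])

text \<open>Jacobi's formula reduces the claim to the trace of P times the derivative of G. Metric
  compatibility makes this twice the trace of \<open>\<Gamma> k p\<close>, and the 2 cancels against
  the derivative of the square root.\<close>

lemma partial_volume:
  assumes p: "p \<in> fst c"
  shows "partial c k volume p = volume p * trace (\<Gamma> k p)"
proof -
  have pos: "0 < det (G p)" by (rule posdef_matrix.det_pos[OF posdef_g[OF p]])
  have sd: "smooth (\<lambda>q. det (G q))"
    by (rule smooth_det[OF chart_domain_axioms mat_smoothD[OF smooth_g]])
  have "trace (dM k G p ** P p) = trace (transpose (\<Gamma> k p) ** (G p ** P p)) + trace (G p ** (\<Gamma> k p ** P p))"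
    by (simp add: metric_compatible p matrix_distribs trace_add)
  also have "\<dots> = 2 * trace (\<Gamma> k p)"
    by (simp add: GP p trace_transpose trace_cyclic[of "G p"] matrix_mul_assoc[symmetric] PG)
  finally have tr: "trace (dM k G p ** P p) = 2 * trace (\<Gamma> k p)" .
  have "partial c k volume p = det (G p) * (2 * trace (\<Gamma> k p)) / (2 * sqrt (det (G p)))"
    unfolding volume_def[abs_def]
    by (simp add: partial_sqrt[OF p chart_smooth_imp_Ck[OF sd] pos] partial_det[OF p smooth_g GP[OF p]] tr)
  also have "\<dots> = volume p * trace (\<Gamma> k p)"
    using pos real_sqrt_mult_self[of "det (G p)"] by (simp add: volume_def field_simps)
  finally show ?thesis .
qed

definition yano :: "('m \<Rightarrow> real) \<Rightarrow> 'm \<Rightarrow> real ^ 'n" where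
  "yano f p = (\<chi> i. rough_laplacian g c X i p + grad g c (divergence g c X) i p
     + (\<Sum>j\<in>UNIV. ricci_up g c i j p * X c p $ j) + (\<Sum>j\<in>UNIV. partial c j f p * lie_metric_up g c X i j p))"

text \<open>Insert L = A G + (A G)^T with A = \<open>nablaX p\<close> for the last factor. Both
  summands have the same trace against the symmetric matrix P L P, which gives the factor 2.\<close>

lemma trace_lieX_nablaX:
  assumes p: "p \<in> fst c"
  shows "trace (P p ** lieX p ** P p ** lieX p) = 2 * (\<Sum>k\<in>UNIV. ((P p ** lieX p) *v (nablaX p $ k)) $ k)"
proof -
  let ?P = "P p" and ?L = "lieX p" and ?A = "nablaX p" and ?G = "G p"
  have "trace (?P ** ?L ** ?P ** ?L) = trace (?P ** ?L ** ?P ** ?A ** ?G) + trace (?P ** ?L ** (?P ** ?G) ** transpose ?A)"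
    by (subst (2) lieX_eq[OF p]) (simp add: matrix_distribs trace_add transpose_G p)
  also have "trace (?P ** ?L ** ?P ** ?A ** ?G) = trace (?G ** ?P ** ?L ** ?P ** ?A)"
    by (simp add: trace_cyclic[of "?P ** ?L ** ?P ** ?A"] matrix_mul_assoc)
  also have "\<dots> = trace (transpose (?L ** ?P ** ?A))" by (simp add: GP p trace_transpose)
  also have "\<dots> = trace (transpose ?A ** (?P ** ?L))"
    by (simp add: matrix_transpose_mul transpose_P transpose_lieX p matrix_mul_assoc)
  also have "\<dots> = trace ((?P ** ?L) ** transpose ?A)" by (rule trace_cyclic)
  finally show ?thesis
    by (simp add: PG p trace_def matrix_matrix_mult_def[of "?P ** ?L"] matrix_vector_mult_def transpose_def)
qed

text \<open>The derivative of the volume cancels the connection term in the divergence of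
  \<open>lie_up\<close>, the derivative of \<open>exp (f q)\<close> gives the term with
  \<open>f\<close>, the two second derivative terms of \<open>partial_lie_up\<close> give the rest
  of \<open>yano\<close>, and its last term gives the trace.\<close>

theorem weighted_divergence:
  assumes p: "p \<in> fst c" and f: "smooth f"
  shows "(\<Sum>j\<in>UNIV. partial c j (\<lambda>q. volume q * (exp (f q) * lie_up q $ j)) p) =
    volume p * (exp (f p) * (yano f p \<bullet> (G p *v X c p) + trace (P p ** lieX p ** P p ** lieX p) / 2))"
proof -
  let ?P = "P p" and ?L = "lieX p" and ?A = "nablaX p" and ?G = "G p" and ?X = "X c p" and ?N = "\<lambda>k. nabla2X k p"
  let ?x = "?G *v ?X"
  have prod: "partial c j (\<lambda>q. volume q * (exp (f q) * lie_up q $ j)) p =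
     volume p * exp (f p) * (trace (\<Gamma> j p) * lie_up p $ j + partial c j f p * lie_up p $ j + dV j lie_up p $ j)" for j
    using vec_smoothD[OF smooth_lie_up, of j]
    by (simp add: partial_mult[OF p] partial_exp[OF p] chart_smooth_imp_Ck smooth_intros f smooth_volume
        partial_volume p partial_vec_def algebra_simps)
  \<comment> \<open>Symmetry of \<open>\<Gamma>\<close> in the lower indices turns the contraction
    into the logarithmic derivative of the volume along \<open>lie_up\<close>.\<close>
  have gam: "(\<Sum>j\<in>UNIV. (\<Gamma> j p *v lie_up p) $ j) = (\<Sum>j\<in>UNIV. trace (\<Gamma> j p) * lie_up p $ j)"
  proof -
    have "(\<Sum>j\<in>UNIV. (\<Gamma> j p *v lie_up p) $ j) = (\<Sum>j\<in>UNIV. \<Sum>m\<in>UNIV. \<Gamma> m p $ j $ j * lie_up p $ m)"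
      using \<Gamma>_sym[OF p] by (simp add: matrix_vector_mult_def)
    also have "\<dots> = (\<Sum>m\<in>UNIV. trace (\<Gamma> m p) * lie_up p $ m)"
      by (subst sum.swap) (simp add: trace_def sum_distrib_right)
    finally show ?thesis .
  qed
  have PGsum: "(\<Sum>i\<in>UNIV. ?x $ i * ?P $ i $ j) = ?X $ j" for j
  proof -
    have "(\<Sum>i\<in>UNIV. ?x $ i * ?P $ i $ j) = (?P *v ?x) $ j"
      by (simp add: matrix_vector_mult_def P_sym[OF p, of _ j] mult.commute)
    then show ?thesis by (simp add: matrix_vector_mul_assoc PG p)
  qed
  have t1: "(\<Sum>i\<in>UNIV. ?x $ i * rough_laplacian g c X i p) = (\<Sum>k\<in>UNIV. ((?P ** (?N k ** ?G)) *v ?X) $ k)"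
  proof -
    have "((?P ** (?N k ** ?G)) *v ?X) $ k = (\<Sum>l\<in>UNIV. \<Sum>i\<in>UNIV. ?x $ i * (?P $ k $ l * ?N k $ l $ i))" for k
    proof -
      have "(?P ** (?N k ** ?G)) *v ?X = ?P *v (?N k *v ?x)" by (simp add: matrix_vector_mul_assoc matrix_mul_assoc)
      then show ?thesis by (simp add: matrix_vector_mult_def[of ?P] matrix_vector_mult_def[of "?N k"] sum_distrib_left mult_ac)
    qed
    then have "(\<Sum>k\<in>UNIV. ((?P ** (?N k ** ?G)) *v ?X) $ k) =
       (\<Sum>k\<in>UNIV. \<Sum>i\<in>UNIV. \<Sum>l\<in>UNIV. ?x $ i * (?P $ k $ l * ?N k $ l $ i))"
      by (simp only:) (intro sum.cong refl sum.swap)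
    also have "\<dots> = (\<Sum>i\<in>UNIV. \<Sum>k\<in>UNIV. \<Sum>l\<in>UNIV. ?x $ i * (?P $ k $ l * ?N k $ l $ i))"
      by (rule sum.swap)
    also have "\<dots> = (\<Sum>i\<in>UNIV. ?x $ i * rough_laplacian g c X i p)"
      by (simp add: rough_laplacian_def nabla2X_def sum_distrib_left)
    finally show ?thesis ..
  qed
  have t2: "(\<Sum>i\<in>UNIV. ?x $ i * grad g c (divergence g c X) i p) = (\<Sum>j\<in>UNIV. ?X $ j * partial c j (divergence g c X) p)"
    unfolding grad_def PGsum[symmetric] sum_distrib_left sum_distrib_right
    by (subst sum.swap) (simp add: mult_ac)
  \<comment> \<open>Both slots of the Ricci tensor are contracted with the same vector, so renaming
    the summation indices matches the index order of
    \<open>contracted_ricci_identity\<close>.\<close>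
  have t3: "(\<Sum>i\<in>UNIV. ?x $ i * (\<Sum>j\<in>UNIV. ricci_up g c i j p * ?X $ j)) =
      (\<Sum>j\<in>UNIV. ?X $ j * (\<Sum>m\<in>UNIV. ricci g c m j p * ?X $ m))"
  proof -
    have "(\<Sum>i\<in>UNIV. ?x $ i * (\<Sum>j\<in>UNIV. ricci_up g c i j p * ?X $ j)) =
        (\<Sum>i\<in>UNIV. \<Sum>j\<in>UNIV. \<Sum>k\<in>UNIV. ?x $ i * ?P $ i $ k * (ricci g c k j p * ?X $ j))"
      by (simp add: ricci_up_def sum_distrib_left sum_distrib_right mult_ac)
    also have "\<dots> = (\<Sum>j\<in>UNIV. \<Sum>k\<in>UNIV. \<Sum>i\<in>UNIV. ?x $ i * ?P $ i $ k * (ricci g c k j p * ?X $ j))"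
      by (rule sum.swap[THEN trans]) (intro sum.cong refl sum.swap)
    also have "\<dots> = (\<Sum>j\<in>UNIV. \<Sum>k\<in>UNIV. ?X $ k * (ricci g c k j p * ?X $ j))"
      by (simp only: sum_distrib_right[symmetric] PGsum)
    finally show ?thesis by (simp add: sum_distrib_left mult_ac)
  qed
  have t4: "(\<Sum>i\<in>UNIV. ?x $ i * (\<Sum>j\<in>UNIV. partial c j f p * lie_metric_up g c X i j p)) =
      (\<Sum>j\<in>UNIV. partial c j f p * lie_up p $ j)"
  proof -
    let ?T = "?P ** ?L ** ?P"
    have T: "lie_metric_up g c X i j p = ?T $ j $ i" for i j
    proof -
      have "transpose ?T = ?T" by (simp add: matrix_transpose_mul transpose_P transpose_lieX p matrix_mul_assoc)
      then have "transpose ?T $ i $ j = ?T $ i $ j" by (simp only:)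
      then have "?T $ j $ i = ?T $ i $ j" by (simp only: transpose_def vec_lambda_beta)
      then show ?thesis unfolding lie_metric_up_eq[OF p, symmetric] by simp
    qed
    have lie: "lie_up p = ?T *v ?x"
      by (simp add: lie_up_def matrix_vector_mul_assoc matrix_mul_assoc[symmetric] PG p)
    have lie': "lie_up p $ j = (\<Sum>i\<in>UNIV. ?T $ j $ i * ?x $ i)" for j
      unfolding lie by (simp only: matrix_vector_mult_def[of ?T] vec_lambda_beta)
    show ?thesis
      unfolding T lie' sum_distrib_left
      by (rule sum.swap[THEN trans]) (simp only: mult_ac)
  qed
  \<comment> \<open>The transposed second derivative contracts its derivative index with the
    component of \<open>X\<close>; it accounts for the gradient term and the Ricci term
    together.\<close>
  have t5: "(\<Sum>k\<in>UNIV. ((?P ** (?G ** transpose (?N k))) *v ?X) $ k) =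
      (\<Sum>j\<in>UNIV. ?X $ j * (partial c j (divergence g c X) p + (\<Sum>m\<in>UNIV. ricci g c m j p * ?X $ m)))"
  proof -
    have "((?P ** (?G ** transpose (?N k))) *v ?X) $ k = (\<Sum>l\<in>UNIV. ?X $ l * ?N k $ l $ k)" for k
      by (simp add: matrix_mul_assoc PG p matrix_vector_mult_def transpose_def mult.commute del: transpose_matrix_vector)
    then have "(\<Sum>k\<in>UNIV. ((?P ** (?G ** transpose (?N k))) *v ?X) $ k) = (\<Sum>l\<in>UNIV. ?X $ l * (\<Sum>k\<in>UNIV. ?N k $ l $ k))"
      by (simp add: sum_distrib_left) (rule sum.swap)
    then show ?thesis by (simp add: contracted_ricci_identity[OF p])
  qed
  have "yano f p \<bullet> ?x = (\<Sum>i\<in>UNIV. ?x $ i * rough_laplacian g c X i p) +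
      (\<Sum>i\<in>UNIV. ?x $ i * grad g c (divergence g c X) i p) +
      (\<Sum>i\<in>UNIV. ?x $ i * (\<Sum>j\<in>UNIV. ricci_up g c i j p * ?X $ j)) +
      (\<Sum>i\<in>UNIV. ?x $ i * (\<Sum>j\<in>UNIV. partial c j f p * lie_metric_up g c X i j p))"
    unfolding sum.distrib[symmetric] distrib_left[symmetric]
    by (simp add: yano_def inner_vec_def mult.commute)
  also have "\<dots> = (\<Sum>k\<in>UNIV. ((?P ** (?N k ** ?G)) *v ?X) $ k) + (\<Sum>k\<in>UNIV. ((?P ** (?G ** transpose (?N k))) *v ?X) $ k)
      + (\<Sum>j\<in>UNIV. partial c j f p * lie_up p $ j)"
    unfolding t1 t2 t3 t4 t5 by (simp add: distrib_left sum.distrib)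
  finally have yano: "yano f p \<bullet> ?x = \<dots>" .
  have "(\<Sum>j\<in>UNIV. dV j lie_up p $ j) = - (\<Sum>j\<in>UNIV. trace (\<Gamma> j p) * lie_up p $ j)
      + (\<Sum>k\<in>UNIV. ((?P ** (?N k ** ?G)) *v ?X) $ k) + (\<Sum>k\<in>UNIV. ((?P ** (?G ** transpose (?N k))) *v ?X) $ k)
      + (\<Sum>k\<in>UNIV. ((?P ** ?L) *v (?A $ k)) $ k)"
    by (simp only: partial_lie_up[OF p] matrix_add_ldistrib matrix_vector_mult_add_rdistrib
        vector_add_component vector_uminus_component sum.distrib sum_negf gam add_ac)
  then have "(\<Sum>j\<in>UNIV. trace (\<Gamma> j p) * lie_up p $ j + partial c j f p * lie_up p $ j + dV j lie_up p $ j) =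
     yano f p \<bullet> ?x + trace (?P ** ?L ** ?P ** ?L) / 2"
    unfolding trace_lieX_nablaX[OF p] yano sum.distrib by simp
  then show ?thesis
    unfolding prod sum_distrib_left[symmetric] by (simp add: mult.assoc)
qed

end

section \<open>Symmetry of the Ricci tensor, and the equation for Killing fields\<close>

lemma transpose_sum: "transpose (\<Sum>i\<in>I. M i) = (\<Sum>i\<in>I. transpose (M i :: real ^ 'n ^ 'm))"
  by (simp add: transpose_def vec_eq_iff)

context metric_chart
begin

text \<open>The only term of the Ricci curvature that is not visibly symmetric is \<open>\<partial>\<^sub>j \<Gamma>\<^sup>i\<^sub>i\<^sub>k\<close>, and
  \<open>\<Gamma>\<^sup>i\<^sub>i\<^sub>k\<close> is the logarithmic derivative of the volume density.\<close>

lemma ricci_sym: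
  assumes p: "p \<in> fst c"
  shows "ricci g c k j p = ricci g c j k p"
proof -
  have tr: "partial c j (\<lambda>q. trace (\<Gamma> k q)) p = (\<Sum>i\<in>UNIV. partial c j (\<lambda>q. \<Gamma> k q $ i $ i) p)" for j k
    unfolding trace_def
    by (rule partial_sum[OF p]) (rule chart_smooth_imp_Ck[OF mat_smoothD[OF smooth_\<Gamma>]])
  have st: "smooth (\<lambda>q. trace (\<Gamma> k q))" for k
    unfolding trace_def by (intro smooth_sum mat_smoothD[OF smooth_\<Gamma>])
  have vol: "0 < volume p"
    using posdef_matrix.det_pos[OF posdef_g[OF p]] by (simp add: volume_def)
  have "partial c j (partial c k volume) p = volume p * (partial c j (\<lambda>q. trace (\<Gamma> k q)) p + trace (\<Gamma> j p) * trace (\<Gamma> k p))" for j k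
  proof -
    have "partial c j (partial c k volume) p = partial c j (\<lambda>q. volume q * trace (\<Gamma> k q)) p"
      by (rule partial_cong[OF p]) (rule partial_volume)
    also have "\<dots> = volume p * partial c j (\<lambda>q. trace (\<Gamma> k q)) p + partial c j volume p * trace (\<Gamma> k p)"
      by (rule partial_mult[OF p]) (intro chart_smooth_imp_Ck smooth_volume st)+
    finally show ?thesis by (simp add: partial_volume[OF p] algebra_simps)
  qed
  note hess = this
  \<comment> \<open>The Hessian of the volume is symmetric; so is the product of traces in
    \<open>hess\<close>, and division by \<open>volume p\<close> leaves the claim.\<close>
  have tr_sym: "partial c j (\<lambda>q. trace (\<Gamma> k q)) p = partial c k (\<lambda>q. trace (\<Gamma> j q)) p"
    using partial_commute[OF p chart_smooth_imp_Ck[OF smooth_volume], of j k] vol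
    unfolding hess by (simp add: mult.commute)
  have \<Gamma>1: "partial c j (christoffel g c i k i) p = partial c j (christoffel g c i i k) p" for i j k
    by (rule partial_cong[OF p]) (use \<Gamma>_sym[of _ k i i] in \<open>simp add: \<Gamma>_def\<close>)
  have \<Gamma>2: "partial c i (christoffel g c i j k) p = partial c i (christoffel g c i k j) p" for i
    by (rule partial_cong[OF p]) (use \<Gamma>_sym[of _ j i k] in \<open>simp add: \<Gamma>_def\<close>)
  have second: "(\<Sum>i\<in>UNIV. partial c j (christoffel g c i i k) p) = partial c j (\<lambda>q. trace (\<Gamma> k q)) p" for j k
    unfolding tr by (rule sum.cong[OF refl]) (simp add: \<Gamma>_def \<Gamma>1[of j _ k])
  \<comment> \<open>Exchanging the names of the two summation indices interchanges the roles of
    \<open>j\<close> and \<open>k\<close>.\<close>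
  have "(\<Sum>i\<in>UNIV. \<Sum>m\<in>UNIV. \<Gamma> j p $ i $ m * \<Gamma> i p $ m $ k) = (\<Sum>i\<in>UNIV. \<Sum>m\<in>UNIV. \<Gamma> k p $ i $ m * \<Gamma> i p $ m $ j)"
    by (subst sum.swap) (simp add: \<Gamma>_sym[OF p, of _ _ k] \<Gamma>_sym[OF p, of j] mult.commute)
  moreover have "(\<Sum>i\<in>UNIV. \<Sum>m\<in>UNIV. \<Gamma> i p $ i $ m * \<Gamma> j p $ m $ k) = (\<Sum>i\<in>UNIV. \<Sum>m\<in>UNIV. \<Gamma> i p $ i $ m * \<Gamma> k p $ m $ j)"
    by (simp add: \<Gamma>_sym[OF p, of j])
  ultimately show ?thesis
    unfolding ricci_def riemann_def sum.distrib sum_subtractf second \<Gamma>2 tr_sym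
    by (simp add: \<Gamma>_def)
qed

text \<open>If L = 0 then nabla_k L = 0, so nabla_k nabla_l X_i is antisymmetric in \<open>l\<close>
  and \<open>i\<close>. Tracing over \<open>k\<close> and \<open>l\<close> makes the Laplacian minus
  the contraction treated by \<open>contracted_ricci_identity\<close>, which cancels the gradient
  and Ricci terms.\<close>

lemma killing_imp_yano:
  assumes lie: "\<And>q. q \<in> fst c \<Longrightarrow> lieX q = 0" and p: "p \<in> fst c"
  shows "yano f p = 0"
proof -
  let ?P = "P p" and ?G = "G p" and ?N = "\<lambda>k. nabla2X k p"
  have "dM k lieX p = dM k (\<lambda>q. 0) p" for k
    by (rule partial_mat_cong[OF p]) (rule lie)
  then have "?N k ** ?G + ?G ** transpose (?N k) = 0" for k
    using partial_lieX[OF p, of k] lie[OF p] by (simp add: partial_mat_const)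
  then have "?P ** (?N k ** ?G + ?G ** transpose (?N k)) ** ?P = 0" for k
    by simp
  \<comment> \<open>Multiplication by the inverse metric on both sides raises both indices, so the
    antisymmetry no longer contains G.\<close>
  then have N: "?P ** ?N k = - (transpose (?N k) ** ?P)" for k
    by (simp add: matrix_distribs PG p) (simp add: matrix_mul_assoc[symmetric] GP p eq_neg_iff_add_eq_0)
  have up: "lie_metric_up g c X i j p = 0" for i j
    using lie_metric_up_eq[OF p] lie[OF p] by (simp add: vec_eq_iff)
  show ?thesis
  proof (rule vec_eq_iff[THEN iffD2], rule allI)
    fix i
    have "rough_laplacian g c X i p = (\<Sum>k\<in>UNIV. (?P ** ?N k) $ k $ i)"
      by (simp add: rough_laplacian_def matrix_matrix_mult_def nabla2X_def)
    also have "\<dots> = - (\<Sum>k\<in>UNIV. \<Sum>l\<in>UNIV. ?N k $ l $ k * ?P $ l $ i)"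
      unfolding N by (simp add: matrix_matrix_mult_def transpose_def sum_negf)
    also have "\<dots> = - (\<Sum>l\<in>UNIV. ?P $ i $ l * (\<Sum>k\<in>UNIV. ?N k $ l $ k))"
      by (subst sum.swap) (simp add: sum_distrib_left P_sym[OF p, of _ i] mult.commute)
    also have "\<dots> = - grad g c (divergence g c X) i p - (\<Sum>l\<in>UNIV. ?P $ i $ l * (\<Sum>m\<in>UNIV. ricci g c m l p * X c p $ m))"
      by (simp add: contracted_ricci_identity[OF p] grad_def distrib_left sum.distrib)
    \<comment> \<open>Here \<open>l\<close>, the second index of \<open>ricci\<close>, is raised,
      whereas \<open>ricci_up\<close> raises the first one; \<open>ricci_sym\<close> reconciles the
      two.\<close>
    also have "(\<Sum>l\<in>UNIV. ?P $ i $ l * (\<Sum>m\<in>UNIV. ricci g c m l p * X c p $ m)) =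
        (\<Sum>m\<in>UNIV. ricci_up g c i m p * X c p $ m)"
      unfolding ricci_up_def sum_distrib_left sum_distrib_right
      by (subst sum.swap) (simp add: ricci_sym[OF p] mult_ac)
    finally show "yano f p $ i = 0 $ i"
      by (simp add: yano_def up)
  qed
qed

text \<open>The classical formula X^m d_m g_ij + g_mj d_i X^m + g_im d_j X^m. It contains no
  Christoffel symbols, so a change of chart can be computed without their transformation
  law.\<close>

lemma lieX_coordinates:
  assumes p: "p \<in> fst c"
  defines "DX \<equiv> \<chi> k. dV k (X c) p"
  shows "lieX p = (\<Sum>m\<in>UNIV. X c p $ m *\<^sub>R dM m G p) + DX ** G p + transpose (DX ** G p)"
proof -
  \<comment> \<open>The connection part of \<open>nablaX\<close>, with the lower indices of
    \<open>\<Gamma>\<close> exchanged so that \<open>X\<close> occupies the differentiation slot;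
    metric compatibility along \<open>X\<close> then applies.\<close>
  define B where "B = (\<chi> k i. \<Sum>m\<in>UNIV. X c p $ m * \<Gamma> m p $ i $ k)"
  have "nablaX p $ k = DX $ k + B $ k" for k
    by (simp add: nablaX_row[OF p] DX_def B_def vec_eq_iff matrix_vector_mult_def \<Gamma>_sym[OF p, of k] mult.commute)
  then have A: "nablaX p = DX + B" by (simp add: vec_eq_iff)
  have BG: "B ** G p = (\<Sum>m\<in>UNIV. X c p $ m *\<^sub>R (transpose (\<Gamma> m p) ** G p))"
    unfolding vec_eq_iff B_def
    by (simp add: matrix_matrix_mult_def transpose_def sum_distrib_left sum_distrib_right mult_ac)
      (intro allI sum.swap)
  have "transpose (B ** G p) = (\<Sum>m\<in>UNIV. X c p $ m *\<^sub>R (G p ** \<Gamma> m p))"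
    unfolding BG transpose_sum by (simp add: transpose_scalar matrix_transpose_mul transpose_G[OF p])
  then have "B ** G p + transpose (B ** G p) = (\<Sum>m\<in>UNIV. X c p $ m *\<^sub>R dM m G p)"
    by (simp add: BG metric_compatible[OF p] scaleR_add_right sum.distrib)
  then show ?thesis
    by (simp add: lieX_eq[OF p] A matrix_add_rdistrib' transpose_add add_ac)
qed

end

section \<open>Change of chart\<close>

lemma sum_scaleR_matrix_mult_left:
  "(\<Sum>i\<in>I. a i *\<^sub>R M i) ** B = (\<Sum>i\<in>I. a i *\<^sub>R (M i ** (B :: real ^ 'n ^ 'm)))"
  by (simp add: matrix_matrix_mult_def vec_eq_iff sum_distrib_left sum_distrib_right mult_ac)
    (intro allI sum.swap)

lemma sum_scaleR_matrix_mult_right: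
  "B ** (\<Sum>i\<in>I. a i *\<^sub>R M i) = (\<Sum>i\<in>I. a i *\<^sub>R ((B :: real ^ 'n ^ 'm) ** M i))"
  by (simp add: matrix_matrix_mult_def vec_eq_iff sum_distrib_left sum_distrib_right mult_ac)
    (intro allI sum.swap)

locale metric_overlap = chart_overlap c "fst c \<inter> fst d" d + mc: metric_chart c g X + md: metric_chart d g X
  for c d :: "('m::t2_space, 'n::finite) chart" and g :: "('m, 'n) metric_field" and X :: "('m, 'n) vector_field" +
  assumes g_change: "\<And>q. q \<in> fst c \<inter> fst d \<Longrightarrow>
      g c q = transpose (transition_jac c d q) ** g d q ** transition_jac c d q"
    and X_change: "\<And>q. q \<in> fst c \<inter> fst d \<Longrightarrow> X d q = transition_jac c d q *v X c q"
begin

lemma msmooth_J: "msmooth J"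
  by (simp add: mat_smooth_def smooth_transition_jac)

lemma msmooth_g_d: "msmooth (g d)"
  unfolding mat_smooth_def
  by (intro allI smooth_change chart_smooth_subset[OF mat_smoothD[OF md.smooth_g]]) auto

lemma vsmooth_X_c: "vsmooth (X c)"
  unfolding vec_smooth_def
  by (intro allI chart_smooth_subset[OF vec_smoothD[OF mc.smooth_X]]) auto

context
  fixes p assumes p: "p \<in> fst c \<inter> fst d"
begin

lemma partial_mat_change: "partial_mat c k (g d) p = (\<Sum>b\<in>UNIV. J p $ b $ k *\<^sub>R partial_mat d b (g d) p)"
proof -
  have "d.Ck (Suc 0) (\<lambda>q. g d q $ i $ j)" for i j
    by (rule chart_smooth_imp_Ck[OF chart_smooth_subset[OF mat_smoothD[OF md.smooth_g]]]) auto
  then show ?thesis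
    by (simp add: partial_mat_def vec_eq_iff partial_change[OF p])
qed

text \<open>\<open>H\<close> is the derivative of the Jacobian along \<open>X\<close>. It enters one
  side through the derivative of \<open>g c\<close> and the other through the derivative of
  \<open>X d\<close>; by symmetry of the second derivatives of the transition map the two
  contributions coincide.\<close>

lemma lieX_change: "mc.lieX p = transpose (J p) ** md.lieX p ** J p"
proof -
  let ?J = "J p" and ?G = "g d p" and ?X = "X c p"
  define H where "H = (\<Sum>m\<in>UNIV. ?X $ m *\<^sub>R partial_mat c m J p)"
  define S where "S = (\<Sum>b\<in>UNIV. X d p $ b *\<^sub>R partial_mat d b (g d) p)"
  define DXc where "DXc = (\<chi> k. partial_vec c k (X c) p)"
  define DXd where "DXd = (\<chi> k. partial_vec d k (X d) p)"
  have pc: "p \<in> fst c" and pd: "p \<in> fst d" using p by auto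
  have dG: "partial_mat c k (g c) p = transpose (partial_mat c k J p) ** (?G ** ?J)
      + transpose ?J ** partial_mat c k (g d) p ** ?J + transpose ?J ** ?G ** partial_mat c k J p" for k
  proof -
    have "partial_mat c k (g c) p = partial_mat c k (\<lambda>q. transpose (J q) ** g d q ** J q) p"
      by (rule partial_mat_cong[OF p g_change])
    then show ?thesis
      by (simp add: partial_mat_mult[OF p] partial_mat_transpose[OF p] msmooth_mult msmooth_transpose
          msmooth_J msmooth_g_d matrix_distribs)
  qed
  have mid: "(\<Sum>m\<in>UNIV. ?X $ m *\<^sub>R partial_mat c m (g d) p) = S"
  proof -
    have "(\<Sum>m\<in>UNIV. ?X $ m *\<^sub>R partial_mat c m (g d) p) =
        (\<Sum>b\<in>UNIV. \<Sum>m\<in>UNIV. (?J $ b $ m * ?X $ m) *\<^sub>R partial_mat d b (g d) p)"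
      unfolding partial_mat_change scaleR_sum_right by (subst sum.swap) (simp add: mult.commute)
    then show ?thesis
      unfolding S_def X_change[OF p] by (simp add: matrix_vector_mult_def scaleR_sum_left)
  qed
  have Ht: "transpose H = (\<Sum>m\<in>UNIV. ?X $ m *\<^sub>R transpose (partial_mat c m J p))"
    by (simp add: H_def transpose_sum transpose_scalar)
  have Sc: "(\<Sum>m\<in>UNIV. ?X $ m *\<^sub>R partial_mat c m (g c) p) =
      transpose H ** (?G ** ?J) + transpose ?J ** S ** ?J + transpose ?J ** ?G ** H"
    unfolding dG scaleR_add_right sum.distrib mid[symmetric] Ht unfolding H_def
    by (simp only: sum_scaleR_matrix_mult_left sum_scaleR_matrix_mult_right)
  have DX: "transpose ?J ** DXd = transpose H + DXc ** transpose ?J"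
  proof -
    have "(transpose ?J ** DXd) $ i $ a = (transpose H + DXc ** transpose ?J) $ i $ a" for i a
    proof -
      have C: "d.Ck (Suc 0) (\<lambda>q. X d q $ a)"
        by (rule chart_smooth_imp_Ck[OF chart_smooth_subset[OF vec_smoothD[OF md.smooth_X]]]) auto
      have "(transpose ?J ** DXd) $ i $ a = partial c i (\<lambda>q. X d q $ a) p"
        by (simp add: matrix_matrix_mult_def transpose_def DXd_def partial_vec_def partial_change[OF p C])
      also have "\<dots> = partial_vec c i (\<lambda>q. J q *v X c q) p $ a"
        unfolding partial_vec_def vec_lambda_beta by (rule partial_cong[OF p]) (simp add: X_change)
      also have "\<dots> = (\<Sum>m\<in>UNIV. partial c i (\<lambda>q. J q $ a $ m) p * ?X $ m) + (\<Sum>b\<in>UNIV. ?J $ a $ b * DXc $ i $ b)"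
        unfolding partial_vec_mult[OF p msmooth_J vsmooth_X_c]
        by (simp add: matrix_vector_mult_def partial_mat_def DXc_def)
      also have "(\<Sum>m\<in>UNIV. partial c i (\<lambda>q. J q $ a $ m) p * ?X $ m) = H $ a $ i"
        unfolding partial_transition_jac_commute[OF p, of i]
        by (simp add: H_def partial_mat_def mult.commute)
      finally show ?thesis
        by (simp add: transpose_def matrix_matrix_mult_def mult.commute)
    qed
    then show ?thesis by (simp add: vec_eq_iff)
  qed
  have lc: "mc.lieX p = (\<Sum>m\<in>UNIV. ?X $ m *\<^sub>R partial_mat c m (g c) p) + DXc ** g c p + transpose (DXc ** g c p)"
    unfolding DXc_def by (rule mc.lieX_coordinates[OF pc])
  have ld: "md.lieX p = S + DXd ** ?G + transpose (DXd ** ?G)"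
    unfolding DXd_def S_def by (rule md.lieX_coordinates[OF pd])
  have "transpose ?J ** (DXd ** ?G) ** ?J = transpose H ** (?G ** ?J) + DXc ** g c p"
    by (simp add: matrix_mul_assoc DX g_change[OF p] matrix_add_rdistrib')
  moreover from arg_cong[OF this, of transpose]
  have "transpose ?J ** transpose (DXd ** ?G) ** ?J = transpose ?J ** ?G ** H + transpose (DXc ** g c p)"
    by (simp add: matrix_transpose_mul transpose_add md.transpose_G[OF pd] matrix_mul_assoc)
  ultimately show ?thesis
    unfolding lc ld Sc matrix_add_ldistrib matrix_add_rdistrib' by simp
qed

text \<open>For square matrices a left inverse is a right inverse, so the factors of a product equal
  to the identity may be rotated; rotating P J^T G J twice exhibits the inverse of
  \<open>g d p\<close>.\<close>

lemma ginv_change: "J p ** ginv g c p ** transpose (J p) = ginv g d p"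
proof -
  let ?J = "J p" and ?P = "ginv g c p"
  have pc: "p \<in> fst c" and pd: "p \<in> fst d" using p by auto
  have "?P ** (transpose ?J ** g d p ** ?J) = mat 1"
    using mc.PG[OF pc] by (simp add: g_change[OF p])
  then have "(?P ** transpose ?J ** g d p) ** ?J = mat 1" by (simp add: matrix_mul_assoc)
  then have "?J ** (?P ** transpose ?J ** g d p) = mat 1"
    using matrix_left_right_inverse by blast
  then have "(?J ** ?P ** transpose ?J) ** g d p = mat 1" by (simp add: matrix_mul_assoc)
  then have "g d p ** (?J ** ?P ** transpose ?J) = mat 1"
    using matrix_left_right_inverse by blast
  from matrix_inv_unique[OF this] show ?thesis by (simp add: ginv_def)
qed

lemma lie_up_change: "md.lie_up p = J p *v mc.lie_up p"
  by (simp add: mc.lie_up_def md.lie_up_def lieX_change X_change[OF p] ginv_change[symmetric]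
      matrix_vector_mul_assoc matrix_mul_assoc)

lemma volume_change: "mc.volume p = \<bar>det (J p)\<bar> * md.volume p"
proof -
  have "det (g c p) = (det (J p))\<^sup>2 * det (g d p)"
    unfolding g_change[OF p] det_mul det_transpose power2_eq_square by (simp only: mult_ac)
  then show ?thesis by (simp add: mc.volume_def md.volume_def real_sqrt_mult)
qed

text \<open>Moving the last Jacobian to the front by cyclicity completes each P to J P J^T. This
  makes the squared norm of L a function on the manifold.\<close>

lemma trace_lieX_change:
  "trace (ginv g c p ** mc.lieX p ** ginv g c p ** mc.lieX p) =
    trace (ginv g d p ** md.lieX p ** ginv g d p ** md.lieX p)"
proof -
  let ?J = "J p" and ?P = "ginv g c p" and ?L = "md.lieX p"
  have "trace (?P ** mc.lieX p ** ?P ** mc.lieX p) =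
      trace ((?P ** transpose ?J ** ?L ** ?J ** ?P ** transpose ?J ** ?L) ** ?J)"
    by (simp add: lieX_change matrix_mul_assoc)
  also have "\<dots> = trace (?J ** (?P ** transpose ?J ** ?L ** ?J ** ?P ** transpose ?J ** ?L))"
    by (rule trace_cyclic)
  finally show ?thesis by (simp add: ginv_change[symmetric] matrix_mul_assoc)
qed

end

end

section \<open>Killing fields on closed manifolds\<close>

lemma metric_chartI:
  assumes A: "smooth_atlas A" "riemannian_metric A g" "smooth_vector_field A X" and c: "c \<in> A"
  shows "metric_chart c g X"
proof -
  have chart: "is_chart c" using A(1) c by (simp add: smooth_atlas_def)
  interpret whole_chart c by (rule whole_chartI[OF chart])
  show ?thesis
  proof (rule metric_chart.intro[OF whole_chart_axioms metric_chart_axioms.intro])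
    have g: "smooth_on (snd c ` fst c) (g c \<circ> inv_chart c)"
      using A(2) c by (simp add: riemannian_metric_def)
    have X: "smooth_on (snd c ` fst c) (X c \<circ> inv_chart c)"
      using A(3) c by (simp add: smooth_vector_field_def)
    have "chart_smooth c (fst c) (\<lambda>q. g c q $ i $ j)" for i j
      using chart_smooth_components[OF chart g
          bounded_linear_compose[OF bounded_linear_vec_nth[of j] bounded_linear_vec_nth[of i]]] .
    then show "msmooth (g c)" by (simp add: mat_smooth_def)
    show "vsmooth (X c)"
      unfolding vec_smooth_def
      by (rule allI) (rule chart_smooth_components[OF chart X bounded_linear_vec_nth])
    show "posdef_matrix (g c q)" if "q \<in> fst c" for q
    proof (rule posdef_matrix.intro)
      show "transpose (g c q) = g c q"
        using A(2) c that unfolding riemannian_metric_def by blast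
      show "0 < v \<bullet> (g c q *v v)" if "v \<noteq> 0" for v
        using A(2) c \<open>q \<in> fst c\<close> that unfolding riemannian_metric_def by blast
    qed
  qed
qed

lemma metric_overlapI:
  assumes A: "smooth_atlas A" "riemannian_metric A g" "smooth_vector_field A X" and cd: "c \<in> A" "d \<in> A"
  shows "metric_overlap c d g X"
proof -
  interpret mc: metric_chart c g X by (rule metric_chartI[OF A cd(1)])
  interpret md: metric_chart d g X by (rule metric_chartI[OF A cd(2)])
  interpret chart_overlap c "fst c \<inter> fst d" d
  proof
    show "open (fst c \<inter> fst d)" using mc.open_W md.open_W by (rule open_Int)
    show "smooth_on (snd c ` (fst c \<inter> fst d)) (transition c d)"
      using A(1) cd by (simp add: smooth_atlas_def)
  qed (use mc.chart md.chart in auto)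
  show ?thesis
  proof
    fix q assume q: "q \<in> fst c \<inter> fst d"
    show "g c q = transpose (transition_jac c d q) ** g d q ** transition_jac c d q"
      using A(2) cd q unfolding riemannian_metric_def by blast
    show "X d q = transition_jac c d q *v X c q"
      using A(3) cd q unfolding smooth_vector_field_def by blast
  qed
qed

theorem theorem3p1:
  fixes A :: "('m::{t2_space, second_countable_topology}, 'n::finite) chart set"
    and g :: "('m, 'n) metric_field"
    and f :: "'m \<Rightarrow> real"
    and X :: "('m, 'n) vector_field"
  assumes "compact (UNIV :: 'm set)"
    and "smooth_atlas A"
    and "orientable_atlas A"
    and "riemannian_metric A g"
    and "smooth_function A f"
    and "smooth_vector_field A X"
  shows "killing A g X \<longleftrightarrow>
    (\<forall>c\<in>A. \<forall>p\<in>fst c. \<forall>i.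
       0 = rough_laplacian g c X i p + grad g c (divergence g c X) i p
           + (\<Sum>j\<in>UNIV. ricci_up g c i j p * X c p $ j)
           + (\<Sum>j\<in>UNIV. partial c j f p * lie_metric_up g c X i j p))"
    (is "_ \<longleftrightarrow> (\<forall>c\<in>A. \<forall>p\<in>fst c. \<forall>i. 0 = ?E c p i)")
proof -
  note data = assms(2,4,6)
  note mc = metric_chartI[OF data] and mo = metric_overlapI[OF data]
  let ?L = "\<lambda>c. metric_chart.lieX c g X" and ?w = "\<lambda>c. metric_chart.volume c g"
  let ?tr = "\<lambda>c p. trace (ginv g c p ** ?L c p ** ginv g c p ** ?L c p)"
  have killing: "killing A g X \<longleftrightarrow> (\<forall>c\<in>A. \<forall>p\<in>fst c. ?L c p = 0)"
    using metric_chart.lieX_def[OF mc] by (simp add: killing_def vec_eq_iff)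
  have yano: "metric_chart.yano c g X f p $ i = ?E c p i" if "c \<in> A" for c p i
    using metric_chart.yano_def[OF mc[OF that]] by simp
  have f: "chart_smooth c (fst c) f" if "c \<in> A" for c
    using assms(5) that by (simp add: smooth_function_def smooth_on_def chart_smooth_def chart_Ck_def comp_def)
  show ?thesis
  proof
    assume "killing A g X"
    then have yano0: "metric_chart.yano c g X f p = 0" if "c \<in> A" "p \<in> fst c" for c p
      using metric_chart.killing_imp_yano[OF mc[OF that(1)]] that killing by blast
    then show "\<forall>c\<in>A. \<forall>p\<in>fst c. \<forall>i. 0 = ?E c p i"
    proof (intro ballI allI)
      show "0 = ?E c p i" if "c \<in> A" "p \<in> fst c" for c p i
        using yano0[OF that] yano[OF that(1), of p i] by simp
    qed
  next
    assume eq: "\<forall>c\<in>A. \<forall>p\<in>fst c. \<forall>i. 0 = ?E c p i"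
    have yano0: "metric_chart.yano c g X f p = 0" if "c \<in> A" "p \<in> fst c" for c p
      using eq that yano[OF that(1)] by (simp add: vec_eq_iff)
    interpret density_manifold A ?w
    proof
      show "compact (UNIV :: 'm set)" "smooth_atlas A" by fact+
      fix c d and p :: 'm assume c: "c \<in> A"
      then interpret c: metric_chart c g X by (rule mc)
      show "c.Ck (Suc 0) (?w c)" by (rule chart_smooth_imp_Ck[OF c.smooth_volume])
      show "0 < ?w c p" if "p \<in> fst c"
        using posdef_matrix.det_pos[OF c.posdef_g[OF that]] by (simp add: c.volume_def)
      show "?w c p = \<bar>det (transition_jac c d p)\<bar> * ?w d p" if "d \<in> A" "p \<in> fst c" "p \<in> fst d"
        using metric_overlap.volume_change[OF mo[OF c that(1)]] that(2,3) by simp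
    qed
    \<comment> \<open>The field whose divergence is integrated; the weight \<open>exp (f p)\<close>
      is a scalar, so \<open>V\<close> transforms as \<open>lie_up\<close> does.\<close>
    define V where "V c p = exp (f p) *\<^sub>R metric_chart.lie_up c g X p" for c p
    \<comment> \<open>The trace is computed in some chart at \<open>p\<close>, which is legitimate
      by its chart independence.\<close>
    define h where "h p = (let c = SOME c. c \<in> A \<and> p \<in> fst c in exp (f p) * (?tr c p / 2))" for p
    have h: "h p = exp (f p) * (?tr c p / 2)" if "c \<in> A" "p \<in> fst c" for c p
    proof -
      define d where "d = (SOME c. c \<in> A \<and> p \<in> fst c)"
      have "d \<in> A \<and> p \<in> fst d" unfolding d_def by (rule someI[of _ c]) (use that in simp)
      then have "?tr c p = ?tr d p"
        using metric_overlap.trace_lieX_change[OF mo[OF that(1)]] that(2) by blast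
      then show ?thesis by (simp add: h_def Let_def d_def)
    qed
    have h_nonneg: "0 \<le> h p" for p
    proof -
      obtain c where c: "c \<in> A" "p \<in> fst c" by (rule chart_at)
      interpret c: metric_chart c g X by (rule mc[OF c(1)])
      show ?thesis
        unfolding h[OF c]
        using posdef_matrix.trace_square(1)[OF c.posdef_g c.transpose_lieX] c(2) by (simp add: ginv_def)
    qed
    have h0: "h p = 0" for p
    proof (rule nonneg_divergence_eq_0[of V h])
      show "0 \<le> h p" for p by (rule h_nonneg)
      fix c d :: "('m, 'n) chart" and p i assume c: "c \<in> A"
      then interpret c: metric_chart c g X by (rule mc)
      have "c.smooth (\<lambda>q. exp (f q) * c.lie_up q $ i)"
        by (intro c.smooth_mult c.smooth_exp f[OF c] vec_smoothD[OF c.smooth_lie_up])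
      then show "c.Ck (Suc 0) (\<lambda>q. V c q $ i)" by (simp add: V_def chart_smooth_imp_Ck)
      show "V d p = transition_jac c d p *v V c p" if "d \<in> A" "p \<in> fst c" "p \<in> fst d"
        using metric_overlap.lie_up_change[OF mo[OF c that(1)], of p] that(2,3)
        by (simp add: V_def matrix_vector_mult_scaleR)
      \<comment> \<open>The equation removes the \<open>yano\<close> term of the weighted
        divergence, leaving half the squared norm of L times the weight.\<close>
      show "(\<Sum>j\<in>UNIV. partial c j (\<lambda>q. ?w c q * V c q $ j) p) = h p * ?w c p" if "p \<in> fst c"
        using c.weighted_divergence[OF that f[OF c]] by (simp add: V_def yano0[OF c that] h[OF c that])
    qed
    have "?L c p = 0" if c: "c \<in> A" "p \<in> fst c" for c p
    proof -
      interpret c: metric_chart c g X by (rule mc[OF c(1)])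
      have "?tr c p = 0" using h0[of p] h[OF c] by simp
      then show ?thesis
        using posdef_matrix.trace_square(2)[OF c.posdef_g[OF c(2)] c.transpose_lieX[OF c(2)]]
        by (simp add: ginv_def)
    qed
    then show "killing A g X" by (simp add: killing)
  qed
qed

end
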